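(* Any Einstein solvmanifold is standard. That is: let $S$ be a simply connected solvable (real, finite-dimensional) Lie group endowed with a left invariant Riemannian metric, let $\mathfrak{s}$ be its Lie algebra, let $\langle\cdot,\cdot\rangle$ be the inner product on $\mathfrak{s}$ determined by the metric, and let $\mathfrak{s}=\mathfrak{a}\oplus\mathfrak{n}$ be the orthogonal decomposition with $\mathfrak{n}=[\mathfrak{s},\mathfrak{s}]$. If the Ricci operator of $S$ satisfies $\operatorname{Ric}=cI$ for some $c\in\mathbb{R}$, then $[\mathfrak{a},\mathfrak{a}]=0$.
   Context: A solvmanifold is a simply connected solvable Lie group $S$ endowed with a left invariant Riemannian metric. With $\mathfrak{s}$ its Lie algebra, $\langle\cdot,\cdot\rangle$ the inner product on $\mathfrak{s}$ given by the metric, $\mathfrak{n}=[\mathfrak{s},\mathfrak{s}]$ and $\mathfrak{a}$ the orthogonal complement of $\mathfrak{n}$ in $\mathfrak{s}$, the solvmanifold is called standard if $[\mathfrak{a},\mathfrak{a}]=0$. It is called Einstein if its Ricci operator equals $cI$ for some $c\in\mathbb{R}$. The Ricci operator, viewed as a symmetric operator on $(\mathfrak{s},\langle\cdot,\cdot\rangle)$, is given by $\operatorname{Ric}=R-\tfrac12 B-S(\operatorname{ad}H)$, where: $B$ is the symmetric operator representing the Killing form of $\mathfrak{s}$ with respect to $\langle\cdot,\cdot\rangle$; $H\in\mathfrak{a}$ is the unique element with $\langle H,A\rangle=\operatorname{tr}(\operatorname{ad}A)$ for all $A\in\mathfrak{a}$; $S(\operatorname{ad}H)=\tfrac12(\operatorname{ad}H+(\operatorname{ad}H)^t)$;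 and $R$ is the symmetric operator with $$\langle Rx,y\rangle=-\tfrac12\sum_{i,j}\langle[x,x_i],x_j\rangle\langle[y,x_i],x_j\rangle+\tfrac14\sum_{i,j}\langle[x_i,x_j],x\rangle\langle[x_i,x_j],y\rangle,\qquad x,y\in\mathfrak{s},$$ for any orthonormal basis $\{x_i\}$ of $\mathfrak{s}$. *)

theory Defs
  imports "HOL-Analysis.Analysis"
begin

section \<open>Smooth manifolds\<close>

primrec C_k_on :: "nat \<Rightarrow> ('a::euclidean_space \<Rightarrow> 'b::real_normed_vector) \<Rightarrow> 'a set \<Rightarrow> bool" where
  "C_k_on 0 f W \<longleftrightarrow> continuous_on W f"
| "C_k_on (Suc k) f W \<longleftrightarrow>
     f differentiable_on W \<and> (\<forall>v. C_k_on k (\<lambda>x. frechet_derivative f (at x) v) W)"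

text \<open>Only used for open sets \<open>W\<close>.\<close>

definition smooth_on :: "('a::euclidean_space \<Rightarrow> 'b::real_normed_vector) \<Rightarrow> 'a set \<Rightarrow> bool" where
  "smooth_on f W \<longleftrightarrow> (\<forall>k. C_k_on k f W)"

text \<open>A chart is a pair of its domain and its coordinate map; the values of the coordinate map
  outside the domain are irrelevant.\<close>

type_synonym ('m, 'a) atlas = "('m set \<times> ('m \<Rightarrow> 'a)) set"

definition chart_on :: "'m::topological_space set \<Rightarrow> ('m \<Rightarrow> 'a::euclidean_space) \<Rightarrow> bool" where
  "chart_on U \<xi> \<longleftrightarrow> open U \<and> open (\<xi> ` U) \<and> homeomorphism U (\<xi> ` U) \<xi> (inv_into U \<xi>)"

text \<open>Hausdorff and second countable are imposed through the type class of \<open>'m\<close>, whose universe is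
  the underlying set of the manifold. The atlas need not be maximal.\<close>

definition smooth_manifold ::
    "('m::{t2_space, second_countable_topology}, 'a::euclidean_space) atlas \<Rightarrow> bool" where
  "smooth_manifold A \<longleftrightarrow>
     (\<forall>(U, \<xi>) \<in> A. chart_on U \<xi>) \<and>
     (\<Union>(U, \<xi>) \<in> A. U) = UNIV \<and>
     (\<forall>(U, \<xi>) \<in> A. \<forall>(V, \<psi>) \<in> A. smooth_on (\<psi> \<circ> inv_into U \<xi>) (\<xi> ` (U \<inter> V)))"

definition smooth_map ::
    "('m::topological_space, 'a::euclidean_space) atlas \<Rightarrow>
     ('n::topological_space, 'b::euclidean_space) atlas \<Rightarrow> ('m \<Rightarrow> 'n) \<Rightarrow> bool" where
  "smooth_map A B f \<longleftrightarrow>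
     continuous_on UNIV f \<and>
     (\<forall>(U, \<xi>) \<in> A. \<forall>(V, \<psi>) \<in> B.
        smooth_on (\<psi> \<circ> f \<circ> inv_into U \<xi>) (\<xi> ` (U \<inter> f -` V)))"

definition prod_atlas ::
    "('m, 'a) atlas \<Rightarrow> ('n, 'b) atlas \<Rightarrow> ('m \<times> 'n, 'a \<times> 'b) atlas" where
  "prod_atlas A B = {(U \<times> V, map_prod \<xi> \<psi>) | U \<xi> V \<psi>. (U, \<xi>) \<in> A \<and> (V, \<psi>) \<in> B}"

definition smooth_functions ::
    "('m::topological_space, 'a::euclidean_space) atlas \<Rightarrow> ('m \<Rightarrow> real) set" where
  "smooth_functions A = {f. smooth_map A {(UNIV, id :: real \<Rightarrow> real)} f}"

text \<open>Tangent vectors at a point and smooth vector fields are derivations of the algebra of smooth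
  functions. To make them determined by their action on smooth functions, they are required to
  vanish on all other functions.\<close>

definition tangent_space ::
    "('m::topological_space, 'a::euclidean_space) atlas \<Rightarrow> 'm \<Rightarrow> (('m \<Rightarrow> real) \<Rightarrow> real) set" where
  "tangent_space A p =
     {v. (\<forall>f \<in> smooth_functions A. \<forall>h \<in> smooth_functions A. v (\<lambda>q. f q + h q) = v f + v h) \<and>
         (\<forall>f \<in> smooth_functions A. \<forall>c. v (\<lambda>q. c * f q) = c * v f) \<and>
         (\<forall>f \<in> smooth_functions A. \<forall>h \<in> smooth_functions A.
            v (\<lambda>q. f q * h q) = f p * v h + h p * v f) \<and>
         (\<forall>f. f \<notin> smooth_functions A \<longrightarrow> v f = 0)}"

type_synonym 'm vector_field = "('m \<Rightarrow> real) \<Rightarrow> ('m \<Rightarrow> real)"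

definition at_point :: "'m vector_field \<Rightarrow> 'm \<Rightarrow> ('m \<Rightarrow> real) \<Rightarrow> real" where
  "at_point X p = (\<lambda>f. X f p)"

definition vector_fields ::
    "('m::topological_space, 'a::euclidean_space) atlas \<Rightarrow> 'm vector_field set" where
  "vector_fields A =
     {X. (\<forall>p. at_point X p \<in> tangent_space A p) \<and>
         (\<forall>f \<in> smooth_functions A. X f \<in> smooth_functions A)}"

definition commutator :: "'m vector_field \<Rightarrow> 'm vector_field \<Rightarrow> 'm vector_field" where
  "commutator X Y = (\<lambda>f p. X (Y f) p - Y (X f) p)"

definition riemannian_metric ::
    "('m::topological_space, 'a::euclidean_space) atlas \<Rightarrow>
     ('m \<Rightarrow> (('m \<Rightarrow> real) \<Rightarrow> real) \<Rightarrow> (('m \<Rightarrow> real) \<Rightarrow> real) \<Rightarrow> real) \<Rightarrow> bool" where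
  "riemannian_metric A g \<longleftrightarrow>
     (\<forall>p. \<forall>u \<in> tangent_space A p. \<forall>v \<in> tangent_space A p. \<forall>w \<in> tangent_space A p.
        g p (\<lambda>f. u f + v f) w = g p u w + g p v w) \<and>
     (\<forall>p. \<forall>u \<in> tangent_space A p. \<forall>w \<in> tangent_space A p. \<forall>c.
        g p (\<lambda>f. c * u f) w = c * g p u w) \<and>
     (\<forall>p. \<forall>u \<in> tangent_space A p. \<forall>w \<in> tangent_space A p. g p u w = g p w u) \<and>
     (\<forall>p. \<forall>u \<in> tangent_space A p. u \<noteq> (\<lambda>f. 0) \<longrightarrow> g p u u > 0) \<and>
     (\<forall>X \<in> vector_fields A. \<forall>Y \<in> vector_fields A.
        (\<lambda>p. g p (at_point X p) (at_point Y p)) \<in> smooth_functions A)"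

section \<open>Lie groups with left invariant metrics\<close>

locale lie_group = group mul e iv
  for mul :: "'g::{t2_space, second_countable_topology} \<Rightarrow> 'g \<Rightarrow> 'g" and e :: 'g and iv :: "'g \<Rightarrow> 'g" +
  fixes A :: "('g, 'a::euclidean_space) atlas"
  assumes manifold: "smooth_manifold A"
    and smooth_mul: "smooth_map (prod_atlas A A) A (\<lambda>(x, y). mul x y)"
    and smooth_inv: "smooth_map A A iv"

text \<open>The condition says that the differential of left translation by \<open>a\<close>, which maps \<open>v\<close> to
  \<open>\<lambda>f. v (f \<circ> mul a)\<close>, is an isometry of tangent spaces.\<close>

definition left_invariant_metric ::
    "('g::topological_space \<Rightarrow> 'g \<Rightarrow> 'g) \<Rightarrow> ('g, 'a::euclidean_space) atlas \<Rightarrow>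
     ('g \<Rightarrow> (('g \<Rightarrow> real) \<Rightarrow> real) \<Rightarrow> (('g \<Rightarrow> real) \<Rightarrow> real) \<Rightarrow> real) \<Rightarrow> bool" where
  "left_invariant_metric mul A g \<longleftrightarrow>
     riemannian_metric A g \<and>
     (\<forall>a p. \<forall>u \<in> tangent_space A p. \<forall>v \<in> tangent_space A p.
        g (mul a p) (\<lambda>f. u (f \<circ> mul a)) (\<lambda>f. v (f \<circ> mul a)) = g p u v)"

text \<open>The Lie algebra of a Lie group: its left invariant vector fields, with the bracket
  \<^const>\<open>commutator\<close>.\<close>

definition left_invariant_fields ::
    "('g::topological_space \<Rightarrow> 'g \<Rightarrow> 'g) \<Rightarrow> ('g, 'a::euclidean_space) atlas \<Rightarrow> 'g vector_field set" where
  "left_invariant_fields mul A =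
     {X \<in> vector_fields A. \<forall>a. \<forall>f \<in> smooth_functions A. X (f \<circ> mul a) = X f \<circ> mul a}"

text \<open>The Lie algebra, with the inner product given by the metric at the identity, is a
  Euclidean vector space of dimension \<open>DIM('a)\<close>. A linear isometry \<open>\<phi>\<close> from \<open>'a\<close> onto it names this
  space by a type; such a \<open>\<phi>\<close> always exists and carries no further information.\<close>

definition lie_algebra_isometry ::
    "('g::topological_space \<Rightarrow> 'g \<Rightarrow> 'g) \<Rightarrow> 'g \<Rightarrow> ('g, 'a::euclidean_space) atlas \<Rightarrow>
     ('g \<Rightarrow> (('g \<Rightarrow> real) \<Rightarrow> real) \<Rightarrow> (('g \<Rightarrow> real) \<Rightarrow> real) \<Rightarrow> real) \<Rightarrow>
     ('a \<Rightarrow> 'g vector_field) \<Rightarrow> bool" where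
  "lie_algebra_isometry mul e A g \<phi> \<longleftrightarrow>
     bij_betw \<phi> UNIV (left_invariant_fields mul A) \<and>
     (\<forall>x y. \<phi> (x + y) = (\<lambda>f p. \<phi> x f p + \<phi> y f p)) \<and>
     (\<forall>c x. \<phi> (c *\<^sub>R x) = (\<lambda>f p. c * \<phi> x f p)) \<and>
     (\<forall>x y. g e (at_point (\<phi> x) e) (at_point (\<phi> y) e) = x \<bullet> y)"

definition transported_bracket :: "('a \<Rightarrow> 'g vector_field) \<Rightarrow> 'a \<Rightarrow> 'a \<Rightarrow> 'a" where
  "transported_bracket \<phi> x y = inv \<phi> (commutator (\<phi> x) (\<phi> y))"

section \<open>Lie algebras with an inner product\<close>

text \<open>In this section \<open>br\<close> is the Lie bracket on the vector space \<open>'a\<close>, so that \<open>br x\<close> is the operator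
  \<open>ad x\<close>.\<close>

definition bracket_space :: "('a::euclidean_space \<Rightarrow> 'a \<Rightarrow> 'a) \<Rightarrow> 'a set \<Rightarrow> 'a set \<Rightarrow> 'a set" where
  "bracket_space br V W = span {br x y | x y. x \<in> V \<and> y \<in> W}"

primrec derived_series :: "('a::euclidean_space \<Rightarrow> 'a \<Rightarrow> 'a) \<Rightarrow> nat \<Rightarrow> 'a set" where
  "derived_series br 0 = UNIV"
| "derived_series br (Suc k) = bracket_space br (derived_series br k) (derived_series br k)"

definition solvable_algebra :: "('a::euclidean_space \<Rightarrow> 'a \<Rightarrow> 'a) \<Rightarrow> bool" where
  "solvable_algebra br \<longleftrightarrow> (\<exists>k. derived_series br k = {0})"

definition nn :: "('a::euclidean_space \<Rightarrow> 'a \<Rightarrow> 'a) \<Rightarrow> 'a set" where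
  "nn br = bracket_space br UNIV UNIV"

definition aa :: "('a::euclidean_space \<Rightarrow> 'a \<Rightarrow> 'a) \<Rightarrow> 'a set" where
  "aa br = orthogonal_comp (nn br)"

definition standard :: "('a::euclidean_space \<Rightarrow> 'a \<Rightarrow> 'a) \<Rightarrow> bool" where
  "standard br \<longleftrightarrow> bracket_space br (aa br) (aa br) = {0}"

definition tr :: "('a::euclidean_space \<Rightarrow> 'a) \<Rightarrow> real" where
  "tr T = (\<Sum>b\<in>Basis. T b \<bullet> b)"

text \<open>For a bilinear form \<open>\<beta>\<close>, the operator \<open>T\<close> with \<open>T x \<bullet> y = \<beta> x y\<close>.\<close>

definition operator_of_form :: "('a::euclidean_space \<Rightarrow> 'a \<Rightarrow> real) \<Rightarrow> 'a \<Rightarrow> 'a" where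
  "operator_of_form \<beta> x = (\<Sum>b\<in>Basis. \<beta> x b *\<^sub>R b)"

definition killing_form :: "('a::euclidean_space \<Rightarrow> 'a \<Rightarrow> 'a) \<Rightarrow> 'a \<Rightarrow> 'a \<Rightarrow> real" where
  "killing_form br x y = tr (br x \<circ> br y)"

definition R_form :: "('a::euclidean_space \<Rightarrow> 'a \<Rightarrow> 'a) \<Rightarrow> 'a \<Rightarrow> 'a \<Rightarrow> real" where
  "R_form br x y =
     - (1/2) * (\<Sum>i\<in>Basis. \<Sum>j\<in>Basis. (br x i \<bullet> j) * (br y i \<bullet> j))
     + (1/4) * (\<Sum>i\<in>Basis. \<Sum>j\<in>Basis. (br i j \<bullet> x) * (br i j \<bullet> y))"

definition mean_curvature_vector :: "('a::euclidean_space \<Rightarrow> 'a \<Rightarrow> 'a) \<Rightarrow> 'a" where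
  "mean_curvature_vector br = (THE H. H \<in> aa br \<and> (\<forall>x \<in> aa br. H \<bullet> x = tr (br x)))"

definition symmetric_part :: "('a::euclidean_space \<Rightarrow> 'a) \<Rightarrow> 'a \<Rightarrow> 'a" where
  "symmetric_part T x = (1/2) *\<^sub>R (T x + adjoint T x)"

definition ricci_operator :: "('a::euclidean_space \<Rightarrow> 'a \<Rightarrow> 'a) \<Rightarrow> 'a \<Rightarrow> 'a" where
  "ricci_operator br x =
     operator_of_form (R_form br) x
     - (1/2) *\<^sub>R operator_of_form (killing_form br) x
     - symmetric_part (br (mean_curvature_vector br)) x"

definition einstein :: "('a::euclidean_space \<Rightarrow> 'a \<Rightarrow> 'a) \<Rightarrow> bool" where
  "einstein br \<longleftrightarrow> (\<exists>c. \<forall>x. ricci_operator br x = c *\<^sub>R x)"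

end

theory Submission
  imports Defs "HOL-Combinatorics.Permutations"
begin

text \<open>Let \<open>n = [s, s]\<close>, a nilpotent ideal. Among all filtrations of \<open>n\<close> by subspaces \<open>F\<^sub>t\<close> with
  \<open>[F\<^sub>s, F\<^sub>t] \<subseteq> F\<^sub>s\<^sub>+\<^sub>t\<close> there is exactly one with weights closest to \<open>(1, \<dots>, 1)\<close>: the cost is strictly convex
  along a common adapted basis of two filtrations. By uniqueness it is invariant under all derivations.
  Let \<open>D\<close> be the symmetric operator with this filtration. Optimality gives \<open>tr D\<^sup>2 = tr D\<close>. It also
  makes the graded bracket semistable for the centralizer of \<open>D\<close>, and a vector of minimal length in the
  closure of its orbit yields \<open>tr (D A) = tr A\<close> for every derivation \<open>A\<close> and \<open>D > 0\<close>.

  Now pair the Einstein equation with \<open>D\<close>, extended by \<open>0\<close> to \<open>a\<close>. In an orthonormal eigenbasis this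
  reads \<open>1/4 \<Sum> c\<^sub>i\<^sub>j\<^sub>k\<^sup>2 (d\<^sub>k - d\<^sub>i - d\<^sub>j) = c tr D + tr (D ad H)\<close> with nonnegative summands on the left, while
  the Einstein equation on \<open>a\<close> and the Cauchy-Schwarz inequality show that the right hand side is not
  positive. Hence all summands vanish; for indices \<open>i, j\<close> in \<open>a\<close> this says \<open>[a, a] = 0\<close>.\<close>

subsection \<open>Orthonormal frames and traces\<close>

text \<open>Why the target is \<open>(1, \<dots>, 1)\<close>: a diagonal operator with entries
  \<open>x\<close> scales the structure constant \<open>c\<^sub>i\<^sub>j\<^sub>k\<close> with
  exponent \<open>x\<^sub>k - x\<^sub>i - x\<^sub>j\<close>, and \<open>D\<close> is multiplicative
  iff all exponents of \<open>D - 1\<close> at nonzero constants are at least 1. So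
  \<open>D - 1\<close> is the shortest operator with this property, the optimal one-parameter
  subgroup of Kempf and Hesselink. In general \<open>D\<close> is a derivation of the graded bracket
  only, not of \<open>n\<close>. The pairing needs less:
  \<open>d\<^sub>k - d\<^sub>i - d\<^sub>j\<close> must be nonnegative at nonzero constants. For
  \<open>i, j\<close> in \<open>n\<close> this is multiplicativity. For one index in
  \<open>a\<close> it is invariance under the derivation that this vector induces on
  \<open>n\<close>, which is why uniqueness is wanted. For both in \<open>a\<close> it is
  \<open>d\<^sub>k > 0\<close>. The right hand side is bounded with \<open>S\<close>, the symmetric
  part of \<open>ad H\<close>: \<open>tr (D ad H) = tr (ad H) = |H|\<^sup>2\<close>, the equation on
  \<open>a\<close> reads \<open>c |H|\<^sup>2 = - tr S\<^sup>2\<close>, and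
  \<open>(tr (D S))\<^sup>2 \<le> tr D\<^sup>2 tr S\<^sup>2\<close> with
  \<open>tr D\<^sup>2 = tr D\<close> gives \<open>|H|\<^sup>2 \<le> - c tr D\<close>. Both trace
  identities for \<open>D\<close> enter here.\<close>

text \<open>The vectors of a frame are indexed by the standard basis.\<close>

definition oframe :: "('a::euclidean_space \<Rightarrow> 'a) \<Rightarrow> bool" where
  "oframe u \<longleftrightarrow> (\<forall>i\<in>Basis. \<forall>j\<in>Basis. u i \<bullet> u j = (if i = j then 1 else 0))"

lemma oframeD: "oframe u \<Longrightarrow> i \<in> Basis \<Longrightarrow> j \<in> Basis \<Longrightarrow> u i \<bullet> u j = (if i = j then 1 else 0)"
  by (auto simp: oframe_def)

lemma oframe_self: "oframe u \<Longrightarrow> i \<in> Basis \<Longrightarrow> u i \<bullet> u i = 1"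
  by (auto simp: oframe_def)

lemma oframe_id: "oframe (\<lambda>x. x)"
  by (auto simp: oframe_def inner_Basis)

lemma oframe_norm: "oframe u \<Longrightarrow> i \<in> Basis \<Longrightarrow> norm (u i) = 1"
  by (simp add: norm_eq_sqrt_inner oframe_self)

lemma oframe_nonzero: "oframe u \<Longrightarrow> i \<in> Basis \<Longrightarrow> u i \<noteq> 0"
  using oframe_norm by force

lemma oframe_inj: "oframe u \<Longrightarrow> inj_on u Basis"
  by (rule inj_onI) (metis oframeD zero_neq_one)

lemma oframe_independent:
  assumes "oframe u"
  shows "independent (u ` Basis)"
proof (rule pairwise_orthogonal_independent)
  show "pairwise orthogonal (u ` Basis)"
    using assms by (auto simp: pairwise_def orthogonal_def oframe_def)
  show "0 \<notin> u ` Basis"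
    using oframe_nonzero[OF assms] by auto
qed

lemma oframe_span:
  fixes u :: "'a::euclidean_space \<Rightarrow> 'a"
  assumes "oframe u"
  shows "span (u ` Basis) = UNIV"
proof -
  have "card (u ` Basis) = DIM('a)"
    by (simp add: card_image[OF oframe_inj[OF assms]])
  then show ?thesis
    using oframe_independent[OF assms] by (metis card_ge_dim_independent dim_UNIV order_refl subset_UNIV top.extremum_uniqueI)
qed

lemma oframe_expand:
  assumes "oframe u"
  shows "(\<Sum>i\<in>Basis. (x \<bullet> u i) *\<^sub>R u i) = x"
proof -
  have "(\<Sum>v\<in>u ` Basis. (x \<bullet> v) *\<^sub>R v) = x"
    by (rule orthonormal_basis_expand)
       (use assms in \<open>auto simp: pairwise_def orthogonal_def oframe_def oframe_span oframe_norm\<close>)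
  then show ?thesis
    by (simp add: sum.reindex[OF oframe_inj[OF assms]])
qed

lemma oframe_inner:
  assumes "oframe u"
  shows "x \<bullet> y = (\<Sum>i\<in>Basis. (x \<bullet> u i) * (y \<bullet> u i))"
proof -
  have "x \<bullet> y = (\<Sum>i\<in>Basis. (x \<bullet> u i) *\<^sub>R u i) \<bullet> y"
    by (simp add: oframe_expand[OF assms])
  then show ?thesis
    by (simp add: inner_sum_left inner_commute[of "u _" y])
qed

lemma oframe_eqI:
  assumes "oframe u" "\<And>i. i \<in> Basis \<Longrightarrow> x \<bullet> u i = y \<bullet> u i"
  shows "x = y"
proof -
  have "(\<Sum>i\<in>Basis. (x \<bullet> u i) *\<^sub>R u i) = (\<Sum>i\<in>Basis. (y \<bullet> u i) *\<^sub>R u i)"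
    by (rule sum.cong) (auto simp: assms(2))
  then show ?thesis
    by (simp add: oframe_expand[OF assms(1)])
qed

lemma oframe_linear_expand:
  assumes "oframe u" "linear T"
  shows "T x = (\<Sum>i\<in>Basis. (x \<bullet> u i) *\<^sub>R T (u i))"
proof -
  have "T x = T (\<Sum>i\<in>Basis. (x \<bullet> u i) *\<^sub>R u i)"
    by (simp add: oframe_expand[OF assms(1)])
  then show ?thesis
    by (simp add: linear_sum[OF assms(2)] linear_cmul[OF assms(2)])
qed

lemma oframe_linear_eqI:
  assumes "oframe u" "linear S" "linear T" "\<And>i. i \<in> Basis \<Longrightarrow> S (u i) = T (u i)"
  shows "S x = T x"
  by (subst oframe_linear_expand[OF assms(1,2)], subst oframe_linear_expand[OF assms(1,3)])
     (simp add: assms(4))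

text \<open>Both sides are the trace of the adjoint of \<open>T\<close> composed with
  \<open>S\<close>. Every change of frame for traces and for the inner products on operators and
  brackets rests on this.\<close>

lemma oframe_double_sum:
  assumes u: "oframe u" and v: "oframe v" and S: "linear S" and T: "linear T"
  shows "(\<Sum>i\<in>Basis. S (u i) \<bullet> T (u i)) = (\<Sum>j\<in>Basis. S (v j) \<bullet> T (v j))"
proof -
  have "(\<Sum>i\<in>Basis. S (u i) \<bullet> T (u i)) = (\<Sum>i\<in>Basis. \<Sum>j\<in>Basis. (u i \<bullet> v j) * (S (v j) \<bullet> T (u i)))"
    by (rule sum.cong, simp, subst oframe_linear_expand[OF v S]) (simp add: inner_sum_left)
  also have "\<dots> = (\<Sum>j\<in>Basis. S (v j) \<bullet> (\<Sum>i\<in>Basis. (v j \<bullet> u i) *\<^sub>R T (u i)))"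
    by (subst sum.swap) (simp add: inner_sum_right inner_commute)
  also have "\<dots> = (\<Sum>j\<in>Basis. S (v j) \<bullet> T (v j))"
    by (simp add: oframe_linear_expand[OF u T, symmetric])
  finally show ?thesis .
qed

lemma tr_frame:
  assumes "oframe u" "linear T"
  shows "tr T = (\<Sum>i\<in>Basis. T (u i) \<bullet> u i)"
  unfolding tr_def
  using oframe_double_sum[OF oframe_id assms(1) assms(2) linear_ident] by (simp add: linear_ident)

lemma tr_comm:
  fixes S T :: "'a::euclidean_space \<Rightarrow> 'a"
  assumes S: "linear S" and T: "linear T"
  shows "tr (\<lambda>x. S (T x)) = tr (\<lambda>x. T (S x))"
proof -
  have expand: "tr (\<lambda>x. U (V x)) = (\<Sum>b\<in>Basis. \<Sum>c\<in>Basis. (V b \<bullet> c) * (U c \<bullet> b))"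
    if "linear U" for U V :: "'a \<Rightarrow> 'a"
    unfolding tr_def
    by (rule sum.cong, simp, subst oframe_linear_expand[OF oframe_id that]) (simp add: inner_sum_left)
  show ?thesis
    unfolding expand[OF S] expand[OF T] by (subst sum.swap) (simp add: mult.commute)
qed

lemma tr_add: "tr (\<lambda>x. S x + T x) = tr S + tr T"
  by (simp add: tr_def inner_add_left sum.distrib)

lemma tr_diff: "tr (\<lambda>x. S x - T x) = tr S - tr T"
  by (simp add: tr_def inner_diff_left sum_subtractf)

lemma tr_adjoint:
  assumes "linear T"
  shows "tr (adjoint T) = tr T"
  by (simp add: tr_def adjoint_works[OF assms, symmetric] adjoint_clauses[OF assms] inner_commute)

lemma adjoint_inner_left:
  fixes T :: "'a::euclidean_space \<Rightarrow> 'a"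
  shows "linear T \<Longrightarrow> adjoint T x \<bullet> y = x \<bullet> T y"
  by (rule adjoint_clauses(2))

lemma adjoint_comp_eq:
  fixes S T :: "'a::euclidean_space \<Rightarrow> 'a"
  assumes "linear S" "linear T"
  shows "adjoint (\<lambda>x. S (T x)) = (\<lambda>x. adjoint T (adjoint S x))"
  by (rule adjoint_unique) (simp add: adjoint_works[OF assms(1)] adjoint_works[OF assms(2)])

lemma orthonormal_basis_frame:
  fixes B :: "'a::euclidean_space set"
  assumes B: "pairwise orthogonal B" "\<And>x. x \<in> B \<Longrightarrow> norm x = 1" "span B = UNIV"
  obtains u where "oframe u" "u ` Basis = B" "inj_on u Basis"
proof -
  have "0 \<notin> B"
    using B(2)[of 0] by auto
  then have ind: "independent B"
    by (rule pairwise_orthogonal_independent[OF B(1)])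
  have "card B = DIM('a)"
    using ind B(3) by (metis dim_UNIV dim_span_eq_card_independent)
  then obtain u where u: "bij_betw u (Basis::'a set) B"
    using independent_imp_finite[OF ind] by (metis finite_Basis finite_same_card_bij)
  then have img: "u ` Basis = B" and inj: "inj_on u Basis"
    by (auto simp: bij_betw_def)
  have "oframe u"
    unfolding oframe_def
  proof (intro ballI)
    fix i j :: 'a assume ij: "i \<in> Basis" "j \<in> Basis"
    then have mem: "u i \<in> B" "u j \<in> B"
      using img by auto
    show "u i \<bullet> u j = (if i = j then 1 else 0)"
    proof (cases "i = j")
      case True
      then show ?thesis
        using B(2)[OF mem(1)] by (simp add: norm_eq_1)
    next
      case False
      then have "u i \<noteq> u j"
        using inj ij by (auto simp: inj_on_def)
      then show ?thesis
        using B(1) mem False by (auto simp: pairwise_def orthogonal_def)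
    qed
  qed
  then show thesis
    using img inj by (rule that)
qed

lemma oframe_extend:
  fixes W :: "'a::euclidean_space set"
  assumes W: "subspace W"
  obtains u where "oframe u" "\<And>i. i \<in> Basis \<Longrightarrow> u i \<in> W \<or> (\<forall>w\<in>W. u i \<bullet> w = 0)"
proof -
  obtain B where B: "B \<subseteq> W" "pairwise orthogonal B" "\<And>x. x \<in> B \<Longrightarrow> norm x = 1"
    "independent B" "card B = dim W" "span B = W"
    using orthonormal_basis_subspace[OF W] by metis
  let ?W' = "orthogonal_comp W"
  have W': "subspace ?W'"
    by (rule subspace_orthogonal_comp)
  obtain C where C: "C \<subseteq> ?W'" "pairwise orthogonal C" "\<And>x. x \<in> C \<Longrightarrow> norm x = 1"
    "independent C" "card C = dim ?W'" "span C = ?W'"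
    using orthonormal_basis_subspace[OF W'] by metis
  have orth: "b \<bullet> c = 0" if "b \<in> W" "c \<in> ?W'" for b c
    using that by (auto simp: orthogonal_comp_def orthogonal_def)
  have pw: "pairwise orthogonal (B \<union> C)"
    using B(1,2) C(1,2) orth
    unfolding pairwise_def orthogonal_def by (metis Un_iff inner_commute subset_iff)
  have "span (B \<union> C) = UNIV"
  proof -
    have "\<exists>a b. x = a + b \<and> a \<in> W \<and> b \<in> ?W'" for x
    proof -
      obtain y z where "y \<in> span W" "\<And>w. w \<in> span W \<Longrightarrow> orthogonal z w" "x = y + z"
        using orthogonal_subspace_decomp_exists[of W x] by metis
      moreover have "span W = W"
        using W by (simp add: span_eq_iff)
      ultimately show ?thesis
        by (intro exI[of _ y] exI[of _ z]) (auto simp: orthogonal_comp_def orthogonal_commute)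
    qed
    moreover have "W \<subseteq> span (B \<union> C)" "?W' \<subseteq> span (B \<union> C)"
      using B(6) C(6) span_mono[of B "B \<union> C"] span_mono[of C "B \<union> C"] by auto
    ultimately show ?thesis
      by (metis UNIV_eq_I span_add subset_iff)
  qed
  moreover have "norm x = 1" if "x \<in> B \<union> C" for x
    using that B(3) C(3) by auto
  ultimately obtain u where u: "oframe u" and img: "u ` Basis = B \<union> C"
    using orthonormal_basis_frame[OF pw] by metis
  have "u i \<in> W \<or> (\<forall>w\<in>W. u i \<bullet> w = 0)" if "i \<in> Basis" for i
  proof -
    have "u i \<in> B \<union> C"
      using img that by blast
    then show ?thesis
      using B(1) C(1) orth by (metis Un_iff inner_commute subset_iff)
  qed
  with u show thesis ..
qed

text \<open>The trace of an idempotent is its rank. \<open>E\<close> need not be symmetric: in a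
  frame that splits along its range, the diagonal entry is 1 for a vector of the range and 0 for one
  orthogonal to it.\<close>

lemma tr_idempotent_zero:
  assumes E: "linear E" and idem: "\<And>x. E (E x) = E x" and tr0: "tr E = 0"
  shows "E x = 0"
proof -
  have W: "subspace (range E)"
    using E by (simp add: linear_subspace_image)
  obtain u where u: "oframe u" and uW: "\<And>i. i \<in> Basis \<Longrightarrow> u i \<in> range E \<or> (\<forall>w\<in>range E. u i \<bullet> w = 0)"
    using oframe_extend[OF W] by blast
  have fixed: "E (u i) = u i" if "u i \<in> range E" for i
    using that idem by auto
  have diag: "E (u i) \<bullet> u i = (if u i \<in> range E then 1 else 0)" if "i \<in> Basis" for i
    using uW[OF that] fixed[of i] oframe_self[OF u that] by (metis inner_commute rangeI)
  have "tr E = (\<Sum>i\<in>Basis. if u i \<in> range E then 1 else 0)"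
    unfolding tr_frame[OF u E] by (rule sum.cong) (auto simp: diag)
  then have "\<forall>i\<in>Basis. (if u i \<in> range E then 1 else (0::real)) = 0"
    using tr0 by (subst sum_nonneg_eq_0_iff[symmetric]) auto
  then have "\<forall>i\<in>Basis. u i \<bullet> E x = 0"
    using uW by (metis rangeI zero_neq_one)
  then show ?thesis
    by (intro oframe_eqI[OF u]) (simp add: inner_commute)
qed

text \<open>Jacobson's lemma: a commutator that commutes with one of its factors is nilpotent. If \<open>Z\<close> is
  not nilpotent and \<open>G\<close> is its Drazin inverse, then \<open>[pG, q] = ZG\<close> is a nonzero idempotent, whose
  trace cannot vanish.\<close>

lemma commutator_nilpotent:
  fixes p q Z :: "'a::euclidean_space \<Rightarrow> 'a"
  assumes p: "linear p" and q: "linear q"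
    and Z: "\<And>x. Z x = p (q x) - q (p x)" and Zq: "\<And>x. Z (q x) = q (Z x)"
  shows "\<exists>m. \<forall>x. (Z ^^ m) x = 0"
proof -
  have linZ: "linear Z"
    unfolding Z[abs_def] by (intro linear_compose_sub linear_compose[OF q p, unfolded o_def] linear_compose[OF p q, unfolded o_def])
  have linZn: "linear (Z ^^ n)" for n
  proof (induction n)
    case 0
    show ?case using linear_id by (simp add: id_def)
  next
    case (Suc n)
    show ?case using linear_compose[OF Suc linZ] by (simp add: o_def)
  qed
  \<comment> \<open>The ranges of the powers of \<open>Z\<close> form a descending chain; it is
    constant from the stage \<open>m\<close> of least dimension on.\<close>
  define m where "m = (ARG_MIN (\<lambda>n. dim (range (Z ^^ n))) n. True)"
  have mmin: "dim (range (Z ^^ m)) \<le> dim (range (Z ^^ n))" for n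
    unfolding m_def by (rule arg_min_nat_le) simp
  define R where "R = range (Z ^^ m)"
  have subR: "subspace R"
    unfolding R_def using linZn by (simp add: linear_subspace_image)
  have dec: "range (Z ^^ (m + k)) = R" for k
  proof -
    have "range (Z ^^ (m + k)) \<subseteq> R"
      unfolding R_def by (auto simp: funpow_add)
    then show ?thesis
      using mmin[of "m + k"] subspace_dim_equal[of "range (Z ^^ (m+k))" R] subR linZn
      by (simp add: R_def linear_subspace_image)
  qed
  have sucR: "(Z ^^ Suc m) ` R = R"
  proof -
    have "(Z ^^ Suc m) ` R = range (Z ^^ (Suc m + m))"
      unfolding R_def by (simp add: image_comp funpow_add o_def)
    also have "\<dots> = R"
      using dec[of "Suc m"] by (simp add: add.commute)
    finally show ?thesis .
  qed
  have injR: "inj_on (Z ^^ Suc m) R"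
  proof -
    obtain B where B: "B \<subseteq> R" "independent B" "R \<subseteq> span B" "card B = dim R"
      using basis_exists by blast
    have spanB: "span B = R"
      using B subR by (meson span_minimal subset_antisym)
    have finB: "finite B"
      using B independent_imp_finite by blast
    have sp: "span ((Z ^^ Suc m) ` B) = R"
      using linear_span_image[OF linZn] spanB sucR by metis
    have "card ((Z ^^ Suc m) ` B) \<ge> dim R"
      using sp dim_le_card[of R "(Z ^^ Suc m) ` B"] finB by auto
    then have c: "card ((Z ^^ Suc m) ` B) = card B"
      using B(4) card_image_le[OF finB, of "Z ^^ Suc m"] by simp
    have "independent ((Z ^^ Suc m) ` B)"
      by (rule card_le_dim_spanning[of _ R]) (use sp finB c B(4) in \<open>auto simp del: funpow.simps intro: span_base\<close>)
    then show ?thesis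
      using linear_inj_on_span_independent_image[OF linZn _ eq_card_imp_inj_on[OF finB c]] spanB by simp
  qed
  have ex: "\<exists>!r. r \<in> R \<and> (Z ^^ Suc m) r = (Z ^^ m) x" for x
  proof -
    have "(Z ^^ m) x \<in> (Z ^^ Suc m) ` R"
      unfolding sucR by (simp add: R_def)
    then obtain r where "r \<in> R" "(Z ^^ Suc m) r = (Z ^^ m) x"
      by (metis imageE)
    then show ?thesis
      by (intro ex1I[of _ r]) (auto intro: inj_onD[OF injR] simp del: funpow.simps)
  qed
  \<comment> \<open>\<open>Z ^^ Suc m\<close> is bijective on the stable range \<open>R\<close>, so
    this equation determines the Drazin inverse.\<close>
  define G where "G x = (THE r. r \<in> R \<and> (Z ^^ Suc m) r = (Z ^^ m) x)" for x
  have G: "G x \<in> R" "(Z ^^ Suc m) (G x) = (Z ^^ m) x" for x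
    using theI'[OF ex[of x]] by (auto simp: G_def)
  have Guniq: "G x = r" if "r \<in> R" "(Z ^^ Suc m) r = (Z ^^ m) x" for x r
    using ex[of x] G that by blast
  have linG: "linear G"
  proof (rule linearI)
    show "G (x + y) = G x + G y" for x y
      by (rule Guniq) (simp_all add: G subspace_add[OF subR] linear_add[OF linZn] del: funpow.simps)
    show "G (c *\<^sub>R x) = c *\<^sub>R G x" for c x
      by (rule Guniq) (simp_all add: G subspace_scale[OF subR] linear_cmul[OF linZn] del: funpow.simps)
  qed
  have Znq: "(Z ^^ n) (q x) = q ((Z ^^ n) x)" for n x
    by (induction n) (auto simp: Zq)
  have Gq: "G (q x) = q (G x)" for x
  proof (rule Guniq)
    show "q (G x) \<in> R"
    proof -
      obtain y where "G x = (Z ^^ m) y"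
        using G(1)[of x] unfolding R_def by blast
      then have "q (G x) = (Z ^^ m) (q y)"
        by (simp add: Znq)
      then show ?thesis
        by (simp add: R_def)
    qed
    show "(Z ^^ Suc m) (q (G x)) = (Z ^^ m) (q x)"
      by (simp only: Znq G)
  qed
  have GZ: "G (Z r) = r" if "r \<in> R" for r
    by (rule Guniq[OF that]) (simp add: funpow_swap1)
  have linZG: "linear (\<lambda>x. Z (G x))"
    using linear_compose[OF linG linZ] by (simp add: o_def)
  \<comment> \<open>\<open>Z\<close> commutes with \<open>q\<close>, hence so does \<open>G\<close>;
    therefore \<open>Z G\<close> is the commutator of \<open>p G\<close> with \<open>q\<close> and
    has trace 0.\<close>
  have "tr (\<lambda>x. Z (G x)) = tr (\<lambda>x. p (G (q x)) - q (p (G x)))"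
    by (simp add: Z Gq)
  also have "\<dots> = tr (\<lambda>x. p (G (q x))) - tr (\<lambda>x. q (p (G x)))"
    by (rule tr_diff)
  also have "\<dots> = 0"
    using tr_comm[OF linear_compose[OF linG p] q] by (simp add: o_def)
  finally have "Z (G x) = 0" for x
    by (intro tr_idempotent_zero[OF linZG]) (simp add: GZ G)
  then have "(Z ^^ m) x = 0" for x
    using G(2)[of x] linear_0[OF linZn[of m]] by (simp add: funpow_swap1)
  then show ?thesis
    by blast
qed

text \<open>A symmetric operator attains the maximum of its Rayleigh quotient at an eigenvector.\<close>

lemma symmetric_eigenvector:
  fixes T :: "'a::euclidean_space \<Rightarrow> 'a"
  assumes T: "linear T" and sym: "\<And>x y. T x \<bullet> y = x \<bullet> T y"
    and W: "subspace W" "\<And>w. w \<in> W \<Longrightarrow> T w \<in> W" "W \<noteq> {0}"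
  obtains v c where "v \<in> W" "norm v = 1" "T v = c *\<^sub>R v"
proof -
  let ?K = "sphere 0 1 \<inter> W"
  have comp: "compact ?K"
    by (intro compact_Int_closed compact_sphere closed_subspace W)
  obtain w0 where w0: "w0 \<in> W" "w0 \<noteq> 0"
    using W(1,3) subspace_0 by blast
  then have "w0 /\<^sub>R norm w0 \<in> ?K"
    using W(1) by (auto simp: subspace_scale)
  then have ne: "?K \<noteq> {}"
    by blast
  have "continuous_on ?K (\<lambda>v. T v \<bullet> v)"
    by (intro continuous_intros linear_continuous_on linear_conv_bounded_linear[THEN iffD1, OF T])
  then obtain v where v: "v \<in> ?K" and vmax: "\<And>w. w \<in> ?K \<Longrightarrow> T w \<bullet> w \<le> T v \<bullet> v"
    using continuous_attains_sup[OF comp ne] by blast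
  define c where "c = T v \<bullet> v"
  have q: "0 \<le> c * (w \<bullet> w) - T w \<bullet> w" if "w \<in> W" for w
  proof (cases "w = 0")
    case True
    then show ?thesis by (simp add: linear_0[OF T])
  next
    case False
    have "w /\<^sub>R norm w \<in> ?K"
      using that False W(1) by (auto simp: subspace_scale)
    then have "T (w /\<^sub>R norm w) \<bullet> (w /\<^sub>R norm w) \<le> c"
      using vmax[of "w /\<^sub>R norm w"] unfolding c_def by blast
    then have "(T w \<bullet> w) / (norm w * norm w) \<le> c"
      by (simp add: linear_cmul[OF T] divide_inverse mult_ac)
    then have "T w \<bullet> w \<le> c * (norm w * norm w)"
      using False by (simp add: pos_divide_le_eq)
    then show ?thesis
      by (simp add: power2_norm_eq_inner[symmetric] power2_eq_square)
  qed
  \<comment> \<open>The residual of the eigenvalue equation. The form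
    \<open>c |w|^2 - T w \<bullet> w\<close> is nonnegative on \<open>W\<close> and vanishes at
    \<open>v\<close>; along \<open>v + t z\<close> its linear term is \<open>2 t |z|^2\<close>,
    which would make it negative for small negative \<open>t\<close> unless
    \<open>z = 0\<close>.\<close>
  define z where "z = c *\<^sub>R v - T v"
  have zW: "z \<in> W"
    unfolding z_def using v W by (intro subspace_diff subspace_scale) auto
  have vv: "v \<bullet> v = 1"
    using v by (simp add: norm_eq_1)
  have ineq: "0 \<le> 2 * t * (z \<bullet> z) + t\<^sup>2 * (c * (z \<bullet> z) - T z \<bullet> z)" for t
  proof -
    have "v + t *\<^sub>R z \<in> W"
      using v zW W by (intro subspace_add subspace_scale) auto
    from q[OF this] have "0 \<le> c * ((v + t *\<^sub>R z) \<bullet> (v + t *\<^sub>R z)) - T (v + t *\<^sub>R z) \<bullet> (v + t *\<^sub>R z)" .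
    also have "\<dots> = c + 2 * t * (c * (v \<bullet> z)) + t\<^sup>2 * (c * (z \<bullet> z)) - (c + 2 * t * (T v \<bullet> z) + t\<^sup>2 * (T z \<bullet> z))"
      using sym[of z v] vv
      by (simp add: linear_add[OF T] linear_cmul[OF T] inner_add_left inner_add_right inner_commute
          c_def power2_eq_square algebra_simps)
    also have "\<dots> = 2 * t * (z \<bullet> z) + t\<^sup>2 * (c * (z \<bullet> z) - T z \<bullet> z)"
      by (simp add: z_def inner_diff_left algebra_simps)
    finally show ?thesis .
  qed
  have "z \<bullet> z = 0"
  proof (rule ccontr)
    assume "z \<bullet> z \<noteq> 0"
    then have pos: "0 < z \<bullet> z" by simp
    define M where "M = \<bar>c * (z \<bullet> z) - T z \<bullet> z\<bar> + 1"
    have M: "0 < M" "c * (z \<bullet> z) - T z \<bullet> z < M" by (auto simp: M_def)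
    define t where "t = - (z \<bullet> z) / M"
    have "t < 0" using pos M by (simp add: t_def)
    have "t\<^sup>2 * (c * (z \<bullet> z) - T z \<bullet> z) \<le> t\<^sup>2 * M"
      using M by (intro mult_left_mono) auto
    also have "\<dots> = - t * (z \<bullet> z)"
      using M by (simp add: t_def power2_eq_square)
    finally have "0 \<le> t * (z \<bullet> z)"
      using ineq[of t] by simp
    then show False
      using \<open>t < 0\<close> pos by (simp add: zero_le_mult_iff)
  qed
  then have "T v = c *\<^sub>R v"
    by (simp add: z_def)
  then show thesis
    using that v by auto
qed

text \<open>A largest orthonormal set of common eigenvectors spans everything: its orthogonal
  complement is invariant under both operators, and if it were nonzero, an eigenvector of
  \<open>T\<close> inside an eigenspace of \<open>S\<close> there would enlarge the set. With
  \<open>S = T\<close> this is the spectral theorem.\<close>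

lemma common_eigenframe:
  fixes S T :: "'a::euclidean_space \<Rightarrow> 'a"
  assumes S: "linear S" and T: "linear T"
    and symS: "\<And>x y. S x \<bullet> y = x \<bullet> S y" and symT: "\<And>x y. T x \<bullet> y = x \<bullet> T y"
    and comm: "\<And>x. S (T x) = T (S x)"
  obtains u f g where "oframe u" "\<And>i. i \<in> Basis \<Longrightarrow> S (u i) = f i *\<^sub>R u i"
    "\<And>i. i \<in> Basis \<Longrightarrow> T (u i) = g i *\<^sub>R u i"
proof -
  define ev where "ev v \<longleftrightarrow> norm v = 1 \<and> (\<exists>c. S v = c *\<^sub>R v) \<and> (\<exists>d. T v = d *\<^sub>R v)" for v
  have step: "\<exists>v\<in>W. ev v" if W: "subspace W" "\<And>w. w \<in> W \<Longrightarrow> S w \<in> W" "\<And>w. w \<in> W \<Longrightarrow> T w \<in> W" "W \<noteq> {0}" for W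
  proof -
    obtain v c where v: "v \<in> W" "norm v = 1" "S v = c *\<^sub>R v"
      using symmetric_eigenvector[OF S symS W(1,2,4)] by blast
    let ?V = "{w \<in> W. S w = c *\<^sub>R w}"
    have V: "subspace ?V"
      using W(1) by (auto simp: subspace_def linear_add[OF S] linear_cmul[OF S] linear_0[OF S] algebra_simps)
    have TV: "T w \<in> ?V" if "w \<in> ?V" for w
      using that W(3) comm by (simp add: linear_cmul[OF T])
    have "v \<in> ?V" "v \<noteq> 0"
      using v by auto
    then have "?V \<noteq> {0}"
      by blast
    then obtain w d where "w \<in> ?V" "norm w = 1" "T w = d *\<^sub>R w"
      using symmetric_eigenvector[OF T symT V TV] by blast
    then show ?thesis
      unfolding ev_def by blast
  qed
  define good where "good B \<longleftrightarrow> pairwise orthogonal B \<and> (\<forall>v\<in>B. ev v)" for B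
  have indep: "independent B" if "good B" for B
  proof (rule pairwise_orthogonal_independent)
    show "0 \<notin> B"
      using that by (auto simp: good_def ev_def)
  qed (use that in \<open>simp add: good_def\<close>)
  have bound: "card B \<le> DIM('a)" if "good B" for B
    using independent_card_le[OF indep[OF that]] by simp
  have "good {}" by (simp add: good_def)
  then obtain B where B: "good B" and max: "\<And>C. good C \<Longrightarrow> card C \<le> card B"
    using ex_has_greatest_nat[of good "{}" card "Suc DIM('a)"] bound by (auto simp: less_Suc_eq_le)
  have finB: "finite B"
    using indep[OF B] independent_imp_finite by blast
  let ?W = "{w. \<forall>b\<in>B. b \<bullet> w = 0}"
  have "?W = {0}"
  proof (rule ccontr)
    assume ne: "?W \<noteq> {0}"
    have subW: "subspace ?W"
      by (auto simp: subspace_def inner_add_right)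
    have inv: "b \<bullet> S w = 0" "b \<bullet> T w = 0" if that: "w \<in> ?W" "b \<in> B" for w b
    proof -
      obtain c d where "S b = c *\<^sub>R b" "T b = d *\<^sub>R b"
        using B \<open>b \<in> B\<close> unfolding good_def ev_def by blast
      then show "b \<bullet> S w = 0" "b \<bullet> T w = 0"
        using that symS[of b w] symT[of b w] by auto
    qed
    obtain v where v: "v \<in> ?W" "ev v"
      using step[OF subW _ _ ne] inv by blast
    have "v \<notin> B"
      using v by (auto simp: ev_def)
    moreover have "good (insert v B)"
      using v B unfolding good_def by (auto simp: pairwise_insert orthogonal_def inner_commute)
    ultimately show False
      using max[of "insert v B"] finB by simp
  qed
  then have "span B = UNIV"
  proof -
    assume W0: "?W = {0}"
    have "x \<in> span B" for x
    proof -
      obtain y z where yz: "y \<in> span B" "\<And>w. w \<in> span B \<Longrightarrow> orthogonal z w" "x = y + z"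
        using orthogonal_subspace_decomp_exists[of B x] by metis
      have "z \<in> ?W"
        using yz(2) span_base by (auto simp: orthogonal_def inner_commute)
      then show ?thesis
        using W0 yz by simp
    qed
    then show ?thesis by blast
  qed
  moreover have "pairwise orthogonal B" "\<And>x. x \<in> B \<Longrightarrow> norm x = 1"
    using B by (auto simp: good_def ev_def)
  ultimately obtain u where u: "oframe u" "u ` Basis = B"
    using orthonormal_basis_frame by metis
  then have mem: "u i \<in> B" if "i \<in> Basis" for i
    using that by blast
  have "\<forall>i. \<exists>c d. i \<in> Basis \<longrightarrow> S (u i) = c *\<^sub>R u i \<and> T (u i) = d *\<^sub>R u i"
    using mem B unfolding good_def ev_def by blast
  then obtain f g where "\<And>i. i \<in> Basis \<Longrightarrow> S (u i) = f i *\<^sub>R u i \<and> T (u i) = g i *\<^sub>R u i"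
    by metis
  with u(1) show thesis
    using that by blast
qed

subsection \<open>Orthogonal projections\<close>

definition oproj :: "'a::euclidean_space set \<Rightarrow> 'a \<Rightarrow> 'a" where
  "oproj W x = (THE y. y \<in> W \<and> (\<forall>w\<in>W. (x - y) \<bullet> w = 0))"

lemma oproj_unique:
  assumes W: "subspace W" and y: "y \<in> W" "\<And>w. w \<in> W \<Longrightarrow> (x - y) \<bullet> w = 0"
  shows "oproj W x = y"
  unfolding oproj_def
proof (rule the_equality)
  fix z assume z: "z \<in> W \<and> (\<forall>w\<in>W. (x - z) \<bullet> w = 0)"
  then have "y - z \<in> W"
    using W y subspace_diff by blast
  then have "(x - z) \<bullet> (y - z) = 0" "(x - y) \<bullet> (y - z) = 0"
    using y z by auto
  then have "(y - z) \<bullet> (y - z) = 0"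
    by (simp add: inner_diff_left)
  then show "z = y" by simp
qed (use y in auto)

lemma oproj:
  assumes W: "subspace W"
  shows oproj_in: "oproj W x \<in> W" and oproj_orth: "w \<in> W \<Longrightarrow> (x - oproj W x) \<bullet> w = 0"
proof -
  obtain y z where yz: "y \<in> span W" "\<And>w. w \<in> span W \<Longrightarrow> orthogonal z w" "x = y + z"
    using orthogonal_subspace_decomp_exists[of W x] by metis
  have "span W = W"
    using W by (simp add: span_eq_iff)
  then have "oproj W x = y"
    using yz \<open>span W = W\<close> by (intro oproj_unique[OF W]) (auto simp: orthogonal_def)
  then show "oproj W x \<in> W" "w \<in> W \<Longrightarrow> (x - oproj W x) \<bullet> w = 0"
    using yz \<open>span W = W\<close> by (auto simp: orthogonal_def)
qed

lemma oproj_fix: "subspace W \<Longrightarrow> w \<in> W \<Longrightarrow> oproj W w = w"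
  by (rule oproj_unique) auto

lemma oproj_inner: "subspace W \<Longrightarrow> w \<in> W \<Longrightarrow> oproj W x \<bullet> w = x \<bullet> w"
  using oproj_orth[of W w x] by (simp add: inner_diff_left)

lemma linear_oproj:
  assumes W: "subspace W"
  shows "linear (oproj W)"
proof (rule linearI)
  show "oproj W (x + y) = oproj W x + oproj W y" for x y
    by (rule oproj_unique[OF W])
       (auto simp: oproj_in[OF W] subspace_add[OF W] inner_diff_left inner_add_left oproj_inner[OF W])
  show "oproj W (c *\<^sub>R x) = c *\<^sub>R oproj W x" for c x
    by (rule oproj_unique[OF W])
       (auto simp: oproj_in[OF W] subspace_scale[OF W] inner_diff_left oproj_inner[OF W])
qed

lemma oproj_symmetric:
  assumes W: "subspace W"
  shows "oproj W x \<bullet> y = x \<bullet> oproj W y"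
  using oproj_inner[OF W oproj_in[OF W], of x y] oproj_inner[OF W oproj_in[OF W], of y x]
  by (simp add: inner_commute)

lemma oproj_orthogonal: "subspace W \<Longrightarrow> (\<And>w. w \<in> W \<Longrightarrow> x \<bullet> w = 0) \<Longrightarrow> oproj W x = 0"
  by (rule oproj_unique) (auto simp: subspace_0)

subsection \<open>Solvable Lie algebras\<close>

text \<open>Jacobson's lemma when the relations hold on an invariant subspace only. Composing with
  the orthogonal projection extends them to the whole space and leaves the iterates on
  \<open>U\<close> unchanged.\<close>

lemma commutator_nilpotent_on:
  fixes p q Z :: "'a::euclidean_space \<Rightarrow> 'a"
  assumes U: "subspace U" and lin: "linear p" "linear q"
    and inv: "\<And>u. u \<in> U \<Longrightarrow> p u \<in> U" "\<And>u. u \<in> U \<Longrightarrow> q u \<in> U"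
    and Z: "\<And>u. u \<in> U \<Longrightarrow> Z u = p (q u) - q (p u)" and Zq: "\<And>u. u \<in> U \<Longrightarrow> Z (q u) = q (Z u)"
  shows "\<exists>m. \<forall>u\<in>U. (Z ^^ m) u = 0"
proof -
  let ?P = "oproj U"
  note P = oproj_in[OF U] oproj_fix[OF U]
  have comp: "linear (\<lambda>x. f (?P x))" if "linear f" for f :: "'a \<Rightarrow> 'a"
    using linear_compose[OF linear_oproj[OF U] that] by (simp add: o_def)
  have ZU: "Z u \<in> U" if "u \<in> U" for u
    using that inv U by (simp add: Z subspace_diff)
  have "\<exists>m. \<forall>x. ((\<lambda>x. Z (?P x)) ^^ m) x = 0"
  proof (rule commutator_nilpotent[OF comp[OF lin(1)] comp[OF lin(2)]])
    fix x
    show "Z (?P x) = p (?P (q (?P x))) - q (?P (p (?P x)))"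
      by (simp add: P inv Z)
    show "Z (?P (q (?P x))) = q (?P (Z (?P x)))"
      by (simp add: P inv Zq ZU)
  qed
  then obtain m where m: "\<And>x. ((\<lambda>x. Z (?P x)) ^^ m) x = 0"
    by blast
  have "((\<lambda>x. Z (?P x)) ^^ n) u = (Z ^^ n) u \<and> (Z ^^ n) u \<in> U" if "u \<in> U" for u n
    using that by (induction n) (auto simp: P ZU)
  then show ?thesis
    using m by metis
qed

text \<open>In a nonzero invariant subspace of least dimension, the kernel of a member is nonzero by
  nilpotency and invariant by commutation, so it is everything.\<close>

lemma commuting_nilpotent_kernel:
  fixes \<S> :: "('a::euclidean_space \<Rightarrow> 'a) set"
  assumes U: "subspace U" "U \<noteq> {0}"
    and lin: "\<And>S. S \<in> \<S> \<Longrightarrow> linear S"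
    and inv: "\<And>S u. S \<in> \<S> \<Longrightarrow> u \<in> U \<Longrightarrow> S u \<in> U"
    and comm: "\<And>S S' u. S \<in> \<S> \<Longrightarrow> S' \<in> \<S> \<Longrightarrow> u \<in> U \<Longrightarrow> S (S' u) = S' (S u)"
    and nil: "\<And>S. S \<in> \<S> \<Longrightarrow> \<exists>m. \<forall>u\<in>U. (S ^^ m) u = 0"
  shows "\<exists>u\<in>U. u \<noteq> 0 \<and> (\<forall>S\<in>\<S>. S u = 0)"
proof -
  define good where "good V \<longleftrightarrow> subspace V \<and> V \<subseteq> U \<and> V \<noteq> {0} \<and> (\<forall>S\<in>\<S>. \<forall>v\<in>V. S v \<in> V)" for V
  have "good U"
    using U inv by (auto simp: good_def)
  then obtain V where V: "good V" and min: "\<And>V'. good V' \<Longrightarrow> dim V \<le> dim V'"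
    using ex_has_least_nat[of good U dim] by blast
  have kill: "S v = 0" if S: "S \<in> \<S>" and v: "v \<in> V" for S v
  proof -
    let ?V = "{v \<in> V. S v = 0}"
    obtain w where w: "w \<in> V" "w \<noteq> 0"
      using V subspace_0 unfolding good_def by blast
    obtain m where "(S ^^ m) w = 0"
      using nil[OF S] w V by (auto simp: good_def)
    define n where "n = (LEAST m. (S ^^ m) w = 0)"
    have n: "(S ^^ n) w = 0"
      unfolding n_def using \<open>(S ^^ m) w = 0\<close> by (rule LeastI)
    then have "n \<noteq> 0"
      using w by (intro notI) simp
    then obtain l where l: "n = Suc l"
      using not0_implies_Suc by blast
    have "(S ^^ l) w \<noteq> 0"
      using not_less_Least[of l "\<lambda>m. (S ^^ m) w = 0"] l by (simp add: n_def)
    moreover have "(S ^^ k) w \<in> V" for k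
      using w V S by (induction k) (auto simp: good_def)
    ultimately have "?V \<noteq> {0}"
      using n l by auto
    moreover have "subspace ?V"
      using V lin[OF S] by (auto simp: good_def subspace_def linear_0 linear_add linear_cmul)
    moreover have "S' v \<in> ?V" if "S' \<in> \<S>" "v \<in> ?V" for S' v
      using that V comm[OF S that(1), of v] linear_0[OF lin[OF that(1)]] by (auto simp: good_def)
    ultimately have "good ?V"
      using V unfolding good_def by blast
    then have "?V = V"
      using min[of ?V] V by (intro subspace_dim_equal) (auto simp: good_def)
    then show ?thesis
      using v by blast
  qed
  obtain v where "v \<in> V" "v \<noteq> 0"
    using V subspace_0 unfolding good_def by blast
  then show ?thesis
    using kill V unfolding good_def by blast
qed

locale lie_alg =
  fixes br :: "'a::euclidean_space \<Rightarrow> 'a \<Rightarrow> 'a"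
  assumes bilin: "bilinear br" and anti: "br x y = - br y x"
    and jacobi: "br x (br y z) = br (br x y) z + br y (br x z)"
begin

lemma lin_right: "linear (br x)" and lin_left: "linear (\<lambda>x. br x y)"
  using bilin by (simp_all add: bilinear_def)

lemma subspace_derived: "subspace (derived_series br k)"
  by (cases k) (simp_all add: bracket_space_def)

lemma derived_ideal: "z \<in> derived_series br k \<Longrightarrow> br x z \<in> derived_series br k"
proof (induction k arbitrary: x z)
  case (Suc k)
  let ?D = "derived_series br"
  have "z \<in> span {br x y |x y. x \<in> ?D k \<and> y \<in> ?D k}"
    using Suc.prems by (simp add: bracket_space_def)
  then have "br x z \<in> ?D (Suc k)"
  proof (induction rule: span_induct_alt)
    case base
    then show ?case
      by (metis bilin bilinear_rzero subspace_0 subspace_derived)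
  next
    case (step c w v)
    then obtain a b where ab: "w = br a b" "a \<in> ?D k" "b \<in> ?D k"
      by blast
    have "br x w = br (br x a) b + br a (br x b)"
      using ab(1) jacobi[of x a b] by simp
    moreover have "br (br x a) b \<in> ?D (Suc k)" "br a (br x b) \<in> ?D (Suc k)"
      using Suc.IH[OF ab(2)] Suc.IH[OF ab(3)] ab unfolding derived_series.simps bracket_space_def
      by (blast intro: span_base)+
    ultimately have "br x w \<in> ?D (Suc k)"
      using subspace_add[OF subspace_derived] by metis
    then show ?case
      using step.IH
      by (simp add: bilinear_radd[OF bilin] bilinear_rmul[OF bilin] subspace_add[OF subspace_derived]
          subspace_scale[OF subspace_derived] del: derived_series.simps)
  qed
  then show ?case .
qed simp

lemma derived_bracket:
  "a \<in> derived_series br k \<Longrightarrow> b \<in> derived_series br k \<Longrightarrow> br a b \<in> derived_series br (Suc k)"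
  by (auto simp: bracket_space_def intro: span_base)

lemma nn_eq: "nn br = derived_series br (Suc 0)"
  by (simp add: nn_def)

lemma nn_bracket: "br x y \<in> nn br"
  unfolding nn_eq by (rule derived_bracket) auto

lemma subspace_nn: "subspace (nn br)"
  unfolding nn_eq by (rule subspace_derived)

text \<open>A real substitute for Lie's theorem. Common eigenvectors may fail to exist over the
  reals, but the derived algebra must act nilpotently, and a vector killed by it is found without
  any eigenvalue: descend along the derived series, obtaining nilpotency from Jacobson's lemma each
  time.\<close>

lemma solvable_rep_kernel:
  fixes \<rho> :: "'a \<Rightarrow> 'a \<Rightarrow> 'a"
  assumes solvable: "solvable_algebra br"
    and lin\<rho>: "\<And>x. linear (\<rho> x)" "\<And>w. linear (\<lambda>x. \<rho> x w)"
    and W: "subspace W" "W \<noteq> {0}" and inv: "\<And>x w. w \<in> W \<Longrightarrow> \<rho> x w \<in> W"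
    and rep: "\<And>x y w. w \<in> W \<Longrightarrow> \<rho> (br x y) w = \<rho> x (\<rho> y w) - \<rho> y (\<rho> x w)"
  shows "\<exists>w\<in>W. w \<noteq> 0 \<and> (\<forall>x\<in>nn br. \<rho> x w = 0)"
proof -
  let ?D = "derived_series br"
  define U where "U j = {w \<in> W. \<forall>z\<in>?D j. \<rho> z w = 0}" for j
  have subU: "subspace {u \<in> V. \<forall>z\<in>Z. \<rho> z u = 0}" if "subspace V" for V Z
    using that by (auto simp: subspace_def linear_0[OF lin\<rho>(1)] linear_add[OF lin\<rho>(1)] linear_cmul[OF lin\<rho>(1)])
  have neg: "\<rho> (- x) w = - \<rho> x w" for x w
    using linear_neg[OF lin\<rho>(2)] .
  have invU: "\<rho> x u \<in> {u \<in> V. \<forall>z\<in>Z. \<rho> z u = 0}"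
    if V: "\<And>x v. v \<in> V \<Longrightarrow> \<rho> x v \<in> V" "V \<subseteq> W" and Z: "\<And>x z. z \<in> Z \<Longrightarrow> br x z \<in> Z"
      and u: "u \<in> {u \<in> V. \<forall>z\<in>Z. \<rho> z u = 0}" for V Z x u
  proof -
    have "\<rho> z (\<rho> x u) = 0" if z: "z \<in> Z" for z
    proof -
      have "\<rho> (br x z) u = \<rho> x (\<rho> z u) - \<rho> z (\<rho> x u)"
        using rep u V by blast
      moreover have "\<rho> (br x z) u = 0" "\<rho> z u = 0"
        using Z[OF z] u z by blast+
      ultimately show ?thesis
        by (simp add: linear_0[OF lin\<rho>(1)])
    qed
    then show ?thesis
      using u V by blast
  qed
  \<comment> \<open>A vector killed by one derived algebra is traded for one killed by the
    preceding, larger one. On \<open>V\<close> the operators of \<open>?I\<close> commute with each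
    other.\<close>
  have step: "U (Suc i) \<noteq> {0}" if ne: "U (Suc (Suc i)) \<noteq> {0}" for i
  proof -
    let ?I = "?D (Suc i)"
    define V where "V = U (Suc (Suc i))"
    have V: "subspace V" "V \<subseteq> W" "V \<noteq> {0}"
      using subU[OF W(1)] ne by (auto simp: V_def U_def)
    have invV: "\<rho> x v \<in> V" if "v \<in> V" for x v
      unfolding V_def U_def
      by (rule invU) (use that inv derived_ideal in \<open>auto simp: V_def U_def simp del: derived_series.simps\<close>)
    have commV: "\<rho> z (\<rho> z' v) = \<rho> z' (\<rho> z v)" if "z \<in> ?I" "z' \<in> ?I" "v \<in> V" for z z' v
    proof -
      have "\<rho> (br z z') v = 0"
        using derived_bracket[OF that(1,2)] that(3) unfolding V_def U_def by blast
      then show ?thesis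
        using rep[of v z z'] that(3) V(2) by auto
    qed
    \<comment> \<open>For \<open>z\<close> in \<open>?I\<close>, the operator of
      \<open>br x z\<close> is a commutator of the operators of \<open>x\<close> and
      \<open>z\<close> and commutes with the latter, hence is nilpotent on \<open>V\<close>. On the
      common kernel \<open>V'\<close> of all of these, \<open>?I\<close> acts by operators that
      commute with the whole representation.\<close>
    define J where "J = {br x z | x z. z \<in> ?I}"
    have JI: "J \<subseteq> ?I"
      unfolding J_def using derived_ideal by blast
    have J_ideal: "br x z \<in> J" if "z \<in> J" for x z
      using that JI unfolding J_def by blast
    define V' where "V' = {v \<in> V. \<forall>z\<in>J. \<rho> z v = 0}"
    have "\<exists>v\<in>V. v \<noteq> 0 \<and> (\<forall>S\<in>\<rho> ` J. S v = 0)"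
    proof (rule commuting_nilpotent_kernel[OF V(1,3)])
      fix S assume "S \<in> \<rho> ` J"
      then obtain x z where S: "S = \<rho> (br x z)" "z \<in> ?I"
        unfolding J_def by blast
      show "linear S"
        using S lin\<rho> by simp
      show "\<exists>m. \<forall>u\<in>V. (S ^^ m) u = 0"
        by (rule commutator_nilpotent_on[OF V(1) lin\<rho>(1) lin\<rho>(1), of x z])
           (use S invV commV rep V derived_ideal in \<open>auto simp del: derived_series.simps\<close>)
      show "S u \<in> V" if "u \<in> V" for u
        using S invV that by simp
      show "S (S' u) = S' (S u)" if "S' \<in> \<rho> ` J" "u \<in> V" for S' u
        using that S commV JI derived_ideal by (auto simp del: derived_series.simps)
    qed
    then have V': "V' \<noteq> {0}"
      unfolding V'_def by blast
    have subV': "subspace V'" and V'W: "V' \<subseteq> W" "V' \<subseteq> V"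
      using subU[OF V(1)] V by (auto simp: V'_def)
    have invV': "\<rho> x v \<in> V'" if "v \<in> V'" for x v
      unfolding V'_def by (rule invU[OF invV V(2) J_ideal]) (use that in \<open>auto simp: V'_def\<close>)
    have comm': "\<rho> x (\<rho> z v) = \<rho> z (\<rho> x v)" if "z \<in> ?I" "v \<in> V'" for x z v
    proof -
      have "\<rho> (br x z) v = 0"
        using that unfolding V'_def J_def by blast
      then show ?thesis
        using rep[of v x z] that(2) V'W by auto
    qed
    \<comment> \<open>The generators of \<open>?I\<close>. On \<open>V'\<close> the operator of
      \<open>br a b\<close> commutes with that of \<open>b\<close>, so Jacobson's lemma applies a
      second time.\<close>
    define G where "G = {br a b | a b. a \<in> ?D i \<and> b \<in> ?D i}"
    have GI: "G \<subseteq> ?I"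
      unfolding G_def using derived_bracket by blast
    have "\<exists>v\<in>V'. v \<noteq> 0 \<and> (\<forall>S\<in>\<rho> ` G. S v = 0)"
    proof (rule commuting_nilpotent_kernel[OF subV' V'])
      fix S assume "S \<in> \<rho> ` G"
      then obtain a b where S: "S = \<rho> (br a b)" "br a b \<in> ?I"
        using GI unfolding G_def by blast
      show "linear S"
        using S lin\<rho> by simp
      show "\<exists>m. \<forall>u\<in>V'. (S ^^ m) u = 0"
        by (rule commutator_nilpotent_on[OF subV' lin\<rho>(1) lin\<rho>(1), of a b])
           (use S invV' comm'[of "br a b" _ b, symmetric] rep V'W in \<open>auto simp del: derived_series.simps\<close>)
      show "S u \<in> V'" if "u \<in> V'" for u
        using S invV' that by simp
      show "S (S' u) = S' (S u)" if "S' \<in> \<rho> ` G" "u \<in> V'" for S' u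
        using that S comm'[of "br a b" u, symmetric] by (auto simp del: derived_series.simps)
    qed
    then obtain v where v: "v \<in> V'" "v \<noteq> 0" "\<And>z. z \<in> G \<Longrightarrow> \<rho> z v = 0"
      by blast
    have "\<rho> z v = 0" if "z \<in> ?I" for z
    proof -
      have "z \<in> span G"
        using that by (simp add: G_def bracket_space_def)
      then show ?thesis
        by (induction rule: span_induct_alt)
           (auto simp: linear_0[OF lin\<rho>(2)] linear_add[OF lin\<rho>(2)] linear_cmul[OF lin\<rho>(2)] v(3))
    qed
    then have "v \<in> U (Suc i)"
      using v V'W unfolding U_def by blast
    then show ?thesis
      using v by blast
  qed
  obtain k where k: "?D k = {0}"
    using solvable by (auto simp: solvable_algebra_def)
  \<comment> \<open>The descent starts where every vector of \<open>W\<close> is killed and ends at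
    the derived algebra itself; the extra step avoids index 0.\<close>
  have "?D (Suc k) = {0}"
    using k bilin by (simp add: bracket_space_def bilinear_lzero)
  then have "U (Suc k) = W"
    by (auto simp: U_def linear_0[OF lin\<rho>(2)])
  then have "U (Suc 0) \<noteq> {0}"
    using W(2)
  proof (induction k)
    case (Suc k)
    show ?case
    proof (rule ccontr)
      assume "\<not> U (Suc 0) \<noteq> {0}"
      then have "U (Suc j) = {0}" for j
        by (induction j) (use step in auto)
      then show False
        using Suc by blast
    qed
  qed simp
  moreover have "0 \<in> U (Suc 0)"
    using subspace_0[OF subU[OF W(1)]] unfolding U_def .
  ultimately obtain w where "w \<in> U (Suc 0)" "w \<noteq> 0"
    by blast
  then show ?thesis
    unfolding U_def nn_eq by blast
qed

text \<open>Applied to the dual of the adjoint representation, the previous lemma makes the series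
  \<open>C, [n, C], [n, [n, C]], \<dots>\<close> decrease strictly.\<close>

lemma nn_nilpotent_action:
  assumes solvable: "solvable_algebra br"
  shows "\<exists>K. \<forall>xs y. set xs \<subseteq> nn br \<longrightarrow> length xs = K \<longrightarrow> foldr br xs y = 0"
proof -
  define C where "C = rec_nat (UNIV :: 'a set) (\<lambda>_ V. bracket_space br (nn br) V)"
  have C0: "C 0 = UNIV" and CS: "C (Suc j) = span {br x y | x y. x \<in> nn br \<and> y \<in> C j}" for j
    by (simp_all add: C_def bracket_space_def)
  have subC: "subspace (C j)" for j
    by (cases j) (simp_all add: C0 CS)
  have idealC: "br x v \<in> C j" if "v \<in> C j" for x v j
    using that
  proof (induction j arbitrary: x v)
    case (Suc j)
    have "v \<in> span {br x y | x y. x \<in> nn br \<and> y \<in> C j}"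
      using Suc.prems by (simp add: CS)
    then show ?case
    proof (induction rule: span_induct_alt)
      case base
      then show ?case
        by (metis bilin bilinear_rzero subspace_0 subC)
    next
      case (step c w v)
      then obtain a b where ab: "w = br a b" "a \<in> nn br" "b \<in> C j"
        by blast
      have "br x w = br (br x a) b + br a (br x b)"
        using ab(1) jacobi[of x a b] by simp
      moreover have "br (br x a) b \<in> C (Suc j)" "br a (br x b) \<in> C (Suc j)"
        using Suc.IH[OF ab(3)] ab nn_bracket unfolding CS by (blast intro: span_base)+
      ultimately have "br x w \<in> C (Suc j)"
        using subspace_add[OF subC] by metis
      then show ?case
        using step.IH
        by (simp add: bilinear_radd[OF bilin] bilinear_rmul[OF bilin] subspace_add[OF subC] subspace_scale[OF subC])
    qed
  qed (simp add: C0)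
  have sub: "C (Suc j) \<subseteq> C j" for j
    unfolding CS by (rule span_minimal[OF _ subC]) (use idealC in blast)
  have strict: "C (Suc j) \<noteq> C j" if ne: "C j \<noteq> {0}" for j
  proof -
    let ?P = "oproj (C j)"
    note P = oproj_in[OF subC[of j]] oproj_fix[OF subC[of j]]
    define T where "T x w = br x (?P w)" for x w
    have linT: "linear (T x)" for x
      unfolding T_def using linear_compose[OF linear_oproj[OF subC] lin_right] by (simp add: o_def)
    have TC: "T x w \<in> C j" for x w
      unfolding T_def using idealC P by blast
    have Trep: "T (br x y) w = T x (T y w) - T y (T x w)" for x y w
      using P idealC[of "?P w" j] jacobi[of x y "?P w"] by (simp add: T_def)
    \<comment> \<open>The dual of the adjoint action on \<open>C j\<close>. A vector of
      \<open>C j\<close> killed by the dual action of \<open>nn br\<close> is orthogonal to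
      \<open>C (Suc j)\<close>, so the latter is strictly smaller.\<close>
    define \<rho> where "\<rho> x w = - adjoint (T x) w" for x w
    have ad: "z \<bullet> \<rho> x w = - (T x z \<bullet> w)" for x z w
      by (simp add: \<rho>_def adjoint_works[OF linT])
    have "\<exists>w\<in>C j. w \<noteq> 0 \<and> (\<forall>x\<in>nn br. \<rho> x w = 0)"
    proof (rule solvable_rep_kernel[OF solvable _ _ subC ne])
      show "linear (\<rho> x)" for x
        unfolding \<rho>_def by (intro linear_compose_neg adjoint_linear linT)
      show "linear (\<lambda>x. \<rho> x w)" for w
      proof (rule linearI)
        show "\<rho> (x + y) w = \<rho> x w + \<rho> y w" for x y
          by (rule vector_eq_ldot[THEN iffD1])
             (auto simp: ad inner_add_right T_def bilinear_ladd[OF bilin] inner_add_left)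
        show "\<rho> (c *\<^sub>R x) w = c *\<^sub>R \<rho> x w" for c x
          by (rule vector_eq_ldot[THEN iffD1])
             (auto simp: ad T_def bilinear_lmul[OF bilin])
      qed
      show "\<rho> x w \<in> C j" for x w
      proof -
        have "(\<rho> x w - ?P (\<rho> x w)) \<bullet> (\<rho> x w - ?P (\<rho> x w)) = 0"
        proof -
          define d where "d = \<rho> x w - ?P (\<rho> x w)"
          have orth: "d \<bullet> v = 0" if "v \<in> C j" for v
            using oproj_orth[OF subC that] by (simp add: d_def)
          then have "?P d = 0"
            by (intro oproj_orthogonal[OF subC])
          then have "d \<bullet> \<rho> x w = 0"
            unfolding ad by (simp add: T_def bilinear_rzero[OF bilin])
          moreover have "d \<bullet> ?P (\<rho> x w) = 0"
            using orth P by blast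
          ultimately have "d \<bullet> d = 0"
            by (simp add: d_def inner_diff_right)
          then show ?thesis
            by (simp add: d_def)
        qed
        then show ?thesis
          using P(1)[of "\<rho> x w"] by simp
      qed
      show "\<rho> (br x y) w = \<rho> x (\<rho> y w) - \<rho> y (\<rho> x w)" for x y w
      proof (rule vector_eq_ldot[THEN iffD1], intro allI)
        fix z
        have "z \<bullet> \<rho> x (\<rho> y w) = T y (T x z) \<bullet> w" for x y
          by (simp add: ad)
        then show "z \<bullet> \<rho> (br x y) w = z \<bullet> (\<rho> x (\<rho> y w) - \<rho> y (\<rho> x w))"
          by (simp add: inner_diff_right ad Trep inner_diff_left)
      qed
    qed
    then obtain w where w: "w \<in> C j" "w \<noteq> 0" "\<And>x. x \<in> nn br \<Longrightarrow> \<rho> x w = 0"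
      by blast
    have "v \<bullet> w = 0" if "v \<in> C (Suc j)" for v
    proof -
      have "v \<in> span {br x y | x y. x \<in> nn br \<and> y \<in> C j}"
        using that by (simp add: CS)
      then show ?thesis
      proof (induction rule: span_induct_alt)
        case (step c b v)
        then obtain x y where "b = br x y" "x \<in> nn br" "y \<in> C j"
          by blast
        then have "b \<bullet> w = 0"
          using ad[of y x w] w(3) P by (simp add: T_def)
        then show ?case
          using step by (simp add: inner_add_left)
      qed simp
    qed
    then have "w \<notin> C (Suc j)"
      using w(2) by (metis inner_eq_zero_iff)
    then show ?thesis
      using w(1) by blast
  qed
  \<comment> \<open>Each step costs at least one dimension, so \<open>Suc DIM('a)\<close> steps are
    enough.\<close>
  have "C j = {0} \<or> dim (C j) + j \<le> DIM('a)" for j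
  proof (induction j)
    case (Suc j)
    show ?case
    proof (cases "C j = {0}")
      case True
      then show ?thesis
        using sub[of j] subspace_0[OF subC[of "Suc j"]] by auto
    next
      case False
      have "\<not> dim (C j) \<le> dim (C (Suc j))"
        using strict[OF False] sub subspace_dim_equal[OF subC subC] by blast
      then show ?thesis
        using Suc False by simp
    qed
  qed (simp add: C0)
  from this[of "Suc DIM('a)"] have "C (Suc DIM('a)) = {0}"
    by simp
  moreover have "foldr br xs y \<in> C (length xs)" if "set xs \<subseteq> nn br" for xs y
    using that
  proof (induction xs)
    case (Cons x xs)
    then show ?case
      by (auto simp: CS intro!: span_base)
  qed (simp add: C0)
  ultimately have "\<forall>xs y. set xs \<subseteq> nn br \<longrightarrow> length xs = Suc DIM('a) \<longrightarrow> foldr br xs y = 0"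
    by (metis singletonD)
  then show ?thesis
    by blast
qed

end

subsection \<open>Weighted bases and their filtrations\<close>

text \<open>A weighted set stands for the decreasing filtration it spans. Many weighted bases give
  the same filtration, and what matters below depends on the filtration alone.\<close>

definition wfilt :: "'a::euclidean_space set \<Rightarrow> ('a \<Rightarrow> real) \<Rightarrow> real \<Rightarrow> 'a set" where
  "wfilt C f s = span {c \<in> C. s \<le> f c}"

lemma subspace_fs: "subspace (wfilt C f s)"
  by (simp add: wfilt_def)

lemma fs_mono: "s \<le> t \<Longrightarrow> wfilt C f t \<subseteq> wfilt C f s"
  unfolding wfilt_def by (rule span_mono) auto

lemma fs_base: "c \<in> C \<Longrightarrow> c \<in> wfilt C f (f c)"
  unfolding wfilt_def by (rule span_base) auto

lemma fs_low: "(\<And>c. c \<in> C \<Longrightarrow> s \<le> f c) \<Longrightarrow> wfilt C f s = span C"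
  unfolding wfilt_def by (rule arg_cong[where f=span]) auto

lemma finite_lower_bound:
  fixes f :: "'b \<Rightarrow> real"
  assumes "finite C"
  obtains s where "\<And>c. c \<in> C \<Longrightarrow> s \<le> f c"
proof (cases "C = {}")
  case False
  then show thesis
    using that[of "Min (f ` C)"] assms by simp
qed (use that in auto)

lemma fs_eq_span_eq:
  assumes "finite C" "finite C'" "\<And>s. wfilt C f s = wfilt C' f' s"
  shows "span C = span C'"
proof -
  obtain s where "\<And>c. c \<in> C \<Longrightarrow> s \<le> f c"
    using finite_lower_bound[OF assms(1)] by metis
  moreover obtain s' where "\<And>c. c \<in> C' \<Longrightarrow> s' \<le> f' c"
    using finite_lower_bound[OF assms(2)] by metis
  ultimately have "wfilt C f (min s s') = span C" "wfilt C' f' (min s s') = span C'"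
    by (auto intro!: fs_low simp: min_le_iff_disj)
  then show ?thesis
    using assms(3) by metis
qed

lemma span_insert_cong:
  assumes "span A = span B" "v - k *\<^sub>R w \<in> span B" "k \<noteq> 0"
  shows "span (insert v A) = span (insert w B)"
proof (rule antisym)
  have "v = (v - k *\<^sub>R w) + k *\<^sub>R w" by simp
  moreover have "v - k *\<^sub>R w \<in> span (insert w B)" "w \<in> span (insert w B)"
    using assms(2) span_mono[of B "insert w B"] by (auto intro: span_base)
  ultimately have "v \<in> span (insert w B)"
    by (metis span_add span_scale)
  moreover have "A \<subseteq> span (insert w B)"
    using assms(1) span_superset[of A] span_mono[of B "insert w B"] by auto
  ultimately show "span (insert v A) \<subseteq> span (insert w B)"
    by (intro span_minimal) auto
  have "w = (1 / k) *\<^sub>R (v - (v - k *\<^sub>R w))"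
    using assms(3) by simp
  moreover have "v - k *\<^sub>R w \<in> span (insert v A)" "v \<in> span (insert v A)"
    using assms(1,2) span_mono[of A "insert v A"] by (auto intro: span_base)
  ultimately have "w \<in> span (insert v A)"
    by (metis span_diff span_scale)
  moreover have "B \<subseteq> span (insert v A)"
    using assms(1) span_superset[of B] span_mono[of A "insert v A"] by auto
  ultimately show "span (insert w B) \<subseteq> span (insert v A)"
    by (intro span_minimal) auto
qed

lemma fs_insert:
  assumes "c \<notin> C"
  shows "wfilt (insert c C) (f(c := r)) s = (if s \<le> r then span (insert c {x \<in> C. s \<le> f x}) else wfilt C f s)"
proof -
  have "{x \<in> insert c C. s \<le> (f(c := r)) x} = (if s \<le> r then insert c {x \<in> C. s \<le> f x} else {x \<in> C. s \<le> f x})"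
    using assms by auto
  then show ?thesis
    by (simp add: wfilt_def)
qed

lemma fs_remove:
  assumes "c \<in> C"
  shows "wfilt C f s = (if s \<le> f c then span (insert c {x \<in> C - {c}. s \<le> f x}) else wfilt (C - {c}) f s)"
  using fs_insert[of c "C - {c}" f "f c" s] assms by (simp add: insert_absorb)

text \<open>Gram-Schmidt with the lightest vector treated last. Each level that contains this vector
  contains all the others as well, so subtracting a combination of them changes no level.\<close>

lemma adapted_orthonormal:
  assumes "finite C" "independent C"
  shows "\<exists>U e. finite U \<and> pairwise orthogonal U \<and> (\<forall>u\<in>U. norm u = 1) \<and> (\<forall>s. wfilt U e s = wfilt C f s)"
  using assms
proof (induction "card C" arbitrary: C)
  case 0
  then show ?case
    by (intro exI[of _ "{}"]) auto
next
  case (Suc n)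
  then have "C \<noteq> {}" by auto
  then obtain c0 where c0: "c0 \<in> C" and low: "\<And>c. c \<in> C \<Longrightarrow> f c0 \<le> f c"
    using Suc.prems(1) by (metis arg_min_if_finite(1) arg_min_least)
  let ?C = "C - {c0}"
  have "independent ?C"
    using Suc.prems(2) independent_mono by blast
  moreover have "n = card ?C"
    using Suc c0 by simp
  ultimately obtain U e where U: "finite U" "pairwise orthogonal U" "\<And>u. u \<in> U \<Longrightarrow> norm u = 1"
    and fsU: "\<And>s. wfilt U e s = wfilt ?C f s"
    using Suc.hyps(1)[of ?C] Suc.prems by auto
  have spanU: "span U = span ?C"
    using fs_eq_span_eq[OF U(1) _ fsU] Suc.prems by simp
  obtain y z where yz: "y \<in> span ?C" "\<And>w. w \<in> span ?C \<Longrightarrow> orthogonal z w" "c0 = y + z"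
    using orthogonal_subspace_decomp_exists[of ?C c0] by metis
  have "c0 \<notin> span ?C"
    using Suc.prems(2) c0 by (simp add: dependent_def)
  then have z0: "z \<noteq> 0"
    using yz by auto
  define v where "v = z /\<^sub>R norm z"
  have nv: "norm v = 1"
    using z0 by (simp add: v_def)
  have orth: "orthogonal v w" if "w \<in> U" for w
    using yz(2)[of w] span_base[OF that] spanU by (auto simp: v_def orthogonal_def)
  have vU: "v \<notin> U"
    using orth[of v] nv by (auto simp: orthogonal_def)
  have "wfilt (insert v U) (e(v := f c0)) s = wfilt C f s" for s
  proof (cases "s \<le> f c0")
    case True
    have low': "wfilt ?C f s = span ?C"
      by (rule fs_low) (use low True in force)
    have "span (insert v {u \<in> U. s \<le> e u}) = span (insert c0 {x \<in> ?C. s \<le> f x})"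
    proof (rule span_insert_cong[where k = "inverse (norm z)"])
      show "span {u \<in> U. s \<le> e u} = span {x \<in> ?C. s \<le> f x}"
        using fsU[of s] by (simp add: wfilt_def)
      have "v - inverse (norm z) *\<^sub>R c0 = - (inverse (norm z) *\<^sub>R y)"
        by (simp add: v_def yz(3) algebra_simps)
      then show "v - inverse (norm z) *\<^sub>R c0 \<in> span {x \<in> ?C. s \<le> f x}"
        using yz(1) low' by (simp add: wfilt_def span_neg span_scale)
    qed (use z0 in simp)
    then show ?thesis
      using True by (simp add: fs_insert[OF vU] fs_remove[OF c0])
  next
    case False
    then show ?thesis
      by (simp add: fs_insert[OF vU] fs_remove[OF c0] fsU)
  qed
  moreover have "pairwise orthogonal (insert v U)"
    using U(2) orth by (auto simp: pairwise_insert orthogonal_commute)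
  ultimately show ?case
    using U nv by (intro exI[of _ "insert v U"] exI[of _ "e(v := f c0)"]) auto
qed

lemma fs_dim:
  assumes "independent C"
  shows "card {c \<in> C. s \<le> f c} = dim (wfilt C f s)"
  unfolding wfilt_def using dim_span_eq_card_independent[OF independent_mono[OF assms], of "{c \<in> C. s \<le> f c}"] by simp

text \<open>The multiplicity of \<open>s\<close> is the drop of dimension of the filtration right
  after \<open>s\<close>; \<open>s'\<close> is a level above \<open>s\<close> with no weight
  strictly between.\<close>

lemma weight_multiplicity:
  assumes fin: "finite C" "finite C'" and ind: "independent C" "independent C'"
    and eq: "\<And>s. wfilt C f s = wfilt C' f' s"
  shows "card {c \<in> C. f c = s} = card {c \<in> C'. f' c = s}"
proof -
  have ge: "card {c \<in> C. s \<le> f c} = card {c \<in> C'. s \<le> f' c}" for s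
    using eq by (simp add: fs_dim ind)
  let ?V = "{v \<in> f ` C \<union> f' ` C'. s < v}"
  obtain s' where s': "s < s'" "\<And>v. v \<in> ?V \<Longrightarrow> s' \<le> v"
  proof (cases "?V = {}")
    case True
    then show thesis
      using that[of "s + 1"] by auto
  next
    case False
    moreover have "finite ?V"
      using fin by simp
    ultimately show thesis
      using that[of "Min ?V"] Min_in[of ?V] by auto
  qed
  have "{c \<in> C. s < f c} = {c \<in> C. s' \<le> f c}" "{c \<in> C'. s < f' c} = {c \<in> C'. s' \<le> f' c}"
    using s' by force+
  then have gt: "card {c \<in> C. s < f c} = card {c \<in> C'. s < f' c}"
    using ge by simp
  have split: "card {c \<in> D. s \<le> h c} = card {c \<in> D. s < h c} + card {c \<in> D. h c = s}"
    if "finite D" for D :: "'a set" and h :: "'a \<Rightarrow> real"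
  proof -
    have "{c \<in> D. s \<le> h c} = {c \<in> D. s < h c} \<union> {c \<in> D. h c = s}"
      by auto
    then show ?thesis
      using that by (simp add: card_Un_disjoint disjoint_iff)
  qed
  show ?thesis
    using split[OF fin(1), of f] split[OF fin(2), of f'] ge[of s] gt by linarith
qed

lemma sum_by_multiplicity:
  fixes f :: "'b \<Rightarrow> real" and \<phi> :: "real \<Rightarrow> real"
  assumes "finite C" "finite V" "f ` C \<subseteq> V"
  shows "(\<Sum>c\<in>C. \<phi> (f c)) = (\<Sum>v\<in>V. real (card {c \<in> C. f c = v}) * \<phi> v)"
proof -
  have "(\<Sum>c\<in>C. \<phi> (f c)) = (\<Sum>v\<in>V. \<Sum>c\<in>{c \<in> C. f c = v}. \<phi> (f c))"
    by (rule sum.group[symmetric]) (use assms in auto)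
  also have "\<dots> = (\<Sum>v\<in>V. real (card {c \<in> C. f c = v}) * \<phi> v)"
    by (rule sum.cong) auto
  finally show ?thesis .
qed

lemma weight_sum_eq:
  fixes \<phi> :: "real \<Rightarrow> real"
  assumes "finite C" "finite C'" "independent C" "independent C'" "\<And>s. wfilt C f s = wfilt C' f' s"
  shows "(\<Sum>c\<in>C. \<phi> (f c)) = (\<Sum>c\<in>C'. \<phi> (f' c))"
proof -
  let ?V = "f ` C \<union> f' ` C'"
  have "(\<Sum>c\<in>C. \<phi> (f c)) = (\<Sum>v\<in>?V. real (card {c \<in> C. f c = v}) * \<phi> v)"
    by (rule sum_by_multiplicity) (use assms in auto)
  moreover have "(\<Sum>c\<in>C'. \<phi> (f' c)) = (\<Sum>v\<in>?V. real (card {c \<in> C'. f' c = v}) * \<phi> v)"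
    by (rule sum_by_multiplicity) (use assms in auto)
  ultimately show ?thesis
    using weight_multiplicity[OF assms] by simp
qed

text \<open>Any two filtrations have a common adapted basis. Splitting off a vector \<open>c\<^sub>0\<close> of minimal
  weight for the first one leaves a hyperplane; the second basis is moved into it by subtracting
  multiples of its heaviest vector \<open>b\<^sub>0\<close> outside of the hyperplane, which does not change the second
  filtration.\<close>

lemma common_adapted_basis:
  assumes "finite C" "finite C'" "independent C" "independent C'" "span C = span C'"
  shows "\<exists>K h h'. finite K \<and> independent K \<and> (\<forall>s. wfilt K h s = wfilt C f s) \<and> (\<forall>s. wfilt K h' s = wfilt C' f' s)"
  using assms
proof (induction "card C" arbitrary: C C' f')
  case 0
  then have "C = {}" by simp
  then have "C' \<subseteq> {0}"
    using 0 span_superset[of C'] by simp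
  moreover have "0 \<notin> C'"
    using 0 dependent_zero by blast
  ultimately have "C' = {}" by blast
  then show ?case
    using \<open>C = {}\<close> by (intro exI[of _ "{}"]) (auto simp: independent_empty)
next
  case (Suc n)
  note fin = Suc.prems(1,2) and ind = Suc.prems(3,4) and sp = Suc.prems(5)
  have "C \<noteq> {}"
    using Suc.hyps(2) by auto
  then obtain c0 where c0: "c0 \<in> C" and low: "\<And>c. c \<in> C \<Longrightarrow> f c0 \<le> f c"
    using fin(1) by (metis arg_min_if_finite(1) arg_min_least)
  let ?C = "C - {c0}"
  define H where "H = span ?C"
  have subH: "subspace H"
    by (simp add: H_def)
  have c0H: "c0 \<notin> H"
    using ind(1) c0 by (simp add: dependent_def H_def)
  have spanC: "span C = span (insert c0 ?C)"
    using c0 by (simp add: insert_absorb)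
  have "\<not> C' \<subseteq> H"
    using c0H sp span_base[OF c0] span_minimal[OF _ subH] by blast
  then obtain b0 where b0: "b0 \<in> C'" "b0 \<notin> H" and heavy: "\<And>b. b \<in> C' \<Longrightarrow> b \<notin> H \<Longrightarrow> f' b \<le> f' b0"
  proof -
    assume *: "\<And>b0. b0 \<in> C' \<Longrightarrow> b0 \<notin> H \<Longrightarrow> (\<And>b. b \<in> C' \<Longrightarrow> b \<notin> H \<Longrightarrow> f' b \<le> f' b0) \<Longrightarrow> thesis"
    let ?B = "{b \<in> C'. b \<notin> H}"
    have ne: "f' ` ?B \<noteq> {}"
      using \<open>\<not> C' \<subseteq> H\<close> by blast
    have fi: "finite (f' ` ?B)"
      using fin(2) by simp
    from Max_in[OF fi ne] obtain b where "b \<in> ?B" "f' b = Max (f' ` ?B)"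
      by (metis (no_types, lifting) imageE)
    then show thesis
      using *[of b] Max_ge[OF fi] by auto
  qed
  \<comment> \<open>Moves \<open>b\<close> into the hyperplane along \<open>b0\<close>. Vectors
    already in \<open>H\<close> stay fixed, which is needed at the levels that do not contain
    \<open>b0\<close>.\<close>
  have "\<exists>l. b - l *\<^sub>R b0 \<in> H \<and> (b \<in> H \<longrightarrow> l = 0)" if "b \<in> C'" for b
  proof -
    have "b0 \<in> span (insert c0 ?C)" "b \<in> span (insert c0 ?C)"
      using that b0 sp spanC span_base by metis+
    then obtain k0 k where k: "b0 - k0 *\<^sub>R c0 \<in> H" "b - k *\<^sub>R c0 \<in> H"
      unfolding H_def span_breakdown_eq by blast
    then have "k0 \<noteq> 0"
      using b0 by auto
    have "(b - k *\<^sub>R c0) - (k / k0) *\<^sub>R (b0 - k0 *\<^sub>R c0) \<in> H"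
      by (rule subspace_diff[OF subH k(2) subspace_scale[OF subH k(1)]])
    also have "(b - k *\<^sub>R c0) - (k / k0) *\<^sub>R (b0 - k0 *\<^sub>R c0) = b - (k / k0) *\<^sub>R b0"
      using \<open>k0 \<noteq> 0\<close> by (simp add: scaleR_diff_right)
    finally have "b - (k / k0) *\<^sub>R b0 \<in> H" .
    then show ?thesis
      by (cases "b \<in> H") (auto intro: exI[of _ 0])
  qed
  then obtain l where l: "\<And>b. b \<in> C' \<Longrightarrow> b - l b *\<^sub>R b0 \<in> H" "\<And>b. b \<in> C' \<Longrightarrow> b \<in> H \<Longrightarrow> l b = 0"
    by metis
  define \<theta> where "\<theta> b = b - l b *\<^sub>R b0" for b
  let ?B = "C' - {b0}"
  have span\<theta>: "span (insert b0 (\<theta> ` X)) = span (insert b0 X)" for X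
  proof (rule antisym)
    have "\<theta> b \<in> span (insert b0 X)" if "b \<in> X" for b
      unfolding \<theta>_def using that by (intro span_diff span_scale span_base) auto
    then show "span (insert b0 (\<theta> ` X)) \<subseteq> span (insert b0 X)"
      by (intro span_minimal) (auto intro: span_base)
    have "b \<in> span (insert b0 (\<theta> ` X))" if "b \<in> X" for b
    proof -
      have "\<theta> b + l b *\<^sub>R b0 \<in> span (insert b0 (\<theta> ` X))"
        using that by (intro span_add span_scale span_base) auto
      then show ?thesis by (simp add: \<theta>_def)
    qed
    then show "span (insert b0 X) \<subseteq> span (insert b0 (\<theta> ` X))"
      by (intro span_minimal) (auto intro: span_base)
  qed
  have cards: "card C' = card C"
    using dim_span_eq_card_independent[OF ind(1)] dim_span_eq_card_independent[OF ind(2)] sp by simp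
  have dimC': "dim (span C') = card C'"
    by (rule dim_span_eq_card_independent[OF ind(2)])
  have spB: "span (insert b0 (\<theta> ` ?B)) = span C'"
    using span\<theta>[of ?B] b0 by (simp add: insert_absorb)
  have finB: "finite (insert b0 (\<theta> ` ?B))"
    using fin by simp
  have cB: "card C' = Suc (card ?B)"
    using b0 fin(2) by (metis card.remove)
  have "card C' \<le> card (insert b0 (\<theta> ` ?B))"
    using dim_le_card[of "span C'" "insert b0 (\<theta> ` ?B)"] finB spB dimC' by simp
  moreover have "card (insert b0 (\<theta> ` ?B)) \<le> Suc (card (\<theta> ` ?B))"
    by (metis card_insert_le_m1 card_insert_if fin(2) finite_Diff finite_imageI le_SucI order_refl)
  moreover have "card (\<theta> ` ?B) \<le> card ?B"
    using fin by (intro card_image_le) simp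
  ultimately have card\<theta>: "card (\<theta> ` ?B) = card ?B" and cardins: "card (insert b0 (\<theta> ` ?B)) = card C'"
    using cB by linarith+
  have inj: "inj_on \<theta> ?B"
    using card\<theta> fin by (intro eq_card_imp_inj_on) simp_all
  have indins: "independent (insert b0 (\<theta> ` ?B))"
    by (rule card_le_dim_spanning[of _ "span C'"])
       (use spB finB dimC' cardins in \<open>auto simp: span_superset intro: span_base\<close>)
  then have ind\<theta>: "independent (\<theta> ` ?B)"
    using independent_mono by blast
  have \<theta>H: "\<theta> ` ?B \<subseteq> H"
    using l by (auto simp: \<theta>_def)
  have n: "n = card ?C"
    using Suc.hyps(2) c0 fin by simp
  have ind1: "independent ?C"
    using ind independent_mono by blast
  have spanH: "span (\<theta> ` ?B) = H"
  proof (rule subspace_dim_equal[OF subspace_span subH])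
    show "span (\<theta> ` ?B) \<subseteq> H"
      by (rule span_minimal[OF \<theta>H subH])
    have "dim H = card ?C"
      unfolding H_def by (rule dim_span_eq_card_independent[OF ind1])
    moreover have "dim (span (\<theta> ` ?B)) = card ?B"
      using dim_span_eq_card_independent[OF ind\<theta>] card\<theta> by simp
    moreover have "card ?C = card ?B"
      using cards b0 c0 fin by simp
    ultimately show "dim H \<le> dim (span (\<theta> ` ?B))"
      by simp
  qed
  define f1 where "f1 = f' \<circ> inv_into ?B \<theta>"
  have f1: "f1 (\<theta> b) = f' b" if "b \<in> ?B" for b
    using inj that by (simp add: f1_def)
  obtain K h h' where K: "finite K" "independent K"
    and h: "\<And>s. wfilt K h s = wfilt ?C f s" and h': "\<And>s. wfilt K h' s = wfilt (\<theta> ` ?B) f1 s"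
    using Suc.hyps(1)[OF n _ _ ind1 ind\<theta>, of f1] fin spanH unfolding H_def by blast
  have spanK: "span K = H"
    unfolding H_def by (rule fs_eq_span_eq[OF K(1) _ h]) (use fin in simp)
  have b0K: "b0 \<notin> K"
    using b0 spanK span_base by blast
  have "independent (insert b0 K)"
    using K b0 spanK by (simp add: independent_insert)
  moreover have "wfilt (insert b0 K) (h(b0 := f c0)) s = wfilt C f s" for s
  proof (cases "s \<le> f c0")
    case True
    have lowC: "wfilt ?C f s = H"
      unfolding H_def by (rule fs_low) (use low True in force)
    have "b0 \<in> span (insert c0 ?C)"
      using b0 sp spanC span_base by metis
    then obtain k where k: "b0 - k *\<^sub>R c0 \<in> H"
      unfolding H_def span_breakdown_eq by blast
    \<comment> \<open>Modulo \<open>H\<close> the vector \<open>b0\<close> is a nonzero multiple of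
      \<open>c0\<close>; as \<open>c0\<close> is lightest, the level contains all of
      \<open>H\<close>, so either vector completes it.\<close>
    have "span (insert b0 {x \<in> K. s \<le> h x}) = span (insert c0 {x \<in> ?C. s \<le> f x})"
    proof (rule span_insert_cong[where k = k])
      show "span {x \<in> K. s \<le> h x} = span {x \<in> ?C. s \<le> f x}"
        using h[of s] by (simp add: wfilt_def)
      show "b0 - k *\<^sub>R c0 \<in> span {x \<in> ?C. s \<le> f x}"
        using k lowC by (simp add: wfilt_def)
      show "k \<noteq> 0"
        using k b0 by auto
    qed
    then show ?thesis
      using True by (simp add: fs_insert[OF b0K] fs_remove[OF c0])
  next
    case False
    then show ?thesis
      by (simp add: fs_insert[OF b0K] fs_remove[OF c0] h)
  qed
  moreover have "wfilt (insert b0 K) (h'(b0 := f' b0)) s = wfilt C' f' s" for s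
  proof -
    have im: "{y \<in> \<theta> ` ?B. s \<le> f1 y} = \<theta> ` {b \<in> ?B. s \<le> f' b}"
      using f1 by auto
    show ?thesis
    proof (cases "s \<le> f' b0")
      case True
      have "span (insert b0 {x \<in> K. s \<le> h' x}) = span (insert b0 {y \<in> \<theta> ` ?B. s \<le> f1 y})"
        by (rule span_insert_cong[where k = 1]) (use h'[of s] in \<open>simp_all add: wfilt_def span_zero\<close>)
      then show ?thesis
        using True by (simp add: fs_insert[OF b0K] fs_remove[OF b0(1)] im span\<theta>)
    next
      case False
      \<comment> \<open>A vector heavier than \<open>b0\<close> lies in \<open>H\<close> by the
        choice of \<open>b0\<close>, so it was not moved.\<close>
      have "\<theta> b = b" if "b \<in> ?B" "s \<le> f' b" for b
        using heavy[of b] that False l(2)[of b] by (force simp: \<theta>_def)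
      then have "\<theta> ` {b \<in> ?B. s \<le> f' b} = {b \<in> ?B. s \<le> f' b}"
        by auto
      then have "wfilt (\<theta> ` ?B) f1 s = wfilt ?B f' s"
        unfolding wfilt_def im by simp
      then show ?thesis
        using False by (simp add: fs_insert[OF b0K] fs_remove[OF b0(1)] h')
    qed
  qed
  ultimately show ?case
    using K(1) by (intro exI[of _ "insert b0 K"] exI[of _ "h(b0 := f c0)"] exI[of _ "h'(b0 := f' b0)"]) auto
qed

text \<open>Coordinates with respect to \<open>K\<close> are unique, so the support of
  \<open>x\<close> lies in both subsets. This is what makes the average of two multiplicative
  weights on one basis multiplicative.\<close>

lemma independent_span_Int:
  assumes ind: "independent K" and A: "A \<subseteq> K" and B: "B \<subseteq> K" and x: "x \<in> span A" "x \<in> span B"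
  shows "x \<in> span (A \<inter> B)"
proof -
  have xK: "x \<in> span K"
    using x(1) span_mono[OF A] by blast
  have "representation A x = representation K x" "representation B x = representation K x"
    using representation_extend[OF ind x(1) A] representation_extend[OF ind x(2) B] by simp_all
  then have supp: "{c. representation K x c \<noteq> 0} \<subseteq> A \<inter> B"
    using representation_ne_zero[of A x] representation_ne_zero[of B x] by auto
  have "x = (\<Sum>c | representation K x c \<noteq> 0. representation K x c *\<^sub>R c)"
    using sum_nonzero_representation_eq[OF ind xK] by simp
  also have "\<dots> \<in> span (A \<inter> B)"
    using supp by (intro span_sum span_scale span_base) auto
  finally show ?thesis .
qed

lemma bounded_family_convergent_subsequence:
  fixes x :: "nat \<Rightarrow> 'i \<Rightarrow> 'b::heine_borel"
  assumes "finite I" "\<And>i. i \<in> I \<Longrightarrow> bounded (range (\<lambda>n. x n i))"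
  shows "\<exists>l r. strict_mono (r :: nat \<Rightarrow> nat) \<and> (\<forall>i\<in>I. (\<lambda>n. x (r n) i) \<longlonglongrightarrow> l i)"
  using assms
proof (induction I)
  case empty
  then show ?case
    using strict_mono_id by blast
next
  case (insert j I)
  then obtain l and r :: "nat \<Rightarrow> nat" where r: "strict_mono r" "\<And>i. i \<in> I \<Longrightarrow> (\<lambda>n. x (r n) i) \<longlonglongrightarrow> l i"
    by auto
  have "bounded (range (\<lambda>n. x (r n) j))"
    by (rule bounded_subset[of "range (\<lambda>n. x n j)"]) (use insert in auto)
  then obtain a and q :: "nat \<Rightarrow> nat" where q: "strict_mono q" "((\<lambda>n. x (r n) j) \<circ> q) \<longlonglongrightarrow> a"
    using bounded_imp_convergent_subsequence by blast
  have "(\<lambda>n. x ((r \<circ> q) n) i) \<longlonglongrightarrow> (l(j := a)) i" if "i \<in> insert j I" for i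
  proof (cases "i = j")
    case True
    then show ?thesis
      using q by (simp add: o_def)
  next
    case False
    then show ?thesis
      using LIMSEQ_subseq_LIMSEQ[OF r(2) q(1), of i] that by (simp add: o_def)
  qed
  then show ?case
    using strict_mono_o[OF r(1) q(1)] by blast
qed

subsection \<open>Exponentials of linear operators\<close>

definition opexp :: "('a::euclidean_space \<Rightarrow> 'a) \<Rightarrow> 'a \<Rightarrow> 'a" where
  "opexp A x = (\<Sum>k. (A ^^ k) x /\<^sub>R fact k)"

lemma linear_funpow: "linear A \<Longrightarrow> linear (A ^^ k)" for A :: "'a::euclidean_space \<Rightarrow> 'a"
proof (induction k)
  case 0
  show ?case using linear_id by (simp add: id_def)
next
  case (Suc k)
  then show ?case using linear_compose[of "A ^^ k" A] by (simp add: o_def)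
qed

lemma opexp_norm_summable:
  fixes A :: "'a::euclidean_space \<Rightarrow> 'a"
  assumes "linear A"
  shows "summable (\<lambda>k. norm ((A ^^ k) x /\<^sub>R fact k))"
proof -
  obtain B where B: "0 < B" "\<And>x. norm (A x) \<le> B * norm x"
    using linear_bounded_pos[OF assms] by blast
  have le: "norm ((A ^^ k) x) \<le> B ^ k * norm x" for k
  proof (induction k)
    case (Suc k)
    have "norm (A ((A ^^ k) x)) \<le> B * norm ((A ^^ k) x)"
      by (rule B)
    also have "\<dots> \<le> B * (B ^ k * norm x)"
      using Suc B by (intro mult_left_mono) auto
    finally show ?case by (simp add: mult_ac)
  qed simp
  have "summable (\<lambda>k. (B ^ k /\<^sub>R fact k) * norm x)"
    using summable_exp_generic[of B] by (rule summable_mult2)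
  then show ?thesis
    by (rule summable_comparison_test_ev[rotated])
       (use le in \<open>auto intro!: always_eventually simp: field_simps\<close>)
qed

lemma opexp_sums: "linear A \<Longrightarrow> (\<lambda>k. (A ^^ k) x /\<^sub>R fact k) sums opexp A x"
  unfolding opexp_def by (rule summable_sums[OF summable_norm_cancel[OF opexp_norm_summable]])

lemma linear_opexp:
  assumes A: "linear A"
  shows "linear (opexp A)"
proof (rule linearI)
  note lin = linear_funpow[OF A]
  show "opexp A (x + y) = opexp A x + opexp A y" for x y
    using sums_add[OF opexp_sums[OF A, of x] opexp_sums[OF A, of y]] opexp_sums[OF A, of "x + y"]
    by (auto simp: linear_add[OF lin] scaleR_add_right intro: sums_unique2)
  show "opexp A (c *\<^sub>R x) = c *\<^sub>R opexp A x" for c x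
    using sums_scaleR_right[OF opexp_sums[OF A, of x], of c] opexp_sums[OF A, of "c *\<^sub>R x"]
    by (auto simp: linear_cmul[OF lin] mult.commute intro: sums_unique2)
qed

text \<open>With divided powers the Leibniz rule carries no binomial coefficients. Three different
  operators are allowed so that it covers the bracket as well as the inner product.\<close>

lemma bilinear_leibniz:
  fixes \<beta> :: "'a::euclidean_space \<Rightarrow> 'b::euclidean_space \<Rightarrow> 'c::euclidean_space"
  assumes \<beta>: "bilinear \<beta>" and C: "linear C"
    and leib: "\<And>x y. C (\<beta> x y) = \<beta> (A x) y + \<beta> x (B y)"
  shows "(C ^^ k) (\<beta> x y) /\<^sub>R fact k = (\<Sum>i\<le>k. \<beta> ((A ^^ i) x /\<^sub>R fact i) ((B ^^ (k - i)) y /\<^sub>R fact (k - i)))"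
proof (induction k)
  case (Suc k)
  define a where "a i = (A ^^ i) x /\<^sub>R fact i" for i
  define b where "b i = (B ^^ i) y /\<^sub>R fact i" for i
  have step: "C (\<beta> (a i) (b j)) = (real (Suc i)) *\<^sub>R \<beta> (a (Suc i)) (b j) + (real (Suc j)) *\<^sub>R \<beta> (a i) (b (Suc j))" for i j
  proof -
    have "C (\<beta> (a i) (b j)) = (1 / (fact i * fact j)) *\<^sub>R C (\<beta> ((A ^^ i) x) ((B ^^ j) y))"
      by (simp add: a_def b_def bilinear_lmul[OF \<beta>] bilinear_rmul[OF \<beta>] linear_cmul[OF C] divide_inverse)
    also have "\<dots> = real (Suc i) *\<^sub>R \<beta> (a (Suc i)) (b j) + real (Suc j) *\<^sub>R \<beta> (a i) (b (Suc j))"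
      by (simp add: leib a_def b_def bilinear_lmul[OF \<beta>] bilinear_rmul[OF \<beta>] scaleR_add_right
          del: of_nat_Suc) (simp add: field_simps del: of_nat_Suc)
    finally show ?thesis .
  qed
  define X where "X i = \<beta> (a i) (b (Suc k - i))" for i
  have "real (Suc k) *\<^sub>R ((C ^^ Suc k) (\<beta> x y) /\<^sub>R fact (Suc k)) = C ((C ^^ k) (\<beta> x y) /\<^sub>R fact k)"
    by (simp add: linear_cmul[OF C] del: of_nat_Suc)
  also have "\<dots> = C (\<Sum>i\<le>k. \<beta> (a i) (b (k - i)))"
    by (simp add: Suc a_def b_def)
  also have "\<dots> = (\<Sum>i\<le>k. real (Suc i) *\<^sub>R X (Suc i) + real (Suc k - i) *\<^sub>R X i)"
    unfolding linear_sum[OF C]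
    by (rule sum.cong) (auto simp: step X_def Suc_diff_le simp del: of_nat_Suc)
  also have "\<dots> = (\<Sum>i\<le>Suc k. real i *\<^sub>R X i) + (\<Sum>i\<le>Suc k. real (Suc k - i) *\<^sub>R X i)"
  proof -
    have "(\<Sum>i\<le>Suc k. real i *\<^sub>R X i) = (\<Sum>i\<le>k. real (Suc i) *\<^sub>R X (Suc i))"
      by (subst sum.atMost_Suc_shift) simp
    moreover have "(\<Sum>i\<le>Suc k. real (Suc k - i) *\<^sub>R X i) = (\<Sum>i\<le>k. real (Suc k - i) *\<^sub>R X i)"
      by simp
    ultimately show ?thesis
      by (simp only: sum.distrib)
  qed
  also have "\<dots> = (\<Sum>i\<le>Suc k. real (Suc k) *\<^sub>R X i)"
    unfolding sum.distrib[symmetric]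
    by (rule sum.cong) (auto simp: scaleR_left_distrib[symmetric] of_nat_diff simp del: of_nat_Suc)
  also have "\<dots> = real (Suc k) *\<^sub>R (\<Sum>i\<le>Suc k. X i)"
    by (rule scaleR_right.sum[symmetric])
  finally show ?case
    unfolding X_def a_def b_def by (simp only: real_vector.scale_cancel_left) simp
qed simp

lemma summable_norm_inner:
  assumes "summable (\<lambda>k. norm (a k))"
  shows "summable (\<lambda>k. norm (a k \<bullet> p))"
  by (rule summable_comparison_test'[OF summable_mult2[OF assms, of "norm p"], of 0])
     (simp add: Cauchy_Schwarz_ineq2)

text \<open>The exponentiated Leibniz rule: for a bracket, the exponential of a derivation is an
  automorphism. In coordinates the right hand side becomes a finite combination of Cauchy products
  of real series.\<close>

lemma opexp_bilinear:
  fixes \<beta> :: "'a::euclidean_space \<Rightarrow> 'b::euclidean_space \<Rightarrow> 'c::euclidean_space"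
  assumes \<beta>: "bilinear \<beta>" and A: "linear A" and B: "linear B" and C: "linear C"
    and leib: "\<And>x y. C (\<beta> x y) = \<beta> (A x) y + \<beta> x (B y)"
  shows "opexp C (\<beta> x y) = \<beta> (opexp A x) (opexp B y)"
proof (rule vector_eq_rdot[THEN iffD1], intro allI)
  fix z
  define a where "a i = (A ^^ i) x /\<^sub>R fact i" for i
  define b where "b i = (B ^^ i) y /\<^sub>R fact i" for i
  have expand: "\<beta> v w \<bullet> z = (\<Sum>p\<in>Basis. \<Sum>q\<in>Basis. (v \<bullet> p) * (w \<bullet> q) * (\<beta> p q \<bullet> z))" for v w
  proof -
    have "\<beta> v w = (\<Sum>p\<in>Basis. \<Sum>q\<in>Basis. ((v \<bullet> p) * (w \<bullet> q)) *\<^sub>R \<beta> p q)"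
      by (subst (1) euclidean_representation[of v, symmetric], subst (1) euclidean_representation[of w, symmetric])
         (simp add: bilinear_sum[OF \<beta>] sum.cartesian_product bilinear_lmul[OF \<beta>] bilinear_rmul[OF \<beta>] mult.commute)
    then show ?thesis
      by (simp add: inner_sum_left)
  qed
  have pq: "(\<lambda>k. \<Sum>i\<le>k. (a i \<bullet> p) * (b (k - i) \<bullet> q)) sums ((opexp A x \<bullet> p) * (opexp B y \<bullet> q))" for p q
  proof -
    have "summable (\<lambda>k. norm (a k \<bullet> p))"
      using opexp_norm_summable[OF A, of x] unfolding a_def[symmetric] by (rule summable_norm_inner)
    moreover have "summable (\<lambda>k. norm (b k \<bullet> q))"
      using opexp_norm_summable[OF B, of y] unfolding b_def[symmetric] by (rule summable_norm_inner)
    ultimately have "(\<lambda>k. \<Sum>i\<le>k. (a i \<bullet> p) * (b (k - i) \<bullet> q)) sums ((\<Sum>k. a k \<bullet> p) * (\<Sum>k. b k \<bullet> q))"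
      by (rule Cauchy_product_sums)
    moreover have "(\<Sum>k. a k \<bullet> p) = opexp A x \<bullet> p" "(\<Sum>k. b k \<bullet> q) = opexp B y \<bullet> q"
      using bounded_linear.sums[OF bounded_linear_inner_left opexp_sums[OF A, of x]]
        bounded_linear.sums[OF bounded_linear_inner_left opexp_sums[OF B, of y]]
      by (auto simp: a_def b_def sums_iff)
    ultimately show ?thesis by simp
  qed
  have "(\<lambda>k. \<Sum>p\<in>Basis. \<Sum>q\<in>Basis. (\<Sum>i\<le>k. (a i \<bullet> p) * (b (k - i) \<bullet> q)) * (\<beta> p q \<bullet> z))
      sums (\<beta> (opexp A x) (opexp B y) \<bullet> z)"
    unfolding expand[of "opexp A x" "opexp B y"] by (intro sums_sum sums_mult2 pq)
  moreover have "(\<Sum>p\<in>Basis. \<Sum>q\<in>Basis. (\<Sum>i\<le>k. (a i \<bullet> p) * (b (k - i) \<bullet> q)) * (\<beta> p q \<bullet> z))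
      = ((C ^^ k) (\<beta> x y) /\<^sub>R fact k) \<bullet> z" for k
  proof -
    have "((C ^^ k) (\<beta> x y) /\<^sub>R fact k) \<bullet> z = (\<Sum>i\<le>k. \<beta> (a i) (b (k - i)) \<bullet> z)"
      unfolding bilinear_leibniz[OF \<beta> C leib] by (simp add: a_def b_def inner_sum_left)
    also have "\<dots> = (\<Sum>i\<le>k. \<Sum>p\<in>Basis. \<Sum>q\<in>Basis. (a i \<bullet> p) * (b (k - i) \<bullet> q) * (\<beta> p q \<bullet> z))"
      by (rule sum.cong[OF refl], rule expand)
    also have "\<dots> = (\<Sum>p\<in>Basis. \<Sum>q\<in>Basis. \<Sum>i\<le>k. (a i \<bullet> p) * (b (k - i) \<bullet> q) * (\<beta> p q \<bullet> z))"
      by (subst sum.swap, rule sum.cong[OF refl], rule sum.swap)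
    finally show ?thesis
      by (simp only: sum_distrib_right)
  qed
  ultimately have "(\<lambda>k. ((C ^^ k) (\<beta> x y) /\<^sub>R fact k) \<bullet> z) sums (\<beta> (opexp A x) (opexp B y) \<bullet> z)"
    by simp
  moreover have "(\<lambda>k. ((C ^^ k) (\<beta> x y) /\<^sub>R fact k) \<bullet> z) sums (opexp C (\<beta> x y) \<bullet> z)"
    by (rule bounded_linear.sums[OF bounded_linear_inner_left opexp_sums[OF C]])
  ultimately show "opexp C (\<beta> x y) \<bullet> z = \<beta> (opexp A x) (opexp B y) \<bullet> z"
    by (rule sums_unique2[rotated])
qed

text \<open>The exponentials of \<open>A\<close> and of minus its adjoint preserve the inner product
  jointly: this is the previous lemma with the zero operator on the reals. So
  \<open>opexp A x = 0\<close> forces \<open>x \<bullet> x = 0\<close>.\<close>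

lemma opexp_inj:
  fixes A :: "'a::euclidean_space \<Rightarrow> 'a"
  assumes A: "linear A"
  shows "inj (opexp A)"
proof -
  define B where "B y = - adjoint A y" for y
  have B: "linear B"
    unfolding B_def by (intro linear_compose_neg adjoint_linear A)
  have zero: "linear (\<lambda>r::real. 0 :: real)"
    by (rule linear_zero)
  have "opexp (\<lambda>r::real. 0) (x \<bullet> y) = opexp A x \<bullet> opexp B y" for x y
    by (rule opexp_bilinear[OF _ A B zero])
       (auto simp: bilinear_conv_bounded_bilinear bounded_bilinear_inner B_def adjoint_works[OF A])
  moreover have "opexp (\<lambda>r::real. 0) r = r" for r
  proof -
    have "((\<lambda>r::real. 0) ^^ k) r /\<^sub>R fact k = (if k = 0 then r else 0)" for k
      by (cases k) auto
    then show ?thesis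
      using opexp_sums[OF zero, of r] sums_single[of 0 "\<lambda>_. r"] by (simp add: sums_unique2)
  qed
  ultimately have inner: "x \<bullet> y = opexp A x \<bullet> opexp B y" for x y
    by metis
  have "x = 0" if "opexp A x = 0" for x
    using inner[of x x] that by simp
  then show ?thesis
    using linear_injective_0[OF linear_opexp[OF A]] by blast
qed

text \<open>A power series in \<open>t\<close> that vanishes identically has vanishing linear
  coefficient. It turns invariance under a one-parameter group into invariance under its
  generator.\<close>

lemma opexp_orbit_linear_term:
  fixes A :: "'a::euclidean_space \<Rightarrow> 'a"
  assumes A: "linear A" and zero: "\<And>t. opexp (\<lambda>x. t *\<^sub>R A x) x \<bullet> z = 0"
  shows "A x \<bullet> z = 0"
proof -
  define c where "c k = ((A ^^ k) x \<bullet> z) / fact k" for k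
  have lin: "linear (\<lambda>x. t *\<^sub>R A x)" for t
    using A by (rule linear_compose_scale_right)
  have pow: "((\<lambda>x. t *\<^sub>R A x) ^^ k) x = t ^ k *\<^sub>R (A ^^ k) x" for t k
    by (induction k) (auto simp: linear_cmul[OF A] mult_ac)
  have sums: "(\<lambda>k. c k * t ^ k) sums 0" for t
    using bounded_linear.sums[OF bounded_linear_inner_left opexp_sums[OF lin[of t], of x], of z] zero[of t]
    by (simp add: pow c_def divide_inverse mult_ac)
  have "((\<lambda>t. \<Sum>k. c k * t ^ k) has_field_derivative (\<Sum>k. diffs c k * 0 ^ k)) (at 0)"
    by (rule termdiffs_strong[where K=1]) (use sums[of 1] in \<open>auto simp: sums_iff\<close>)
  moreover have "(\<lambda>t. \<Sum>k. c k * t ^ k) = (\<lambda>t. 0)"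
    using sums by (simp add: sums_iff)
  ultimately have "(\<Sum>k. diffs c k * 0 ^ k) = 0"
    by (metis DERIV_const DERIV_unique)
  then have "diffs c 0 = 0"
    unfolding powser_zero .
  then show ?thesis
    by (simp add: diffs_def c_def)
qed

subsection \<open>Multiplicative filtrations of minimal cost\<close>

text \<open>Moves weights indexed by \<open>Basis\<close> to the vectors of the frame, where
  \<open>wfilt\<close> expects them.\<close>

definition frame_weight :: "('a::euclidean_space \<Rightarrow> 'a) \<Rightarrow> ('a \<Rightarrow> real) \<Rightarrow> 'a \<Rightarrow> real" where
  "frame_weight u e = e \<circ> inv_into Basis u"

definition frame_filt :: "('a::euclidean_space \<Rightarrow> 'a) \<Rightarrow> ('a \<Rightarrow> real) \<Rightarrow> real \<Rightarrow> 'a set" where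
  "frame_filt u e s = span (u ` {i \<in> Basis. s \<le> e i})"

definition frame_cost :: "('a::euclidean_space \<Rightarrow> real) \<Rightarrow> real" where
  "frame_cost e = (\<Sum>i\<in>Basis. (e i - 1)\<^sup>2)"

definition multiplicative :: "('a::euclidean_space \<Rightarrow> 'a \<Rightarrow> 'a) \<Rightarrow> 'a set \<Rightarrow> ('a \<Rightarrow> real) \<Rightarrow> bool" where
  "multiplicative \<mu> C f \<longleftrightarrow> (\<forall>c\<in>C. \<forall>d\<in>C. \<mu> c d \<in> wfilt C f (f c + f d))"

definition frame_multiplicative :: "('a::euclidean_space \<Rightarrow> 'a \<Rightarrow> 'a) \<Rightarrow> ('a \<Rightarrow> 'a) \<Rightarrow> ('a \<Rightarrow> real) \<Rightarrow> bool" where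
  "frame_multiplicative \<mu> u e \<longleftrightarrow> (\<forall>i\<in>Basis. \<forall>j\<in>Basis. \<forall>k\<in>Basis. \<mu> (u i) (u j) \<bullet> u k \<noteq> 0 \<longrightarrow> e i + e j \<le> e k)"

lemma fw_apply: "inj_on u Basis \<Longrightarrow> i \<in> Basis \<Longrightarrow> frame_weight u e (u i) = e i"
  by (simp add: frame_weight_def)

lemma fs_frame:
  assumes "inj_on u Basis"
  shows "wfilt (u ` Basis) (frame_weight u e) s = frame_filt u e s"
proof -
  have "{c \<in> u ` Basis. s \<le> frame_weight u e c} = u ` {i \<in> Basis. s \<le> e i}"
    using fw_apply[OF assms] by auto
  then show ?thesis
    by (simp add: wfilt_def frame_filt_def)
qed

lemma sum_frame:
  assumes "inj_on u Basis"
  shows "(\<Sum>c\<in>u ` Basis. \<phi> (frame_weight u e c)) = (\<Sum>i\<in>Basis. \<phi> (e i))"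
  by (simp add: sum.reindex[OF assms] fw_apply[OF assms])

lemma subspace_ffs: "subspace (frame_filt u e s)"
  by (simp add: frame_filt_def)

lemma ffs_base: "i \<in> Basis \<Longrightarrow> s \<le> e i \<Longrightarrow> u i \<in> frame_filt u e s"
  unfolding frame_filt_def by (rule span_base) auto

lemma mem_ffs:
  assumes u: "oframe u"
  shows "x \<in> frame_filt u e s \<longleftrightarrow> (\<forall>i\<in>Basis. e i < s \<longrightarrow> x \<bullet> u i = 0)"
proof
  assume "x \<in> frame_filt u e s"
  then show "\<forall>i\<in>Basis. e i < s \<longrightarrow> x \<bullet> u i = 0"
    unfolding frame_filt_def
  proof (induction rule: span_induct_alt)
    case (step c y z)
    then show ?case
      by (auto simp: inner_add_left oframeD[OF u] split: if_splits)
  qed simp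
next
  assume *: "\<forall>i\<in>Basis. e i < s \<longrightarrow> x \<bullet> u i = 0"
  have "(\<Sum>i\<in>Basis. (x \<bullet> u i) *\<^sub>R u i) \<in> frame_filt u e s"
  proof (rule subspace_sum[OF subspace_ffs])
    fix i :: 'a assume i: "i \<in> Basis"
    show "(x \<bullet> u i) *\<^sub>R u i \<in> frame_filt u e s"
    proof (cases "e i < s")
      case True
      then show ?thesis
        using * i by (simp add: subspace_0[OF subspace_ffs])
    next
      case False
      then show ?thesis
        using i by (intro subspace_scale[OF subspace_ffs] ffs_base) auto
    qed
  qed
  then show "x \<in> frame_filt u e s"
    by (simp add: oframe_expand[OF u])
qed

lemma multiplicative_fs:
  assumes \<mu>: "bilinear \<mu>" and m: "multiplicative \<mu> C f" and x: "x \<in> wfilt C f s" and y: "y \<in> wfilt C f t"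
  shows "\<mu> x y \<in> wfilt C f (s + t)"
proof -
  have 1: "\<mu> c y \<in> wfilt C f (s + t)" if c: "c \<in> C" "s \<le> f c" for c
    using y unfolding wfilt_def[of C f t]
  proof (induction rule: span_induct_alt)
    case base
    then show ?case
      by (simp add: bilinear_rzero[OF \<mu>] subspace_0[OF subspace_fs])
  next
    case (step k d z)
    have "\<mu> c d \<in> wfilt C f (f c + f d)"
      using m c step by (auto simp: multiplicative_def)
    moreover have "wfilt C f (f c + f d) \<subseteq> wfilt C f (s + t)"
      using c step by (intro fs_mono) auto
    ultimately show ?case
      using step
      by (auto simp: bilinear_radd[OF \<mu>] bilinear_rmul[OF \<mu>] intro!: subspace_add[OF subspace_fs] subspace_scale[OF subspace_fs])
  qed
  from x show ?thesis
    unfolding wfilt_def[of C f s]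
  proof (induction rule: span_induct_alt)
    case base
    then show ?case
      by (simp add: bilinear_lzero[OF \<mu>] subspace_0[OF subspace_fs])
  next
    case (step k d z)
    then show ?case
      using 1[of d]
      by (auto simp: bilinear_ladd[OF \<mu>] bilinear_lmul[OF \<mu>] intro!: subspace_add[OF subspace_fs] subspace_scale[OF subspace_fs])
  qed
qed

text \<open>Multiplicativity is a property of the filtration, not of the weighted basis that
  presents it.\<close>

lemma multiplicative_transfer:
  assumes \<mu>: "bilinear \<mu>" and m: "multiplicative \<mu> C f" and eq: "\<And>s. wfilt C' f' s = wfilt C f s"
  shows "multiplicative \<mu> C' f'"
  unfolding multiplicative_def
proof (intro ballI)
  fix c d assume "c \<in> C'" "d \<in> C'"
  then have "c \<in> wfilt C f (f' c)" "d \<in> wfilt C f (f' d)"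
    using fs_base[of _ C' f'] by (simp_all add: eq)
  then show "\<mu> c d \<in> wfilt C' f' (f' c + f' d)"
    unfolding eq by (rule multiplicative_fs[OF \<mu> m])
qed

lemma multiplicative_frame:
  assumes u: "oframe u"
  shows "multiplicative \<mu> (u ` Basis) (frame_weight u e) \<longleftrightarrow> frame_multiplicative \<mu> u e"
  unfolding multiplicative_def frame_multiplicative_def fs_frame[OF oframe_inj[OF u]] mem_ffs[OF u]
  by (auto simp: fw_apply[OF oframe_inj[OF u]] not_less) (metis not_le)+

lemma adapted_frame:
  fixes C :: "'a::euclidean_space set"
  assumes ind: "independent C" and sp: "span C = UNIV"
  obtains u e where "oframe u" "\<And>s. frame_filt u e s = wfilt C f s"
proof -
  have fin: "finite C"
    using ind by (rule independent_imp_finite)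
  from adapted_orthonormal[OF fin ind, of f] obtain U e
    where U: "finite U" "pairwise orthogonal U" "\<forall>u\<in>U. norm u = 1" and "\<forall>s. wfilt U e s = wfilt C f s"
    by blast
  then have eq: "wfilt U e s = wfilt C f s" for s
    by blast
  have "span U = UNIV"
    using fs_eq_span_eq[OF U(1) fin eq] sp by simp
  then obtain u where u: "oframe u" and img: "u ` Basis = U"
    using orthonormal_basis_frame[OF U(2)] U(3) by metis
  have "frame_filt u (e \<circ> u) s = wfilt C f s" for s
  proof -
    have "u ` {i \<in> Basis. s \<le> (e \<circ> u) i} = {c \<in> U. s \<le> e c}"
      using img by auto
    then show ?thesis
      using eq[of s] by (simp add: frame_filt_def wfilt_def)
  qed
  with u show thesis
    using that by blast
qed

text \<open>Orthonormal frames form a compact set, and the cost bounds the weights, so a minimizing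
  sequence has a limit. The limit is multiplicative since a coefficient that is nonzero there is
  eventually nonzero along the sequence.\<close>

lemma exists_optimal_frame:
  fixes \<mu> :: "'a::euclidean_space \<Rightarrow> 'a \<Rightarrow> 'a"
  assumes \<mu>: "bilinear \<mu>"
  obtains u e where "oframe u" "frame_multiplicative \<mu> u e"
    "\<And>u' e'. oframe u' \<Longrightarrow> frame_multiplicative \<mu> u' e' \<Longrightarrow> frame_cost e \<le> frame_cost e'"
proof -
  let ?S = "{frame_cost e | u e. oframe u \<and> frame_multiplicative \<mu> u e}"
  define m where "m = Inf ?S"
  have "frame_multiplicative \<mu> (\<lambda>x. x) (\<lambda>_. 0)"
    by (simp add: frame_multiplicative_def)
  then have ne: "?S \<noteq> {}"
    using oframe_id by blast
  have nonneg: "0 \<le> frame_cost e" for e :: "'a \<Rightarrow> real"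
    by (simp add: frame_cost_def sum_nonneg)
  have bdd: "bdd_below ?S"
    using nonneg by (intro bdd_belowI[of _ 0]) auto
  have "\<exists>u e. oframe u \<and> frame_multiplicative \<mu> u e \<and> frame_cost e < m + 1 / real (Suc n)" for n
  proof -
    have "m < m + 1 / real (Suc n)" by simp
    then obtain c where "c \<in> ?S" "c < m + 1 / real (Suc n)"
      unfolding m_def using cInf_less_iff[OF ne bdd] by blast
    then show ?thesis by blast
  qed
  then obtain u e where u: "\<And>n. oframe (u n)" and mult: "\<And>n. frame_multiplicative \<mu> (u n) (e n)"
    and cost: "\<And>n. frame_cost (e n) < m + 1 / real (Suc n)"
    by metis
  have bu: "bounded (range (\<lambda>n. (u n i, e n i)))" if i: "i \<in> Basis" for i
  proof -
    have "\<bar>e n i\<bar> \<le> 2 + (m + 1)" for n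
    proof -
      have "(e n i - 1)\<^sup>2 \<le> frame_cost (e n)"
        unfolding frame_cost_def using i by (intro member_le_sum) auto
      also have "\<dots> \<le> m + 1"
      proof -
        have "1 / real (Suc n) \<le> 1"
          by simp
        then show ?thesis
          using cost[of n] by linarith
      qed
      finally have "(e n i - 1)\<^sup>2 \<le> m + 1" .
      moreover have "\<bar>e n i - 1\<bar> \<le> 1 + (e n i - 1)\<^sup>2"
        using abs_square_le_1 self_le_power[of "\<bar>e n i - 1\<bar>" 2] by (cases "\<bar>e n i - 1\<bar> \<le> 1") (auto simp: add_increasing2)
      ultimately show ?thesis by linarith
    qed
    then have "norm (u n i, e n i) \<le> 1 + (2 + (m + 1))" for n
      using norm_Pair_le[of "u n i" "e n i"] oframe_norm[OF u i, of n] by (smt (verit) real_norm_def)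
    then show ?thesis
      by (intro boundedI) auto
  qed
  have "\<exists>l r. strict_mono (r :: nat \<Rightarrow> nat) \<and> (\<forall>i\<in>Basis. (\<lambda>n. (u (r n) i, e (r n) i)) \<longlonglongrightarrow> l i)"
    using bounded_family_convergent_subsequence[of Basis "\<lambda>n i. (u n i, e n i)"] bu by simp
  then obtain l and r :: "nat \<Rightarrow> nat" where r: "strict_mono r"
    and lim: "\<And>i. i \<in> Basis \<Longrightarrow> (\<lambda>n. (u (r n) i, e (r n) i)) \<longlonglongrightarrow> l i"
    by blast
  define v where "v i = fst (l i)" for i
  define f where "f i = snd (l i)" for i
  have limu: "(\<lambda>n. u (r n) i) \<longlonglongrightarrow> v i" and lime: "(\<lambda>n. e (r n) i) \<longlonglongrightarrow> f i" if "i \<in> Basis" for i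
    using tendsto_fst[OF lim[OF that]] tendsto_snd[OF lim[OF that]] by (simp_all add: v_def f_def)
  have bb: "bounded_bilinear \<mu>"
    using \<mu> by (simp add: bilinear_conv_bounded_bilinear)
  have v: "oframe v"
    unfolding oframe_def
  proof (intro ballI)
    fix i j :: 'a assume ij: "i \<in> Basis" "j \<in> Basis"
    have "(\<lambda>n. u (r n) i \<bullet> u (r n) j) \<longlonglongrightarrow> v i \<bullet> v j"
      by (intro tendsto_intros limu ij)
    then have "(\<lambda>n. if i = j then 1 else 0) \<longlonglongrightarrow> v i \<bullet> v j"
      by (simp add: oframeD[OF u ij])
    then show "v i \<bullet> v j = (if i = j then 1 else 0)"
      by (simp add: LIMSEQ_const_iff)
  qed
  moreover have "frame_multiplicative \<mu> v f"
    unfolding frame_multiplicative_def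
  proof (intro ballI impI)
    fix i j k :: 'a assume ijk: "i \<in> Basis" "j \<in> Basis" "k \<in> Basis" and nz: "\<mu> (v i) (v j) \<bullet> v k \<noteq> 0"
    have "(\<lambda>n. \<mu> (u (r n) i) (u (r n) j) \<bullet> u (r n) k) \<longlonglongrightarrow> \<mu> (v i) (v j) \<bullet> v k"
      by (intro tendsto_inner bounded_bilinear.tendsto[OF bb] limu ijk)
    then have "\<forall>\<^sub>F n in sequentially. \<mu> (u (r n) i) (u (r n) j) \<bullet> u (r n) k \<noteq> 0"
      using nz by (rule tendsto_imp_eventually_ne)
    then have "\<forall>\<^sub>F n in sequentially. e (r n) i + e (r n) j \<le> e (r n) k"
      by eventually_elim (use mult ijk in \<open>auto simp: frame_multiplicative_def\<close>)
    then show "f i + f j \<le> f k"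
      by (intro tendsto_le[OF _ lime[OF ijk(3)] tendsto_add[OF lime[OF ijk(1)] lime[OF ijk(2)]]]) auto
  qed
  moreover have "frame_cost f \<le> m"
  proof -
    have 1: "(\<lambda>n. frame_cost (e (r n))) \<longlonglongrightarrow> frame_cost f"
      unfolding frame_cost_def by (intro tendsto_intros lime)
    have "(\<lambda>n. m + 1 / real (Suc n)) \<longlonglongrightarrow> m + 0"
      using LIMSEQ_inverse_real_of_nat by (intro tendsto_intros) (simp add: inverse_eq_divide)
    then have 2: "(\<lambda>n. m + 1 / real (Suc (r n))) \<longlonglongrightarrow> m + 0"
      using LIMSEQ_subseq_LIMSEQ[OF _ r] by (auto simp: o_def)
    have "frame_cost f \<le> m + 0"
      by (rule LIMSEQ_le[OF 1 2]) (use cost less_imp_le in blast)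
    then show ?thesis by simp
  qed
  moreover have "m \<le> frame_cost e'" if "oframe u'" "frame_multiplicative \<mu> u' e'" for u' e'
    unfolding m_def using that by (intro cInf_lower[OF _ bdd]) blast
  ultimately show thesis
    using that by (meson order_trans)
qed

locale optimal_frame =
  fixes \<mu> :: "'a::euclidean_space \<Rightarrow> 'a \<Rightarrow> 'a" and u :: "'a \<Rightarrow> 'a" and e :: "'a \<Rightarrow> real"
  assumes bilin: "bilinear \<mu>" and frame: "oframe u" and mult: "frame_multiplicative \<mu> u e"
    and optimal: "\<And>u' e'. oframe u' \<Longrightarrow> frame_multiplicative \<mu> u' e' \<Longrightarrow> frame_cost e \<le> frame_cost e'"
begin

lemmas inj_u = oframe_inj[OF frame]

text \<open>The cost depends on the filtration only, so optimality among orthonormal frames is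
  optimality among all weighted bases.\<close>

lemma optimal_basis:
  assumes ind: "independent C" and sp: "span C = UNIV" and m: "multiplicative \<mu> C f"
  shows "frame_cost e \<le> (\<Sum>c\<in>C. (f c - 1)\<^sup>2)"
proof -
  obtain u' e' where u': "oframe u'" and eq: "\<And>s. frame_filt u' e' s = wfilt C f s"
    using adapted_frame[OF ind sp] by metis
  have inj: "inj_on u' Basis"
    by (rule oframe_inj[OF u'])
  have eq': "wfilt (u' ` Basis) (frame_weight u' e') s = wfilt C f s" for s
    by (simp add: fs_frame[OF inj] eq)
  have "frame_multiplicative \<mu> u' e'"
    using multiplicative_transfer[OF bilin m eq'] by (simp add: multiplicative_frame[OF u'])
  then have "frame_cost e \<le> frame_cost e'"
    by (rule optimal[OF u'])
  also have "\<dots> = (\<Sum>c\<in>u' ` Basis. (frame_weight u' e' c - 1)\<^sup>2)"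
    using sum_frame[OF inj, of "\<lambda>r. (r - 1)\<^sup>2" e'] by (simp add: frame_cost_def)
  also have "\<dots> = (\<Sum>c\<in>C. (f c - 1)\<^sup>2)"
    by (rule weight_sum_eq[where \<phi> = "\<lambda>r. (r - 1)\<^sup>2"])
       (use eq' ind oframe_independent[OF u'] independent_imp_finite[OF ind] in auto)
  finally show ?thesis .
qed

text \<open>The cost is strictly convex along a common adapted basis, so the optimal filtration is unique.\<close>

lemma optimal_unique:
  assumes ind: "independent C" and sp: "span C = UNIV" and m: "multiplicative \<mu> C f"
    and cost: "(\<Sum>c\<in>C. (f c - 1)\<^sup>2) = frame_cost e"
  shows "wfilt C f s = frame_filt u e s"
proof -
  let ?U = "u ` Basis"
  have indU: "independent ?U" and spU: "span ?U = UNIV"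
    using oframe_independent[OF frame] oframe_span[OF frame] by auto
  have finC: "finite C"
    using ind by (rule independent_imp_finite)
  obtain K h h' where K: "finite K" "independent K"
    and h: "\<And>s. wfilt K h s = wfilt C f s" and h': "\<And>s. wfilt K h' s = wfilt ?U (frame_weight u e) s"
    using common_adapted_basis[OF finC _ ind indU, of f "frame_weight u e"] sp spU by auto
  have spK: "span K = UNIV"
    using fs_eq_span_eq[OF K(1) finC h] sp by simp
  have mU: "multiplicative \<mu> ?U (frame_weight u e)"
    using mult multiplicative_frame[OF frame] by blast
  have mh: "multiplicative \<mu> K h" and mh': "multiplicative \<mu> K h'"
    using multiplicative_transfer[OF bilin m h] multiplicative_transfer[OF bilin mU h'] by auto
  define g where "g k = (h k + h' k) / 2" for k
  have "multiplicative \<mu> K g"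
    unfolding multiplicative_def
  proof (intro ballI)
    fix c d assume cd: "c \<in> K" "d \<in> K"
    have "\<mu> c d \<in> span ({k \<in> K. h c + h d \<le> h k} \<inter> {k \<in> K. h' c + h' d \<le> h' k})"
      by (rule independent_span_Int[OF K(2)])
         (use cd mh mh' in \<open>auto simp: multiplicative_def wfilt_def\<close>)
    also have "\<dots> \<subseteq> wfilt K g (g c + g d)"
      unfolding wfilt_def g_def by (rule span_mono) (auto simp: field_simps)
    finally show "\<mu> c d \<in> wfilt K g (g c + g d)" .
  qed
  then have "frame_cost e \<le> (\<Sum>k\<in>K. (g k - 1)\<^sup>2)"
    by (rule optimal_basis[OF K(2) spK])
  \<comment> \<open>Parallelogram identity: the cost of the average is the average cost minus a
    quarter of the squared distance. Both costs are minimal, so the distance is 0.\<close>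
  also have "\<dots> = (\<Sum>k\<in>K. (h k - 1)\<^sup>2) / 2 + (\<Sum>k\<in>K. (h' k - 1)\<^sup>2) / 2 - (\<Sum>k\<in>K. (h k - h' k)\<^sup>2) / 4"
    unfolding sum_divide_distrib sum.distrib[symmetric] sum_subtractf[symmetric]
    by (rule sum.cong) (auto simp: g_def power2_eq_square field_simps)
  also have "(\<Sum>k\<in>K. (h k - 1)\<^sup>2) = frame_cost e"
    using weight_sum_eq[OF K(1) finC K(2) ind h, of "\<lambda>r. (r - 1)\<^sup>2"] cost by simp
  also have "(\<Sum>k\<in>K. (h' k - 1)\<^sup>2) = frame_cost e"
    using weight_sum_eq[OF K(1) _ K(2) indU h', of "\<lambda>r. (r - 1)\<^sup>2"] sum_frame[OF inj_u, of "\<lambda>r. (r - 1)\<^sup>2" e]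
    by (simp add: frame_cost_def)
  finally have "(\<Sum>k\<in>K. (h k - h' k)\<^sup>2) \<le> 0"
    by (simp add: field_simps)
  then have "(\<Sum>k\<in>K. (h k - h' k)\<^sup>2) = 0"
    by (simp add: antisym sum_nonneg)
  then have "\<forall>k\<in>K. h k = h' k"
    using K(1) by (simp add: sum_nonneg_eq_0_iff)
  then have "wfilt K h s = wfilt K h' s"
    unfolding wfilt_def by (intro arg_cong[where f=span]) auto
  then show ?thesis
    by (simp add: h h' fs_frame[OF inj_u])
qed

text \<open>Transporting the weights along \<open>g\<close> gives a multiplicative filtration of the
  same cost, which uniqueness identifies with the original one.\<close>

lemma automorphism_invariant:
  assumes g: "linear g" "inj g" and hom: "\<And>x y. \<mu> (g x) (g y) = g (\<mu> x y)"
  shows "g ` frame_filt u e s = frame_filt u e s"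
proof -
  let ?v = "\<lambda>i. g (u i)"
  have inj: "inj_on ?v Basis"
    using inj_u g(2) by (auto simp: inj_on_def)
  have img: "?v ` Basis = g ` (u ` Basis)"
    by auto
  have ind: "independent (?v ` Basis)"
    unfolding img by (rule linear_independent_injective_image[OF g(1) oframe_independent[OF frame] ])
      (use g(2) inj_on_subset in blast)
  have "span (?v ` Basis) = range g"
    unfolding img linear_span_image[OF g(1)] oframe_span[OF frame] ..
  also have "range g = UNIV"
    using linear_inj_imp_surj[OF g] .
  finally have sp: "span (?v ` Basis) = UNIV" .
  have eq: "wfilt (?v ` Basis) (frame_weight ?v e) s = g ` frame_filt u e s" for s
  proof -
    have "?v ` {i \<in> Basis. s \<le> e i} = g ` (u ` {i \<in> Basis. s \<le> e i})"
      by auto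
    then show ?thesis
      unfolding fs_frame[OF inj] frame_filt_def by (simp add: linear_span_image[OF g(1)])
  qed
  have "multiplicative \<mu> (?v ` Basis) (frame_weight ?v e)"
    unfolding multiplicative_def
  proof (clarify)
    fix i j :: 'a assume ij: "i \<in> Basis" "j \<in> Basis"
    have "multiplicative \<mu> (u ` Basis) (frame_weight u e)"
      using mult multiplicative_frame[OF frame] by blast
    then have "\<mu> (u i) (u j) \<in> frame_filt u e (e i + e j)"
      using ij by (auto simp: multiplicative_def fs_frame[OF inj_u] fw_apply[OF inj_u])
    then show "\<mu> (?v i) (?v j) \<in> wfilt (?v ` Basis) (frame_weight ?v e) (frame_weight ?v e (?v i) + frame_weight ?v e (?v j))"
      unfolding eq hom using ij fw_apply[OF inj] by auto
  qed
  from optimal_unique[OF ind sp this] show ?thesis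
    using sum_frame[OF inj, of "\<lambda>r. (r - 1)\<^sup>2" e] by (simp add: frame_cost_def eq)
qed

text \<open>The automorphisms \<open>exp (t A)\<close> preserve each level, and membership in a
  level is the vanishing of some inner products; their linear terms in \<open>t\<close> give the
  claim for \<open>A\<close>.\<close>

lemma derivation_invariant:
  assumes A: "linear A" and der: "\<And>x y. A (\<mu> x y) = \<mu> (A x) y + \<mu> x (A y)" and x: "x \<in> frame_filt u e s"
  shows "A x \<in> frame_filt u e s"
proof -
  have "opexp (\<lambda>x. t *\<^sub>R A x) x \<in> frame_filt u e s" for t
  proof -
    let ?A = "\<lambda>x. t *\<^sub>R A x"
    have lin: "linear ?A"
      using A by (rule linear_compose_scale_right)
    have "opexp ?A ` frame_filt u e s = frame_filt u e s"
    proof (rule automorphism_invariant[OF linear_opexp[OF lin] opexp_inj[OF lin]])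
      show "\<mu> (opexp ?A x) (opexp ?A y) = opexp ?A (\<mu> x y)" for x y
        by (rule opexp_bilinear[OF bilin lin lin lin, symmetric])
           (simp add: der scaleR_add_right bilinear_lmul[OF bilin] bilinear_rmul[OF bilin])
    qed
    then show ?thesis
      using x by blast
  qed
  then show ?thesis
    unfolding mem_ffs[OF frame] by (blast intro: opexp_orbit_linear_term[OF A])
qed

text \<open>First order optimality: \<open>e + \<epsilon> x\<close> is again multiplicative for all small \<open>\<epsilon> > 0\<close>.\<close>

lemma first_order:
  assumes x: "\<And>i j k. i \<in> Basis \<Longrightarrow> j \<in> Basis \<Longrightarrow> k \<in> Basis \<Longrightarrow> e k = e i + e j \<Longrightarrow>
      \<mu> (v i) (v j) \<bullet> v k \<noteq> 0 \<Longrightarrow> x i + x j \<le> x k"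
    and v: "oframe v" "frame_multiplicative \<mu> v e"
  shows "0 \<le> (\<Sum>i\<in>Basis. (e i - 1) * x i)"
proof -
  let ?T = "{(i, j, k). i \<in> Basis \<and> j \<in> Basis \<and> k \<in> (Basis :: 'a set) \<and> e i + e j < e k}"
  have "finite ?T"
    by (rule finite_subset[of _ "Basis \<times> Basis \<times> Basis"]) auto
  \<comment> \<open>A step length up to which all strict inequalities \<open>e i + e j < e k\<close>
    survive. The added 1 avoids a zero denominator, the inserted 1 an empty minimum.\<close>
  define D where "D = Min (insert 1 ((\<lambda>(i, j, k). (e k - e i - e j) / (1 + \<bar>x i + x j - x k\<bar>)) ` ?T))"
  have fin: "finite (insert 1 ((\<lambda>(i, j, k). (e k - e i - e j) / (1 + \<bar>x i + x j - x k\<bar>)) ` ?T))"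
    using \<open>finite ?T\<close> by simp
  have D: "0 < D"
    unfolding D_def using fin by (subst Min_gr_iff) (auto intro!: divide_pos_pos)
  have cost: "0 \<le> 2 * \<epsilon> * (\<Sum>i\<in>Basis. (e i - 1) * x i) + \<epsilon>\<^sup>2 * (\<Sum>i\<in>Basis. (x i)\<^sup>2)"
    if \<epsilon>: "0 < \<epsilon>" "\<epsilon> \<le> D" for \<epsilon>
  proof -
    have "frame_multiplicative \<mu> v (\<lambda>i. e i + \<epsilon> * x i)"
      unfolding frame_multiplicative_def
    proof (intro ballI impI)
      fix i j k :: 'a assume ijk: "i \<in> Basis" "j \<in> Basis" "k \<in> Basis" and nz: "\<mu> (v i) (v j) \<bullet> v k \<noteq> 0"
      have le: "e i + e j \<le> e k"
        using v(2) ijk nz by (auto simp: frame_multiplicative_def)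
      show "e i + \<epsilon> * x i + (e j + \<epsilon> * x j) \<le> e k + \<epsilon> * x k"
      proof (cases "e k = e i + e j")
        case True
        then show ?thesis
          using mult_left_mono[OF x[OF ijk True nz], of \<epsilon>] \<epsilon> by (simp add: algebra_simps)
      next
        case False
        then have "(i, j, k) \<in> ?T"
          using le ijk by auto
        then have "D \<le> (e k - e i - e j) / (1 + \<bar>x i + x j - x k\<bar>)"
          unfolding D_def using fin by (intro Min_le) force+
        then have "\<epsilon> * (1 + \<bar>x i + x j - x k\<bar>) \<le> e k - e i - e j"
          using \<epsilon> by (simp add: pos_le_divide_eq) (smt (verit) mult_right_mono)
        moreover have "\<epsilon> * (x i + x j - x k) \<le> \<epsilon> * (1 + \<bar>x i + x j - x k\<bar>)"
          using \<epsilon> by (intro mult_left_mono) auto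
        ultimately show ?thesis
          by (simp add: algebra_simps)
      qed
    qed
    then have "frame_cost e \<le> frame_cost (\<lambda>i. e i + \<epsilon> * x i)"
      by (rule optimal[OF v(1)])
    also have "\<dots> = frame_cost e + (2 * \<epsilon> * (\<Sum>i\<in>Basis. (e i - 1) * x i) + \<epsilon>\<^sup>2 * (\<Sum>i\<in>Basis. (x i)\<^sup>2))"
      unfolding frame_cost_def sum_distrib_left sum.distrib[symmetric]
      by (rule sum.cong) (auto simp: power2_eq_square algebra_simps)
    finally show ?thesis by simp
  qed
  show ?thesis
  proof (rule ccontr)
    define S where "S = (\<Sum>i\<in>Basis. (e i - 1) * x i)"
    define Q where "Q = (\<Sum>i\<in>Basis. (x i)\<^sup>2)"
    assume "\<not> 0 \<le> (\<Sum>i\<in>Basis. (e i - 1) * x i)"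
    then have S: "S < 0" by (simp add: S_def)
    have Q: "0 \<le> Q" by (simp add: Q_def sum_nonneg)
    \<comment> \<open>Small enough for the negative linear term \<open>2 \<epsilon> S\<close> to
      outweigh \<open>\<epsilon>^2 Q\<close>.\<close>
    define \<epsilon> where "\<epsilon> = min D (- S / (1 + Q))"
    have \<epsilon>: "0 < \<epsilon>" "\<epsilon> \<le> D" "\<epsilon> \<le> - S / (1 + Q)"
      using D divide_neg_pos[of S "1 + Q"] S Q by (auto simp: \<epsilon>_def)
    have "\<epsilon> * Q \<le> \<epsilon> * (1 + Q)" "\<epsilon> * (1 + Q) \<le> - S"
      using \<epsilon> Q pos_le_divide_eq[of "1 + Q" \<epsilon> "- S"] by (auto intro: mult_left_mono)
    then have "2 * S + \<epsilon> * Q < 0"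
      using S by linarith
    then have "\<epsilon> * (2 * S + \<epsilon> * Q) < 0"
      using \<epsilon> by (simp add: mult_pos_neg)
    then show False
      using cost[OF \<epsilon>(1,2)] unfolding S_def[symmetric] Q_def[symmetric]
      by (simp add: power2_eq_square algebra_simps)
  qed
qed

text \<open>Only triples with \<open>e k = e i + e j\<close> restrict the direction, so
  \<open>e\<close> and \<open>- e\<close> are both admissible. Hence \<open>D\<close> is orthogonal
  to \<open>D - 1\<close>.\<close>

lemma sum_sq: "(\<Sum>i\<in>Basis. (e i)\<^sup>2) = (\<Sum>i\<in>Basis. e i)"
proof -
  have "0 \<le> (\<Sum>i\<in>Basis. (e i - 1) * e i)" "0 \<le> (\<Sum>i\<in>Basis. (e i - 1) * (- e i))"
    by (rule first_order[OF _ frame mult]; simp)+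
  moreover have "(\<Sum>i\<in>Basis. (e i - 1) * (- e i)) = - (\<Sum>i\<in>Basis. (e i - 1) * e i)"
    by (simp add: sum_negf)
  ultimately have "(\<Sum>i\<in>Basis. (e i - 1) * e i) = 0"
    by linarith
  then show ?thesis
    by (simp add: algebra_simps power2_eq_square sum_subtractf)
qed

text \<open>Replacing negative weights by 0 brings them closer to 1. Multiplicativity survives: if a
  weight is cut off, the required bound is \<open>e i \<le> e k\<close> or
  \<open>e j \<le> e k\<close>, which holds because the levels are ideals.\<close>

lemma weights_nonneg:
  assumes anti: "\<And>x y. \<mu> x y = - \<mu> y x"
    and ideal: "\<And>x y s. y \<in> frame_filt u e s \<Longrightarrow> \<mu> x y \<in> frame_filt u e s" and i: "i \<in> Basis"
  shows "0 \<le> e i"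
proof (rule ccontr)
  assume neg: "\<not> 0 \<le> e i"
  have right: "e j \<le> e k" if "\<mu> (u i) (u j) \<bullet> u k \<noteq> 0" "j \<in> Basis" "k \<in> Basis" for i j k
    using ideal[OF ffs_base[of j "e j" e u]] that unfolding mem_ffs[OF frame] by (metis not_le order_refl)
  have left: "e i \<le> e k" if "\<mu> (u i) (u j) \<bullet> u k \<noteq> 0" "i \<in> Basis" "k \<in> Basis" for i j k
    using right[of j i k] that anti[of "u i" "u j"] by simp
  have "frame_multiplicative \<mu> u (\<lambda>i. max (e i) 0)"
    unfolding frame_multiplicative_def
  proof (intro ballI impI)
    fix i j k :: 'a assume ijk: "i \<in> Basis" "j \<in> Basis" "k \<in> Basis" and nz: "\<mu> (u i) (u j) \<bullet> u k \<noteq> 0"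
    have "e i + e j \<le> e k" "e i \<le> e k" "e j \<le> e k"
      using mult right[OF nz] left[OF nz] ijk nz by (auto simp: frame_multiplicative_def)
    then show "max (e i) 0 + max (e j) 0 \<le> max (e k) 0"
      by (auto simp: max_def)
  qed
  then have "frame_cost e \<le> frame_cost (\<lambda>i. max (e i) 0)"
    by (rule optimal[OF frame])
  also have "\<dots> < frame_cost e"
    unfolding frame_cost_def
  proof (rule sum_strict_mono_ex1)
    show "\<forall>i\<in>Basis. (max (e i) 0 - 1)\<^sup>2 \<le> (e i - 1)\<^sup>2"
    proof
      fix i :: 'a
      show "(max (e i) 0 - 1)\<^sup>2 \<le> (e i - 1)\<^sup>2"
        by (cases "0 \<le> e i") (auto simp: max_def power2_eq_square algebra_simps mult_nonpos_nonpos)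
    qed
    show "\<exists>i\<in>Basis. (max (e i) 0 - 1)\<^sup>2 < (e i - 1)\<^sup>2"
    proof (rule bexI[OF _ i])
      have "0 < e i * e i"
        using neg by (simp add: mult_neg_neg)
      then show "(max (e i) 0 - 1)\<^sup>2 < (e i - 1)\<^sup>2"
        using neg by (simp add: max_def power2_eq_square algebra_simps)
    qed
  qed simp
  finally show False by simp
qed

end

subsection \<open>Determinants of operators\<close>

text \<open>The standard basis as a finite type, to index the matrices whose determinant defines
  \<open>edet\<close>.\<close>

typedef (overloaded) 'a bindex = "Basis :: 'a::euclidean_space set"
  by (metis ex_in_conv nonempty_Basis)

instance bindex :: (euclidean_space) finite
proof
  have "(UNIV :: 'a bindex set) = Abs_bindex ` Basis"
    by (metis UNIV_eq_I image_iff Rep_bindex Rep_bindex_inverse)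
  then show "finite (UNIV :: 'a bindex set)"
    by (metis finite_Basis finite_imageI)
qed

lemma sum_bindex: "(\<Sum>k\<in>UNIV. h (Rep_bindex k)) = (\<Sum>b\<in>Basis. h b)"
  by (rule sum.reindex_bij_betw)
     (auto simp: bij_betw_def inj_on_def Rep_bindex_inject type_definition.Rep_range[OF type_definition_bindex])

lemma prod_bindex: "(\<Prod>k\<in>UNIV. h (Rep_bindex k)) = (\<Prod>b\<in>Basis. h b)"
  by (rule prod.reindex_bij_betw)
     (auto simp: bij_betw_def inj_on_def Rep_bindex_inject type_definition.Rep_range[OF type_definition_bindex])

definition opmat :: "('a::euclidean_space \<Rightarrow> 'a) \<Rightarrow> real ^ 'a bindex ^ 'a bindex" where
  "opmat f = (\<chi> i j. f (Rep_bindex j) \<bullet> Rep_bindex i)"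

definition edet :: "('a::euclidean_space \<Rightarrow> 'a) \<Rightarrow> real" where
  "edet f = det (opmat f)"

lemma edet_comp:
  assumes "linear f"
  shows "edet (\<lambda>x. f (g x)) = edet f * edet g"
proof -
  have "opmat (\<lambda>x. f (g x)) = opmat f ** opmat g"
    unfolding vec_eq_iff
  proof (intro allI)
    fix i j
    have "f (g (Rep_bindex j)) = (\<Sum>b\<in>Basis. (g (Rep_bindex j) \<bullet> b) *\<^sub>R f b)"
      by (rule oframe_linear_expand[OF oframe_id assms])
    then show "opmat (\<lambda>x. f (g x)) $ i $ j = (opmat f ** opmat g) $ i $ j"
      by (simp add: opmat_def matrix_matrix_mult_def sum_bindex[of "\<lambda>b. (f b \<bullet> Rep_bindex i) * (g (Rep_bindex j) \<bullet> b)"]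
          inner_sum_left mult.commute)
  qed
  then show ?thesis
    by (simp add: edet_def det_mul)
qed

lemma edet_diag:
  assumes "\<And>b. b \<in> Basis \<Longrightarrow> f b = c b *\<^sub>R b"
  shows "edet f = (\<Prod>b\<in>Basis. c b)"
proof -
  have "det (opmat f) = (\<Prod>k\<in>UNIV. opmat f $ k $ k)"
    by (rule det_diagonal) (auto simp: opmat_def assms Rep_bindex inner_Basis Rep_bindex_inject)
  also have "\<dots> = (\<Prod>k\<in>UNIV. c (Rep_bindex k))"
    by (rule prod.cong) (auto simp: opmat_def assms Rep_bindex)
  finally show ?thesis
    by (simp add: edet_def prod_bindex)
qed

definition frame_map :: "('a::euclidean_space \<Rightarrow> 'a) \<Rightarrow> 'a \<Rightarrow> 'a" where
  "frame_map v x = (\<Sum>b\<in>Basis. (x \<bullet> b) *\<^sub>R v b)"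

lemma linear_frame_map: "linear (frame_map v)"
  unfolding frame_map_def by (rule linearI) (auto simp: inner_add_left scaleR_add_left sum.distrib scaleR_sum_right)

lemma frame_map_Basis: "b \<in> Basis \<Longrightarrow> frame_map v b = v b"
  by (simp add: frame_map_def inner_Basis if_distrib[of "\<lambda>x. x *\<^sub>R _"] sum.delta cong: if_cong)

lemma abs_edet_frame:
  fixes v :: "'a::euclidean_space \<Rightarrow> 'a"
  assumes v: "oframe v"
  shows "\<bar>edet (frame_map v)\<bar> = 1"
proof -
  let ?M = "opmat (frame_map v)"
  have "transpose ?M ** ?M = mat 1"
    unfolding vec_eq_iff
  proof (intro allI)
    fix i j :: "'a bindex"
    let ?i = "Rep_bindex i" and ?j = "Rep_bindex j"
    have "(transpose ?M ** ?M) $ i $ j = (\<Sum>b\<in>Basis. (v ?i \<bullet> b) * (v ?j \<bullet> b))"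
      by (simp add: matrix_matrix_mult_def transpose_def opmat_def frame_map_Basis[OF Rep_bindex]
          sum_bindex[of "\<lambda>b. (v ?i \<bullet> b) * (v ?j \<bullet> b)"])
    also have "\<dots> = v ?i \<bullet> v ?j"
      by (rule oframe_inner[OF oframe_id, symmetric])
    finally show "(transpose ?M ** ?M) $ i $ j = mat 1 $ i $ j"
      by (simp add: oframeD[OF v] Rep_bindex Rep_bindex_inject mat_def)
  qed
  then have "det ?M * det ?M = 1"
    by (metis det_I det_mul det_transpose)
  then show ?thesis
    by (simp add: edet_def abs_square_eq_1[symmetric] power2_eq_square)
qed

text \<open>\<open>f\<close> is a diagonal operator between two orthogonal changes of frame, and
  these have determinant 1 or -1. The absolute determinant is thus read off from singular
  values.\<close>

lemma abs_edet_frames: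
  assumes f: "linear f" and v: "oframe v" and w: "oframe w"
    and fv: "\<And>i. i \<in> Basis \<Longrightarrow> f (v i) = c i *\<^sub>R w i"
  shows "\<bar>edet f\<bar> = \<bar>\<Prod>i\<in>Basis. c i\<bar>"
proof -
  define d where "d x = (\<Sum>b\<in>Basis. (c b * (x \<bullet> b)) *\<^sub>R b)" for x
  have d: "linear d"
    unfolding d_def by (rule linearI) (auto simp: inner_add_left algebra_simps sum.distrib scaleR_sum_right)
  have dB: "d b = c b *\<^sub>R b" if "b \<in> Basis" for b
    using that by (simp add: d_def inner_Basis if_distrib[of "\<lambda>x. _ * x"] if_distrib[of "\<lambda>x. x *\<^sub>R _"] sum.delta cong: if_cong)
  have "f (frame_map v x) = frame_map w (d x)" for x
  proof (rule oframe_linear_eqI[OF oframe_id, of "\<lambda>x. f (frame_map v x)" "\<lambda>x. frame_map w (d x)"])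
    show "linear (\<lambda>x. f (frame_map v x))"
      using linear_compose[OF linear_frame_map f] by (simp add: o_def)
    show "linear (\<lambda>x. frame_map w (d x))"
      using linear_compose[OF d linear_frame_map] by (simp add: o_def)
    show "f (frame_map v b) = frame_map w (d b)" if "b \<in> Basis" for b
      using that by (simp add: frame_map_Basis fv dB linear_cmul[OF linear_frame_map])
  qed
  then have "edet f * edet (frame_map v) = edet (frame_map w) * edet d"
    by (simp add: edet_comp[OF f, symmetric] edet_comp[OF linear_frame_map, symmetric])
  then have "\<bar>edet f\<bar> * \<bar>edet (frame_map v)\<bar> = \<bar>edet (frame_map w)\<bar> * \<bar>edet d\<bar>"
    by (metis abs_mult)
  then show ?thesis
    by (simp add: abs_edet_frame v w edet_diag[of d c, OF dB])
qed

subsection \<open>Diagonal operators\<close>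

definition diagop :: "('a::euclidean_space \<Rightarrow> 'a) \<Rightarrow> ('a \<Rightarrow> real) \<Rightarrow> 'a \<Rightarrow> 'a" where
  "diagop v c x = (\<Sum>i\<in>Basis. (c i * (x \<bullet> v i)) *\<^sub>R v i)"

lemma linear_diagop: "linear (diagop v c)"
  unfolding diagop_def by (rule linearI) (auto simp: inner_add_left algebra_simps sum.distrib scaleR_sum_right)

lemma diagop_inner:
  assumes v: "oframe v" and i: "i \<in> Basis"
  shows "diagop v c x \<bullet> v i = c i * (x \<bullet> v i)"
proof -
  have "diagop v c x \<bullet> v i = (\<Sum>j\<in>Basis. if j = i then c i * (x \<bullet> v i) else 0)"
    unfolding diagop_def inner_sum_left by (rule sum.cong) (auto simp: oframeD[OF v _ i])
  then show ?thesis
    using i by simp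
qed

lemma diagop_frame:
  assumes v: "oframe v" and i: "i \<in> Basis"
  shows "diagop v c (v i) = c i *\<^sub>R v i"
  by (rule oframe_eqI[OF v]) (auto simp: diagop_inner[OF v] oframeD[OF v i])

lemma diagop_symmetric: "diagop v c x \<bullet> y = x \<bullet> diagop v c y"
  by (simp add: diagop_def inner_sum_left inner_sum_right mult_ac inner_commute[of y])

lemma diagop_comp:
  assumes v: "oframe v"
  shows "diagop v c (diagop v d x) = diagop v (\<lambda>i. c i * d i) x"
  by (rule oframe_eqI[OF v]) (simp add: diagop_inner[OF v])

lemma diagop_one: "oframe v \<Longrightarrow> diagop v (\<lambda>_. 1) x = x"
  by (rule oframe_eqI[of v]) (simp_all add: diagop_inner)

lemma diagop_cong: "(\<And>i. i \<in> Basis \<Longrightarrow> c i = d i) \<Longrightarrow> diagop v c x = diagop v d x"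
  by (simp add: diagop_def)

lemma eigenvector_inner:
  assumes u: "oframe u" and x: "diagop u e x = r *\<^sub>R x" and i: "i \<in> Basis" "e i \<noteq> r"
  shows "x \<bullet> u i = 0"
  using diagop_inner[OF u i(1), of e x] x i(2) by simp

text \<open>Functional calculus: a function of the diagonal operator acts by a scalar on every
  eigenvector, not just on those of the frame.\<close>

lemma diagop_eigenvector:
  assumes u: "oframe u" and x: "diagop u e x = r *\<^sub>R x"
  shows "diagop u (\<lambda>i. \<phi> (e i)) x = \<phi> r *\<^sub>R x"
  by (rule oframe_eqI[OF u]) (use eigenvector_inner[OF u x] in \<open>auto simp: diagop_inner[OF u]\<close>)

subsection \<open>Bilinear maps\<close>

lemma bilinear_expand:
  fixes B :: "'a::euclidean_space \<Rightarrow> 'a \<Rightarrow> 'a"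
  assumes B: "bilinear B" and u: "oframe u" and v: "oframe v"
  shows "B x y = (\<Sum>i\<in>Basis. \<Sum>j\<in>Basis. ((x \<bullet> u i) * (y \<bullet> v j)) *\<^sub>R B (u i) (v j))"
proof -
  have "B x y = (\<Sum>i\<in>Basis. (x \<bullet> u i) *\<^sub>R B (u i) y)"
    by (rule oframe_linear_expand[OF u]) (use B in \<open>simp add: bilinear_def\<close>)
  also have "\<dots> = (\<Sum>i\<in>Basis. (x \<bullet> u i) *\<^sub>R (\<Sum>j\<in>Basis. (y \<bullet> v j) *\<^sub>R B (u i) (v j)))"
    by (rule sum.cong[OF refl], rule arg_cong[where f="scaleR _"], rule oframe_linear_expand[OF v])
       (use B in \<open>simp add: bilinear_def\<close>)
  finally show ?thesis
    by (simp add: scaleR_sum_right)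
qed

lemma bilinear_eqI:
  fixes B C :: "'a::euclidean_space \<Rightarrow> 'a \<Rightarrow> 'a"
  assumes "bilinear B" "bilinear C" "oframe u"
    "\<And>i j. i \<in> Basis \<Longrightarrow> j \<in> Basis \<Longrightarrow> B (u i) (u j) = C (u i) (u j)"
  shows "B x y = C x y"
  by (subst bilinear_expand[OF assms(1,3,3)], subst bilinear_expand[OF assms(2,3,3)]) (simp add: assms(4))

lemma bilinear_limit:
  fixes B :: "nat \<Rightarrow> 'a::euclidean_space \<Rightarrow> 'a \<Rightarrow> 'a"
  assumes B: "\<And>n. bilinear (B n)" and lim: "\<And>x y. (\<lambda>n. B n x y) \<longlonglongrightarrow> L x y"
  shows "bilinear L"
  unfolding bilinear_def
proof (intro conjI allI linearI)
  fix x y z :: 'a and c :: real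
  show "L x (y + z) = L x y + L x z"
    by (rule LIMSEQ_unique[OF lim]) (use tendsto_add[OF lim[of x y] lim[of x z]] in \<open>simp add: bilinear_radd[OF B]\<close>)
  show "L x (c *\<^sub>R y) = c *\<^sub>R L x y"
    by (rule LIMSEQ_unique[OF lim]) (use tendsto_scaleR[OF tendsto_const lim[of x y]] in \<open>simp add: bilinear_rmul[OF B]\<close>)
  show "L (y + z) x = L y x + L z x"
    by (rule LIMSEQ_unique[OF lim]) (use tendsto_add[OF lim[of y x] lim[of z x]] in \<open>simp add: bilinear_ladd[OF B]\<close>)
  show "L (c *\<^sub>R y) x = c *\<^sub>R L y x"
    by (rule LIMSEQ_unique[OF lim]) (use tendsto_scaleR[OF tendsto_const lim[of y x]] in \<open>simp add: bilinear_lmul[OF B]\<close>)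
qed

lemma bilinear_tendsto:
  fixes B :: "nat \<Rightarrow> 'a::euclidean_space \<Rightarrow> 'a \<Rightarrow> 'a"
  assumes B: "\<And>n. bilinear (B n)" and lim: "\<And>x y. (\<lambda>n. B n x y) \<longlonglongrightarrow> L x y"
    and x: "x \<longlonglongrightarrow> x'" and y: "y \<longlonglongrightarrow> y'"
  shows "(\<lambda>n. B n (x n) (y n)) \<longlonglongrightarrow> L x' y'"
proof -
  have "(\<lambda>n. \<Sum>i\<in>Basis. \<Sum>j\<in>Basis. ((x n \<bullet> i) * (y n \<bullet> j)) *\<^sub>R B n i j)
      \<longlonglongrightarrow> (\<Sum>i\<in>Basis. \<Sum>j\<in>Basis. ((x' \<bullet> i) * (y' \<bullet> j)) *\<^sub>R L i j)"
    by (intro tendsto_sum tendsto_scaleR tendsto_mult tendsto_inner x y tendsto_const lim)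
  then show ?thesis
    by (simp add: bilinear_expand[OF B oframe_id oframe_id, symmetric]
        bilinear_expand[OF bilinear_limit[OF B lim] oframe_id oframe_id, symmetric])
qed

lemma linear_limit:
  fixes T :: "nat \<Rightarrow> 'a::euclidean_space \<Rightarrow> 'a"
  assumes T: "\<And>n. linear (T n)" and lim: "\<And>x. (\<lambda>n. T n x) \<longlonglongrightarrow> L x"
  shows "linear L"
proof (rule linearI)
  fix x y :: 'a and c :: real
  show "L (x + y) = L x + L y"
    by (rule LIMSEQ_unique[OF lim]) (use tendsto_add[OF lim[of x] lim[of y]] in \<open>simp add: linear_add[OF T]\<close>)
  show "L (c *\<^sub>R x) = c *\<^sub>R L x"
    by (rule LIMSEQ_unique[OF lim]) (use tendsto_scaleR[OF tendsto_const lim[of x]] in \<open>simp add: linear_cmul[OF T]\<close>)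
qed

lemma linear_tendsto:
  fixes T :: "nat \<Rightarrow> 'a::euclidean_space \<Rightarrow> 'a"
  assumes T: "\<And>n. linear (T n)" and lim: "\<And>x. (\<lambda>n. T n x) \<longlonglongrightarrow> L x" and x: "x \<longlonglongrightarrow> x'"
  shows "(\<lambda>n. T n (x n)) \<longlonglongrightarrow> L x'"
proof -
  have "(\<lambda>n. \<Sum>i\<in>Basis. (x n \<bullet> i) *\<^sub>R T n i) \<longlonglongrightarrow> (\<Sum>i\<in>Basis. (x' \<bullet> i) *\<^sub>R L i)"
    by (intro tendsto_sum tendsto_scaleR tendsto_inner x tendsto_const lim)
  then show ?thesis
    by (simp add: oframe_linear_expand[OF oframe_id T, symmetric]
        oframe_linear_expand[OF oframe_id linear_limit[OF T lim], symmetric])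
qed

section \<open>Nilpotent brackets, their derivations and the action of the linear group\<close>

text \<open>The bound \<open>K\<close> is part of the predicate: with a fixed length, nilpotency is
  a closed condition and passes to limits of brackets.\<close>

definition nil_lie :: "nat \<Rightarrow> ('a::euclidean_space \<Rightarrow> 'a \<Rightarrow> 'a) \<Rightarrow> bool" where
  "nil_lie K B \<longleftrightarrow> bilinear B \<and> (\<forall>x y. B x y = - B y x) \<and>
     (\<forall>x y z. B x (B y z) = B (B x y) z + B y (B x z)) \<and> (\<forall>xs y. length xs = K \<longrightarrow> foldr B xs y = 0)"

definition derivation :: "('a::euclidean_space \<Rightarrow> 'a \<Rightarrow> 'a) \<Rightarrow> ('a \<Rightarrow> 'a) \<Rightarrow> bool" where
  "derivation B A \<longleftrightarrow> linear A \<and> (\<forall>x y. A (B x y) = B (A x) y + B x (A y))"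

text \<open>\<open>g\<close> acts on brackets and on operators; \<open>h\<close> is its inverse.\<close>

definition conj_bracket :: "('a \<Rightarrow> 'a) \<Rightarrow> ('a \<Rightarrow> 'a) \<Rightarrow> ('a \<Rightarrow> 'a \<Rightarrow> 'a) \<Rightarrow> 'a \<Rightarrow> 'a \<Rightarrow> 'a" where
  "conj_bracket g h B x y = g (B (h x) (h y))"

definition conj_op :: "('a \<Rightarrow> 'a) \<Rightarrow> ('a \<Rightarrow> 'a) \<Rightarrow> ('a \<Rightarrow> 'a) \<Rightarrow> 'a \<Rightarrow> 'a" where
  "conj_op g h T x = g (T (h x))"

lemma linear_conjo: "linear g \<Longrightarrow> linear h \<Longrightarrow> linear T \<Longrightarrow> linear (conj_op g h T)"
  unfolding conj_op_def using linear_compose[of h "\<lambda>x. g (T x)"] linear_compose[of T g] by (simp add: o_def)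

lemma bilinear_conjb:
  assumes "linear g" "linear h" "bilinear B"
  shows "bilinear (conj_bracket g h B)"
  unfolding bilinear_def conj_bracket_def
  by (intro conjI allI linearI)
     (simp_all add: assms linear_add linear_cmul bilinear_ladd bilinear_radd bilinear_lmul bilinear_rmul)

lemma nil_lie_conjb:
  assumes g: "linear g" "linear h" "\<And>x. h (g x) = x" "\<And>x. g (h x) = x" and B: "nil_lie K B"
  shows "nil_lie K (conj_bracket g h B)"
proof -
  have bil: "bilinear B" and anti: "\<And>x y. B x y = - B y x"
    and jac: "\<And>x y z. B x (B y z) = B (B x y) z + B y (B x z)"
    and nil: "\<And>xs y. length xs = K \<Longrightarrow> foldr B xs y = 0"
    using B unfolding nil_lie_def by blast+
  have fold: "foldr (conj_bracket g h B) xs (g y) = g (foldr B (map h xs) y)" for xs y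
    by (induction xs) (auto simp: conj_bracket_def g)
  show ?thesis
    unfolding nil_lie_def
  proof (intro conjI allI impI)
    show "bilinear (conj_bracket g h B)"
      by (rule bilinear_conjb[OF g(1,2) bil])
    show "conj_bracket g h B x y = - conj_bracket g h B y x" for x y
      using anti[of "h x" "h y"] by (simp add: conj_bracket_def linear_neg[OF g(1)])
    show "conj_bracket g h B x (conj_bracket g h B y z) = conj_bracket g h B (conj_bracket g h B x y) z + conj_bracket g h B y (conj_bracket g h B x z)" for x y z
      using jac[of "h x" "h y" "h z"] by (simp add: conj_bracket_def g linear_add[OF g(1), symmetric])
    show "foldr (conj_bracket g h B) xs y = 0" if "length xs = K" for xs y
      using fold[of xs "h y"] nil[of "map h xs" "h y"] that by (simp add: g linear_0[OF g(1)])
  qed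
qed

lemma derivation_conj:
  assumes g: "linear g" "linear h" "\<And>x. h (g x) = x" and A: "derivation B A"
  shows "derivation (conj_bracket g h B) (conj_op g h A)"
  using A linear_conjo[OF g(1,2), of A]
  by (auto simp: derivation_def conj_bracket_def conj_op_def g linear_add[OF g(1)])

lemma nil_lie_limit:
  fixes B :: "nat \<Rightarrow> 'a::euclidean_space \<Rightarrow> 'a \<Rightarrow> 'a"
  assumes B: "\<And>n. nil_lie K (B n)" and lim: "\<And>x y. (\<lambda>n. B n x y) \<longlonglongrightarrow> L x y"
  shows "nil_lie K L"
proof -
  have bil: "\<And>n. bilinear (B n)" and anti: "\<And>n x y. B n x y = - B n y x"
    and jac: "\<And>n x y z. B n x (B n y z) = B n (B n x y) z + B n y (B n x z)"
    and nil: "\<And>n xs y. length xs = K \<Longrightarrow> foldr (B n) xs y = 0"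
    using B unfolding nil_lie_def by blast+
  note lim2 = bilinear_tendsto[OF bil lim]
  have fold: "(\<lambda>n. foldr (B n) xs y) \<longlonglongrightarrow> foldr L xs y" for xs y
    by (induction xs) (auto intro: lim2)
  show ?thesis
    unfolding nil_lie_def
  proof (intro conjI allI impI)
    show "bilinear L"
      by (rule bilinear_limit[OF bil lim])
    show "L x y = - L y x" for x y
    proof (rule LIMSEQ_unique[OF lim])
      show "(\<lambda>n. B n x y) \<longlonglongrightarrow> - L y x"
        using tendsto_minus[OF lim[of y x]] anti[of _ x y] by simp
    qed
    show "L x (L y z) = L (L x y) z + L y (L x z)" for x y z
    proof (rule LIMSEQ_unique)
      show "(\<lambda>n. B n x (B n y z)) \<longlonglongrightarrow> L x (L y z)"
        by (intro lim2 tendsto_const)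
      show "(\<lambda>n. B n x (B n y z)) \<longlonglongrightarrow> L (L x y) z + L y (L x z)"
        unfolding jac[of _ x y z] by (intro tendsto_add lim2 tendsto_const)
    qed
    show "foldr L xs y = 0" if "length xs = K" for xs y
      using fold[of xs y] nil[OF that] by (simp add: LIMSEQ_const_iff)
  qed
qed

lemma derivation_limit:
  fixes B :: "nat \<Rightarrow> 'a::euclidean_space \<Rightarrow> 'a \<Rightarrow> 'a"
  assumes B: "\<And>n. bilinear (B n)" and lim: "\<And>x y. (\<lambda>n. B n x y) \<longlonglongrightarrow> L x y"
    and A: "\<And>n. derivation (B n) (A n)" and limA: "\<And>x. (\<lambda>n. A n x) \<longlonglongrightarrow> T x"
  shows "derivation L T"
proof -
  have lin: "\<And>n. linear (A n)" and der: "\<And>n x y. A n (B n x y) = B n (A n x) y + B n x (A n y)"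
    using A by (simp_all add: derivation_def)
  have "T (L x y) = L (T x) y + L x (T y)" for x y
  proof (rule LIMSEQ_unique)
    show "(\<lambda>n. A n (B n x y)) \<longlonglongrightarrow> T (L x y)"
      by (rule linear_tendsto[OF lin limA lim])
    show "(\<lambda>n. A n (B n x y)) \<longlonglongrightarrow> L (T x) y + L x (T y)"
      unfolding der by (intro tendsto_add bilinear_tendsto[OF B lim] tendsto_const limA)
  qed
  then show ?thesis
    using linear_limit[OF lin limA] by (simp add: derivation_def)
qed

definition binner :: "('a::euclidean_space \<Rightarrow> 'a \<Rightarrow> 'a) \<Rightarrow> ('a \<Rightarrow> 'a \<Rightarrow> 'a) \<Rightarrow> real" where
  "binner B C = (\<Sum>i\<in>Basis. \<Sum>j\<in>Basis. B i j \<bullet> C i j)"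

definition oinner :: "('a::euclidean_space \<Rightarrow> 'a) \<Rightarrow> ('a \<Rightarrow> 'a) \<Rightarrow> real" where
  "oinner S T = (\<Sum>i\<in>Basis. S i \<bullet> T i)"

text \<open>The differential at the identity of the action \<open>conj_bracket\<close> of the
  general linear group; its isotropy algebra at \<open>B\<close> consists of the derivations of
  \<open>B\<close>.\<close>

definition act :: "('a::real_vector \<Rightarrow> 'a) \<Rightarrow> ('a \<Rightarrow> 'a \<Rightarrow> 'a) \<Rightarrow> 'a \<Rightarrow> 'a \<Rightarrow> 'a" where
  "act T B x y = T (B x y) - B (T x) y - B x (T y)"

lemma bilinear_linear: "bilinear B \<Longrightarrow> linear (B x)" "bilinear B \<Longrightarrow> linear (\<lambda>x. B x y)"
  by (simp_all add: bilinear_def)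

lemma bilinear_act:
  assumes "linear T" "bilinear B"
  shows "bilinear (act T B)"
  unfolding bilinear_def act_def
  by (intro conjI allI linearI)
     (simp_all add: assms linear_add linear_cmul bilinear_ladd bilinear_radd bilinear_lmul bilinear_rmul algebra_simps)

lemma derivation_act: "derivation B T \<longleftrightarrow> linear T \<and> (\<forall>x y. act T B x y = 0)"
  by (auto simp: derivation_def act_def algebra_simps)

lemma binner_frame:
  assumes u: "oframe u" and B: "bilinear B" and C: "bilinear C"
  shows "binner B C = (\<Sum>i\<in>Basis. \<Sum>j\<in>Basis. B (u i) (u j) \<bullet> C (u i) (u j))"
proof -
  have "binner B C = (\<Sum>i\<in>Basis. \<Sum>j\<in>Basis. B i (u j) \<bullet> C i (u j))"
    unfolding binner_def
    by (rule sum.cong[OF refl])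
       (rule oframe_double_sum[OF oframe_id u bilinear_linear(1)[OF B] bilinear_linear(1)[OF C]])
  also have "\<dots> = (\<Sum>j\<in>Basis. \<Sum>i\<in>Basis. B i (u j) \<bullet> C i (u j))"
    by (rule sum.swap)
  also have "\<dots> = (\<Sum>j\<in>Basis. \<Sum>i\<in>Basis. B (u i) (u j) \<bullet> C (u i) (u j))"
    by (rule sum.cong[OF refl])
       (rule oframe_double_sum[OF oframe_id u bilinear_linear(2)[OF B] bilinear_linear(2)[OF C]])
  also have "\<dots> = (\<Sum>i\<in>Basis. \<Sum>j\<in>Basis. B (u i) (u j) \<bullet> C (u i) (u j))"
    by (rule sum.swap)
  finally show ?thesis .
qed

lemma oinner_frame:
  assumes u: "oframe u" and "linear S" "linear T"
  shows "oinner S T = (\<Sum>i\<in>Basis. S (u i) \<bullet> T (u i))"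
  unfolding oinner_def by (rule oframe_double_sum[OF oframe_id assms])

lemma oinner_tr:
  assumes "linear S" "linear T"
  shows "oinner S T = tr (\<lambda>x. adjoint T (S x))"
  by (simp add: oinner_def tr_def adjoint_inner_left[OF assms(2)])

lemma binner_commute: "binner B C = binner C B"
  by (simp add: binner_def inner_commute)

lemma binner_nonneg: "0 \<le> binner B B"
  by (simp add: binner_def sum_nonneg)

lemma oinner_nonneg: "0 \<le> oinner T T"
  by (simp add: oinner_def sum_nonneg)

lemma binner_le:
  assumes u: "oframe u" and B: "bilinear B" and "i \<in> Basis" "j \<in> Basis"
  shows "B (u i) (u j) \<bullet> B (u i) (u j) \<le> binner B B"
proof -
  have "B (u i) (u j) \<bullet> B (u i) (u j) \<le> (\<Sum>j\<in>Basis. B (u i) (u j) \<bullet> B (u i) (u j))"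
    using assms by (intro member_le_sum) auto
  also have "\<dots> \<le> binner B B"
    unfolding binner_frame[OF u B B] using assms
    by (intro member_le_sum[of i Basis "\<lambda>i. \<Sum>j\<in>Basis. B (u i) (u j) \<bullet> B (u i) (u j)"]) (auto intro: sum_nonneg)
  finally show ?thesis .
qed

lemma binner_eq_0:
  assumes B: "bilinear B" and "binner B B = 0"
  shows "B x y = 0"
proof (rule bilinear_eqI[OF B _ oframe_id])
  show "bilinear (\<lambda>x y. 0 :: 'a)"
    by (simp add: bilinear_def linear_zero)
  show "B i j = 0" if "i \<in> Basis" "j \<in> Basis" for i j
    using binner_le[OF oframe_id B that] assms(2) by (metis inner_eq_zero_iff inner_ge_zero order_antisym)
qed

text \<open>The transpose of the action of \<open>T\<close> is the action of the transpose of
  \<open>T\<close>. In each slot, \<open>T\<close> is moved to the other factor by expanding in the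
  basis and exchanging the sums.\<close>

lemma binner_act_adjoint:
  assumes T: "linear T" and B: "bilinear B" and C: "bilinear C"
  shows "binner (act T B) C = binner B (act (adjoint T) C)"
proof -
  have adj: "adjoint T k \<bullet> i = T i \<bullet> k" for i k
    using adjoint_inner_left[OF T, of k i] inner_commute[of k "T i"] by simp
  have slot: "(\<Sum>i\<in>Basis. f (T i) \<bullet> g i) = (\<Sum>i\<in>Basis. f i \<bullet> g (adjoint T i))"
    if f: "linear f" and g: "linear g" for f g :: "'a \<Rightarrow> 'a"
  proof -
    have "(\<Sum>i\<in>Basis. f (T i) \<bullet> g i) = (\<Sum>i\<in>Basis. \<Sum>k\<in>Basis. (T i \<bullet> k) * (f k \<bullet> g i))"
      by (rule sum.cong[OF refl], subst oframe_linear_expand[OF oframe_id f]) (simp add: inner_sum_left)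
    also have "\<dots> = (\<Sum>k\<in>Basis. \<Sum>i\<in>Basis. (adjoint T k \<bullet> i) * (f k \<bullet> g i))"
      by (subst sum.swap) (simp add: adj)
    also have "\<dots> = (\<Sum>k\<in>Basis. f k \<bullet> g (adjoint T k))"
      by (rule sum.cong[OF refl], subst (2) oframe_linear_expand[OF oframe_id g]) (simp add: inner_sum_right)
    finally show ?thesis .
  qed
  have 1: "(\<Sum>i\<in>Basis. \<Sum>j\<in>Basis. B (T i) j \<bullet> C i j) = (\<Sum>i\<in>Basis. \<Sum>j\<in>Basis. B i j \<bullet> C (adjoint T i) j)"
    by (subst sum.swap, subst (2) sum.swap, rule sum.cong[OF refl],
        rule slot[OF bilinear_linear(2)[OF B] bilinear_linear(2)[OF C]])
  have 2: "(\<Sum>i\<in>Basis. \<Sum>j\<in>Basis. B i (T j) \<bullet> C i j) = (\<Sum>i\<in>Basis. \<Sum>j\<in>Basis. B i j \<bullet> C i (adjoint T j))"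
    by (rule sum.cong[OF refl], rule slot[OF bilinear_linear(1)[OF B] bilinear_linear(1)[OF C]])
  show ?thesis
    by (simp add: binner_def act_def inner_diff_left inner_diff_right sum_subtractf 1 2 adjoint_works[OF T])
qed

lemma act_commutator:
  assumes S: "linear S" and T: "linear T" and B: "bilinear B"
  shows "act (\<lambda>x. S (T x) - T (S x)) B x y = act S (act T B) x y - act T (act S B) x y"
  by (simp add: act_def linear_diff[OF S] linear_diff[OF T] linear_add[OF S] linear_add[OF T] bilinear_lsub[OF B] bilinear_rsub[OF B] algebra_simps)

lemma act_linear_comb:
  assumes B: "bilinear B"
  shows "act (\<lambda>x. c *\<^sub>R S x + d *\<^sub>R T x) B x y = c *\<^sub>R act S B x y + d *\<^sub>R act T B x y"
  by (simp add: act_def bilinear_ladd[OF B] bilinear_radd[OF B] bilinear_lmul[OF B] bilinear_rmul[OF B] algebra_simps)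

lemma tendsto_frameI:
  assumes u: "oframe u" and "\<And>k. k \<in> Basis \<Longrightarrow> (\<lambda>n. X n \<bullet> u k) \<longlonglongrightarrow> L \<bullet> u k"
  shows "X \<longlonglongrightarrow> L"
proof -
  have "(\<lambda>n. \<Sum>k\<in>Basis. (X n \<bullet> u k) *\<^sub>R u k) \<longlonglongrightarrow> (\<Sum>k\<in>Basis. (L \<bullet> u k) *\<^sub>R u k)"
    by (intro tendsto_sum tendsto_scaleR tendsto_const assms(2))
  then show ?thesis
    by (simp add: oframe_expand[OF u])
qed

lemma exp_real_mult_tendsto_0:
  assumes "c < 0"
  shows "(\<lambda>n. exp (real n * c)) \<longlonglongrightarrow> 0"
proof -
  have "(\<lambda>n. exp c ^ n) \<longlonglongrightarrow> 0"
    by (rule LIMSEQ_power_zero) (use assms in simp)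
  then show ?thesis
    by (simp add: exp_of_nat_mult)
qed

lemma trilinear_expand:
  fixes B :: "'a::euclidean_space \<Rightarrow> 'a \<Rightarrow> 'a"
  assumes B: "bilinear B" and u: "oframe u"
  shows "B x y \<bullet> z = (\<Sum>i\<in>Basis. \<Sum>j\<in>Basis. \<Sum>k\<in>Basis. (x \<bullet> u i) * (y \<bullet> u j) * (z \<bullet> u k) * (B (u i) (u j) \<bullet> u k))"
  by (subst bilinear_expand[OF B u u], simp add: inner_sum_left, subst oframe_inner[OF u, of _ z])
     (simp add: sum_distrib_left mult_ac)

section \<open>The grading attached to the optimal filtration, and the graded bracket\<close>

locale optimal_nilpotent = optimal_frame \<mu> u e
  for \<mu> :: "'a::euclidean_space \<Rightarrow> 'a \<Rightarrow> 'a" and u e +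
  fixes K :: nat
  assumes nil: "nil_lie K \<mu>"
begin

abbreviation D :: "'a \<Rightarrow> 'a" where "D \<equiv> diagop u e"

text \<open>The eigenvalues carry the same labels as in \<open>u\<close>, so the single weight
  function \<open>e\<close> serves all these frames. This allows limits of frames without
  relabelling.\<close>

definition adapted :: "('a \<Rightarrow> 'a) \<Rightarrow> bool" where
  "adapted v \<longleftrightarrow> oframe v \<and> (\<forall>i\<in>Basis. D (v i) = e i *\<^sub>R v i)"

lemma adapted_u: "adapted u"
  using frame by (simp add: adapted_def diagop_frame)

lemma adapted_frame: "adapted v \<Longrightarrow> oframe v"
  by (simp add: adapted_def)

lemma adapted_inner: "adapted v \<Longrightarrow> i \<in> Basis \<Longrightarrow> j \<in> Basis \<Longrightarrow> e i \<noteq> e j \<Longrightarrow> v i \<bullet> u j = 0"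
  using eigenvector_inner[OF frame, of e "v i" "e i" j] by (auto simp: adapted_def)

text \<open>Adapted frames differ within the eigenspaces of \<open>D\<close> only, so each
  coefficient combines coefficients in \<open>u\<close> with the same three weights.\<close>

lemma adapted_mult:
  assumes v: "adapted v"
  shows "frame_multiplicative \<mu> v e"
  unfolding frame_multiplicative_def
proof (intro ballI impI)
  fix i j k :: 'a assume ijk: "i \<in> Basis" "j \<in> Basis" "k \<in> Basis" and nz: "\<mu> (v i) (v j) \<bullet> v k \<noteq> 0"
  show "e i + e j \<le> e k"
  proof (rule ccontr)
    assume less: "\<not> e i + e j \<le> e k"
    have "(v i \<bullet> u p) * (v j \<bullet> u q) * (v k \<bullet> u l) * (\<mu> (u p) (u q) \<bullet> u l) = 0"
      if pql: "p \<in> Basis" "q \<in> Basis" "l \<in> Basis" for p q l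
    proof (rule ccontr)
      assume "(v i \<bullet> u p) * (v j \<bullet> u q) * (v k \<bullet> u l) * (\<mu> (u p) (u q) \<bullet> u l) \<noteq> 0"
      then have "v i \<bullet> u p \<noteq> 0" "v j \<bullet> u q \<noteq> 0" "v k \<bullet> u l \<noteq> 0" "\<mu> (u p) (u q) \<bullet> u l \<noteq> 0"
        by auto
      then have "e i = e p" "e j = e q" "e k = e l" "e p + e q \<le> e l"
        using adapted_inner[OF v ijk(1) pql(1)] adapted_inner[OF v ijk(2) pql(2)]
          adapted_inner[OF v ijk(3) pql(3)] mult pql by (auto simp: frame_multiplicative_def)
      then show False
        using less by simp
    qed
    then have "\<mu> (v i) (v j) \<bullet> v k = 0"
      unfolding trilinear_expand[OF bilin frame, of "v i" "v j" "v k"] by (simp add: sum.neutral)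
    then show False
      using nz by simp
  qed
qed

text \<open>The bracket of the associated graded algebra, placed on the same space by means of
  \<open>u\<close>. Being a limit of conjugates of \<open>\<mu>\<close>, it inherits the Lie axioms
  and nilpotency.\<close>

definition \<nu> :: "'a \<Rightarrow> 'a \<Rightarrow> 'a" where
  "\<nu> x y = (\<Sum>i\<in>Basis. \<Sum>j\<in>Basis. \<Sum>k\<in>Basis.
     (if e k = e i + e j then (x \<bullet> u i) * (y \<bullet> u j) * (\<mu> (u i) (u j) \<bullet> u k) else 0) *\<^sub>R u k)"

lemma nu_inner:
  assumes k: "k \<in> Basis"
  shows "\<nu> x y \<bullet> u k = (\<Sum>i\<in>Basis. \<Sum>j\<in>Basis.
     (if e k = e i + e j then (x \<bullet> u i) * (y \<bullet> u j) * (\<mu> (u i) (u j) \<bullet> u k) else 0))"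
proof -
  have "(\<Sum>l\<in>Basis. (if e l = e i + e j then (x \<bullet> u i) * (y \<bullet> u j) * (\<mu> (u i) (u j) \<bullet> u l) else 0) * (u l \<bullet> u k))
      = (if e k = e i + e j then (x \<bullet> u i) * (y \<bullet> u j) * (\<mu> (u i) (u j) \<bullet> u k) else 0)" for i j
  proof -
    have "(\<Sum>l\<in>Basis. (if e l = e i + e j then (x \<bullet> u i) * (y \<bullet> u j) * (\<mu> (u i) (u j) \<bullet> u l) else 0) * (u l \<bullet> u k))
      = (\<Sum>l\<in>Basis. if l = k then (if e k = e i + e j then (x \<bullet> u i) * (y \<bullet> u j) * (\<mu> (u i) (u j) \<bullet> u k) else 0) else 0)"
      by (rule sum.cong) (auto simp: oframeD[OF frame _ k])
    then show ?thesis
      using k by simp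
  qed
  then show ?thesis
    by (simp add: \<nu>_def inner_sum_left)
qed

lemma nu_basis:
  assumes ijk: "i \<in> Basis" "j \<in> Basis" "k \<in> Basis"
  shows "\<nu> (u i) (u j) \<bullet> u k = (if e k = e i + e j then \<mu> (u i) (u j) \<bullet> u k else 0)"
proof -
  have "\<nu> (u i) (u j) \<bullet> u k = (\<Sum>p\<in>Basis. \<Sum>q\<in>Basis.
      if p = i \<and> q = j then (if e k = e i + e j then \<mu> (u i) (u j) \<bullet> u k else 0) else 0)"
    unfolding nu_inner[OF ijk(3)]
    by (intro sum.cong refl) (auto simp: oframeD[OF frame ijk(1)] oframeD[OF frame ijk(2)])
  also have "\<dots> = (\<Sum>p\<in>Basis. if p = i then (if e k = e i + e j then \<mu> (u i) (u j) \<bullet> u k else 0) else 0)"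
    using ijk by (intro sum.cong refl) (auto simp: sum.delta)
  finally show ?thesis
    using ijk by simp
qed

definition degen :: "nat \<Rightarrow> 'a \<Rightarrow> 'a" where "degen m = diagop u (\<lambda>i. exp (- (real m * e i)))"
definition degen_inv :: "nat \<Rightarrow> 'a \<Rightarrow> 'a" where "degen_inv m = diagop u (\<lambda>i. exp (real m * e i))"

lemma gm_hm: "degen m (degen_inv m x) = x" "degen_inv m (degen m x) = x" "linear (degen m)" "linear (degen_inv m)"
  by (simp_all add: degen_def degen_inv_def diagop_comp[OF frame] exp_minus diagop_one[OF frame] linear_diagop)

text \<open>Conjugation with \<open>exp (- m D)\<close> multiplies the coefficient at
  \<open>i\<close>, \<open>j\<close>, \<open>k\<close> by \<open>exp (m (e i + e j - e k))\<close>.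
  Multiplicativity makes this exponent nonpositive at nonzero coefficients, and those with exponent
  0 survive.\<close>

lemma degeneration:
  shows "(\<lambda>m. conj_bracket (degen m) (degen_inv m) \<mu> x y) \<longlonglongrightarrow> \<nu> x y"
proof (rule tendsto_frameI[OF frame])
  fix k :: 'a assume k: "k \<in> Basis"
  have eq: "conj_bracket (degen m) (degen_inv m) \<mu> x y \<bullet> u k
      = (\<Sum>i\<in>Basis. \<Sum>j\<in>Basis. exp (real m * (e i + e j - e k)) * ((x \<bullet> u i) * (y \<bullet> u j) * (\<mu> (u i) (u j) \<bullet> u k)))" for m
  proof -
    have "conj_bracket (degen m) (degen_inv m) \<mu> x y \<bullet> u k = exp (- (real m * e k)) * (\<mu> (degen_inv m x) (degen_inv m y) \<bullet> u k)"
      by (simp add: conj_bracket_def degen_def diagop_inner[OF frame k])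
    also have "\<dots> = (\<Sum>i\<in>Basis. \<Sum>j\<in>Basis. exp (- (real m * e k)) * (((degen_inv m x \<bullet> u i) * (degen_inv m y \<bullet> u j)) * (\<mu> (u i) (u j) \<bullet> u k)))"
      by (subst bilinear_expand[OF bilin frame frame]) (simp add: inner_sum_left sum_distrib_left)
    also have "\<dots> = (\<Sum>i\<in>Basis. \<Sum>j\<in>Basis. exp (real m * (e i + e j - e k)) * ((x \<bullet> u i) * (y \<bullet> u j) * (\<mu> (u i) (u j) \<bullet> u k)))"
      by (intro sum.cong refl)
         (simp add: degen_inv_def diagop_inner[OF frame] exp_add exp_diff exp_minus algebra_simps divide_inverse)
    finally show ?thesis .
  qed
  show "(\<lambda>m. conj_bracket (degen m) (degen_inv m) \<mu> x y \<bullet> u k) \<longlonglongrightarrow> \<nu> x y \<bullet> u k"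
    unfolding eq nu_inner[OF k]
  proof (intro tendsto_sum)
    fix i j :: 'a assume ij: "i \<in> Basis" "j \<in> Basis"
    let ?c = "(x \<bullet> u i) * (y \<bullet> u j) * (\<mu> (u i) (u j) \<bullet> u k)"
    consider "\<mu> (u i) (u j) \<bullet> u k = 0" | "e k = e i + e j" | "e i + e j < e k"
      using mult ij k by (fastforce simp: frame_multiplicative_def)
    then show "(\<lambda>m. exp (real m * (e i + e j - e k)) * ?c) \<longlonglongrightarrow> (if e k = e i + e j then ?c else 0)"
    proof cases
      case 3
      then have "(\<lambda>m. exp (real m * (e i + e j - e k)) * ?c) \<longlonglongrightarrow> 0 * ?c"
        by (intro tendsto_mult exp_real_mult_tendsto_0 tendsto_const) simp
      then show ?thesis
        using 3 by simp
    qed simp_all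
  qed
qed

lemma nil_nu: "nil_lie K \<nu>"
  by (rule nil_lie_limit[OF nil_lie_conjb degeneration]) (simp_all add: gm_hm nil)

lemma bilinear_nu: "bilinear \<nu>"
  using nil_nu by (simp add: nil_lie_def)

text \<open>The graded bracket does not depend on the adapted frame in which it is cut out.\<close>

lemma nu_adapted:
  assumes v: "adapted v" and ijk: "i \<in> Basis" "j \<in> Basis" "k \<in> Basis"
  shows "\<nu> (v i) (v j) \<bullet> v k = (if e k = e i + e j then \<mu> (v i) (v j) \<bullet> v k else 0)"
proof -
  have "(v i \<bullet> u p) * (v j \<bullet> u q) * (v k \<bullet> u l) * (\<nu> (u p) (u q) \<bullet> u l)
      = (if e k = e i + e j then (v i \<bullet> u p) * (v j \<bullet> u q) * (v k \<bullet> u l) * (\<mu> (u p) (u q) \<bullet> u l) else 0)"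
    if pql: "p \<in> Basis" "q \<in> Basis" "l \<in> Basis" for p q l
  proof (cases "v i \<bullet> u p = 0 \<or> v j \<bullet> u q = 0 \<or> v k \<bullet> u l = 0")
    case False
    then have "e i = e p" "e j = e q" "e k = e l"
      using adapted_inner[OF v ijk(1) pql(1)] adapted_inner[OF v ijk(2) pql(2)]
        adapted_inner[OF v ijk(3) pql(3)] by auto
    then show ?thesis
      by (simp add: nu_basis[OF pql])
  qed auto
  then show ?thesis
    unfolding trilinear_expand[OF bilinear_nu frame, of "v i" "v j" "v k"]
      trilinear_expand[OF bilin frame, of "v i" "v j" "v k"]
    by simp
qed

lemma D_derivation: "derivation \<nu> D"
  unfolding derivation_def
proof (intro conjI allI linear_diagop)
  fix x y
  show "D (\<nu> x y) = \<nu> (D x) y + \<nu> x (D y)"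
  proof (rule bilinear_eqI[of "\<lambda>x y. D (\<nu> x y)" "\<lambda>x y. \<nu> (D x) y + \<nu> x (D y)", OF _ _ frame])
    show "bilinear (\<lambda>x y. D (\<nu> x y))"
      unfolding bilinear_def
      by (intro conjI allI linearI)
         (simp_all add: linear_add[OF linear_diagop] linear_cmul[OF linear_diagop] bilinear_ladd[OF bilinear_nu]
           bilinear_radd[OF bilinear_nu] bilinear_lmul[OF bilinear_nu] bilinear_rmul[OF bilinear_nu])
    show "bilinear (\<lambda>x y. \<nu> (D x) y + \<nu> x (D y))"
      unfolding bilinear_def
      by (intro conjI allI linearI)
         (simp_all add: linear_add[OF linear_diagop] linear_cmul[OF linear_diagop] bilinear_ladd[OF bilinear_nu]
           bilinear_radd[OF bilinear_nu] bilinear_lmul[OF bilinear_nu] bilinear_rmul[OF bilinear_nu] algebra_simps)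
    show "D (\<nu> (u i) (u j)) = \<nu> (D (u i)) (u j) + \<nu> (u i) (D (u j))" if ij: "i \<in> Basis" "j \<in> Basis" for i j
      by (rule oframe_eqI[OF frame])
         (auto simp: diagop_inner[OF frame] diagop_frame[OF frame] ij bilinear_lmul[OF bilinear_nu] bilinear_rmul[OF bilinear_nu]
           inner_add_left nu_basis algebra_simps)
  qed
qed

text \<open>A derivation preserves the filtration, so its conjugates by \<open>exp (- m D)\<close>
  converge to its part \<open>A0\<close> of degree 0, a derivation of the limit bracket. The
  diagonal of \<open>A\<close>, all that the trace against \<open>D - 1\<close> sees, stays
  unchanged.\<close>

lemma graded_derivation:
  assumes A: "derivation \<mu> A"
  obtains A0 where "derivation \<nu> A0" "\<forall>x. D (A0 x) = A0 (D x)"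
    "(\<Sum>i\<in>Basis. (e i - 1) * (A0 (u i) \<bullet> u i)) = (\<Sum>i\<in>Basis. (e i - 1) * (A (u i) \<bullet> u i))"
proof -
  have lin: "linear A" and der: "\<And>x y. A (\<mu> x y) = \<mu> (A x) y + \<mu> x (A y)"
    using A by (auto simp: derivation_def)
  have inv: "e i \<le> e k" if "i \<in> Basis" "k \<in> Basis" "A (u i) \<bullet> u k \<noteq> 0" for i k
    using derivation_invariant[OF lin der ffs_base[of i "e i" e u]] that unfolding mem_ffs[OF frame]
    by (metis not_le order_refl)
  define A0 where "A0 x = (\<Sum>i\<in>Basis. \<Sum>k\<in>Basis. (if e k = e i then (x \<bullet> u i) * (A (u i) \<bullet> u k) else 0) *\<^sub>R u k)" for x
  have A0: "A0 x \<bullet> u k = (\<Sum>i\<in>Basis. if e k = e i then (x \<bullet> u i) * (A (u i) \<bullet> u k) else 0)" if k: "k \<in> Basis" for x k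
  proof -
    have "(\<Sum>l\<in>Basis. (if e l = e i then (x \<bullet> u i) * (A (u i) \<bullet> u l) else 0) * (u l \<bullet> u k))
      = (\<Sum>l\<in>Basis. if l = k then (if e k = e i then (x \<bullet> u i) * (A (u i) \<bullet> u k) else 0) else 0)" for i
      by (rule sum.cong) (auto simp: oframeD[OF frame _ k])
    then show ?thesis
      using k by (simp add: A0_def inner_sum_left)
  qed
  have lim: "(\<lambda>m. conj_op (degen m) (degen_inv m) A x) \<longlonglongrightarrow> A0 x" for x
  proof (rule tendsto_frameI[OF frame])
    fix k :: 'a assume k: "k \<in> Basis"
    have eq: "conj_op (degen m) (degen_inv m) A x \<bullet> u k
        = (\<Sum>i\<in>Basis. exp (real m * (e i - e k)) * ((x \<bullet> u i) * (A (u i) \<bullet> u k)))" for m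
    proof -
      have "conj_op (degen m) (degen_inv m) A x \<bullet> u k = exp (- (real m * e k)) * (A (degen_inv m x) \<bullet> u k)"
        by (simp add: conj_op_def degen_def diagop_inner[OF frame k])
      also have "\<dots> = (\<Sum>i\<in>Basis. exp (- (real m * e k)) * ((degen_inv m x \<bullet> u i) * (A (u i) \<bullet> u k)))"
        by (subst oframe_linear_expand[OF frame lin]) (simp add: inner_sum_left sum_distrib_left)
      also have "\<dots> = (\<Sum>i\<in>Basis. exp (real m * (e i - e k)) * ((x \<bullet> u i) * (A (u i) \<bullet> u k)))"
        by (intro sum.cong refl)
           (simp add: degen_inv_def diagop_inner[OF frame] exp_add exp_diff exp_minus algebra_simps divide_inverse)
      finally show ?thesis .
    qed
    show "(\<lambda>m. conj_op (degen m) (degen_inv m) A x \<bullet> u k) \<longlonglongrightarrow> A0 x \<bullet> u k"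
      unfolding eq A0[OF k]
    proof (intro tendsto_sum)
      fix i :: 'a assume i: "i \<in> Basis"
      let ?c = "(x \<bullet> u i) * (A (u i) \<bullet> u k)"
      consider "A (u i) \<bullet> u k = 0" | "e k = e i" | "e i < e k"
        using inv[OF i k] by fastforce
      then show "(\<lambda>m. exp (real m * (e i - e k)) * ?c) \<longlonglongrightarrow> (if e k = e i then ?c else 0)"
      proof cases
        case 3
        then have "(\<lambda>m. exp (real m * (e i - e k)) * ?c) \<longlonglongrightarrow> 0 * ?c"
          by (intro tendsto_mult exp_real_mult_tendsto_0 tendsto_const) simp
        then show ?thesis
          using 3 by simp
      qed simp_all
    qed
  qed
  have "derivation \<nu> A0"
    by (rule derivation_limit[OF _ degeneration derivation_conj lim])
       (simp_all add: gm_hm A bilin bilinear_conjb)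
  moreover have "D (A0 x) = A0 (D x)" for x
    by (rule oframe_eqI[OF frame])
       (auto simp: A0 diagop_inner[OF frame] sum_distrib_left intro!: sum.cong)
  moreover have "A0 (u i) \<bullet> u i = A (u i) \<bullet> u i" if i: "i \<in> Basis" for i
  proof -
    have "A0 (u i) \<bullet> u i = (\<Sum>j\<in>Basis. if j = i then A (u i) \<bullet> u i else 0)"
      unfolding A0[OF i] by (intro sum.cong refl) (auto simp: oframeD[OF frame i])
    then show ?thesis
      using i by simp
  qed
  ultimately show thesis
    using that[of A0] by simp
qed

subsection \<open>Operators commuting with the grading\<close>

definition graded_iso :: "('a \<Rightarrow> 'a) \<Rightarrow> ('a \<Rightarrow> 'a) \<Rightarrow> bool" where
  "graded_iso g h \<longleftrightarrow> linear g \<and> linear h \<and> (\<forall>x. g (h x) = x) \<and> (\<forall>x. h (g x) = x) \<and> (\<forall>x. g (D x) = D (g x))"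

lemma inG_D: "graded_iso g h \<Longrightarrow> h (D x) = D (h x)"
  unfolding graded_iso_def by metis

lemma inG_compose: "graded_iso g h \<Longrightarrow> graded_iso g' h' \<Longrightarrow> graded_iso (\<lambda>x. g' (g x)) (\<lambda>x. h (h' x))"
  unfolding graded_iso_def using linear_compose[of g g'] linear_compose[of h' h] by (simp add: o_def)

definition proj :: "real \<Rightarrow> 'a \<Rightarrow> 'a" where
  "proj s = diagop u (\<lambda>i. if e i = s then 1 else 0)"

text \<open>For \<open>g\<close> commuting with \<open>D\<close>: \<open>g\<close> on the eigenspace
  of \<open>s\<close> and the identity on the others, so that its determinant is that of the
  restriction of \<open>g\<close>.\<close>

definition block :: "real \<Rightarrow> ('a \<Rightarrow> 'a) \<Rightarrow> 'a \<Rightarrow> 'a" where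
  "block s g x = g (proj s x) + (x - proj s x)"

text \<open>The logarithm of \<open>\<Prod>\<^sub>s \<bar>det (g restricted to the eigenspace of s)\<bar>\<^sup>s\<^sup>-\<^sup>1\<close>, the character
  of the centralizer of \<open>D\<close> whose differential is \<open>Y \<mapsto> tr ((D - 1) Y)\<close>.\<close>

definition log_char :: "('a \<Rightarrow> 'a) \<Rightarrow> real" where
  "log_char g = (\<Sum>s\<in>e ` Basis. (s - 1) * ln \<bar>edet (block s g)\<bar>)"

lemma proj_eigen: "D x = r *\<^sub>R x \<Longrightarrow> proj s x = (if r = s then x else 0)"
  using diagop_eigenvector[OF frame, of e x r "\<lambda>t. if t = s then 1 else 0"] by (simp add: proj_def)

lemma linear_proj: "linear (proj s)"
  by (simp add: proj_def linear_diagop)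

lemma linear_blk: "linear g \<Longrightarrow> linear (block s g)"
  unfolding block_def
  by (intro linear_compose_add linear_compose_sub linear_proj linear_ident linear_compose[of "proj s" g, unfolded o_def])

lemma proj_comm:
  assumes g: "linear g" "\<And>x. g (D x) = D (g x)"
  shows "proj s (g x) = g (proj s x)"
proof (rule oframe_linear_eqI[OF frame, of "\<lambda>x. proj s (g x)" "\<lambda>x. g (proj s x)"])
  show "linear (\<lambda>x. proj s (g x))" "linear (\<lambda>x. g (proj s x))"
    using linear_compose[OF g(1) linear_proj] linear_compose[OF linear_proj g(1)] by (simp_all add: o_def)
  fix i :: 'a assume i: "i \<in> Basis"
  have "D (u i) = e i *\<^sub>R u i"
    using i by (rule diagop_frame[OF frame])
  then have "D (g (u i)) = e i *\<^sub>R g (u i)"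
    using g(2)[of "u i"] by (simp add: linear_cmul[OF g(1)])
  from proj_eigen[OF this] proj_eigen[OF \<open>D (u i) = e i *\<^sub>R u i\<close>]
  show "proj s (g (u i)) = g (proj s (u i))"
    by (simp add: linear_0[OF g(1)])
qed

lemma blk_frames:
  assumes v: "adapted v" and z: "adapted z" and g: "linear g"
    and gv: "\<And>i. i \<in> Basis \<Longrightarrow> g (v i) = a i *\<^sub>R z i" and a: "\<And>i. i \<in> Basis \<Longrightarrow> 0 < a i"
  shows "\<bar>edet (block s g)\<bar> = (\<Prod>i\<in>{i \<in> Basis. e i = s}. a i)"
proof -
  \<comment> \<open>\<open>block s g\<close> scales \<open>v\<close> into this frame; it is
    orthonormal because eigenspaces of \<open>D\<close> for different eigenvalues are
    orthogonal.\<close>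
  define w where "w i = (if e i = s then z i else v i)" for i
  have zv: "z i \<bullet> v j = 0" if "i \<in> Basis" "j \<in> Basis" "e i \<noteq> e j" for i j
  proof -
    have "D (z i) \<bullet> v j = z i \<bullet> D (v j)"
      by (rule diagop_symmetric)
    then have "e i * (z i \<bullet> v j) = e j * (z i \<bullet> v j)"
      using v z that by (simp add: adapted_def)
    then show ?thesis
      using that by simp
  qed
  have w: "oframe w"
    unfolding oframe_def
  proof (intro ballI)
    fix i j :: 'a assume "i \<in> Basis" "j \<in> Basis"
    then show "w i \<bullet> w j = (if i = j then 1 else 0)"
      using oframeD[OF adapted_frame[OF v], of i j] oframeD[OF adapted_frame[OF z], of i j] zv[of i j] zv[of j i]
      by (auto simp: w_def inner_commute)
  qed
  have "\<bar>edet (block s g)\<bar> = \<bar>\<Prod>i\<in>Basis. if e i = s then a i else 1\<bar>"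
  proof (rule abs_edet_frames[OF linear_blk[OF g] adapted_frame[OF v] w])
    fix i :: 'a assume i: "i \<in> Basis"
    have "D (v i) = e i *\<^sub>R v i"
      using v i by (simp add: adapted_def)
    from proj_eigen[OF this] show "block s g (v i) = (if e i = s then a i else 1) *\<^sub>R w i"
      by (simp add: block_def w_def gv[OF i] linear_0[OF g])
  qed
  also have "(\<Prod>i\<in>Basis. if e i = s then a i else 1) = (\<Prod>i\<in>{i \<in> Basis. e i = s}. a i)"
    by (simp add: prod.inter_filter[symmetric])
  also have "\<bar>\<dots>\<bar> = \<dots>"
    using a by (intro abs_of_nonneg prod_nonneg) (auto simp: less_imp_le)
  finally show ?thesis .
qed

lemma lchi_frames:
  assumes v: "adapted v" and z: "adapted z" and g: "linear g"
    and gv: "\<And>i. i \<in> Basis \<Longrightarrow> g (v i) = a i *\<^sub>R z i" and a: "\<And>i. i \<in> Basis \<Longrightarrow> 0 < a i"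
  shows "log_char g = (\<Sum>i\<in>Basis. (e i - 1) * ln (a i))"
proof -
  have "ln (\<Prod>i\<in>{i \<in> Basis. e i = s}. a i) = (\<Sum>i\<in>{i \<in> Basis. e i = s}. ln (a i))" for s
    by (intro ln_prod) (use a in force)+
  then have "log_char g = (\<Sum>s\<in>e ` Basis. (s - 1) * (\<Sum>i\<in>{i \<in> Basis. e i = s}. ln (a i)))"
    by (simp add: log_char_def blk_frames[OF assms])
  also have "\<dots> = (\<Sum>s\<in>e ` Basis. \<Sum>i\<in>{i \<in> Basis. e i = s}. (e i - 1) * ln (a i))"
    by (simp add: sum_distrib_left)
  also have "\<dots> = (\<Sum>i\<in>Basis. (e i - 1) * ln (a i))"
    by (rule sum.group) auto
  finally show ?thesis .
qed

text \<open>A common eigenframe of \<open>D\<close> and \<open>T\<close> lists the eigenvalues of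
  \<open>D\<close> in some order. It spans the same filtration as \<open>u\<close>, so the
  multiplicities agree and a permutation of \<open>Basis\<close> restores the labels of
  \<open>e\<close>.\<close>

lemma adapted_eigenframe:
  assumes T: "linear T" and sym: "\<And>x y. T x \<bullet> y = x \<bullet> T y" and comm: "\<And>x. D (T x) = T (D x)"
  obtains v y where "adapted v" "\<And>i. i \<in> Basis \<Longrightarrow> T (v i) = y i *\<^sub>R v i"
proof -
  obtain w f y where w: "oframe w" and Dw: "\<And>i. i \<in> Basis \<Longrightarrow> D (w i) = f i *\<^sub>R w i"
    and Tw: "\<And>i. i \<in> Basis \<Longrightarrow> T (w i) = y i *\<^sub>R w i"
    using common_eigenframe[OF linear_diagop T diagop_symmetric sym comm] by metis
  have wu: "w i \<bullet> u j = 0" if "i \<in> Basis" "j \<in> Basis" "f i \<noteq> e j" for i j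
    using eigenvector_inner[OF frame Dw, of i j] that by auto
  have "frame_filt w f s \<subseteq> frame_filt u e s" "frame_filt u e s \<subseteq> frame_filt w f s" for s
  proof -
    have "w i \<in> frame_filt u e s" if "i \<in> Basis" "s \<le> f i" for i
      using wu that by (force simp: mem_ffs[OF frame])
    then show "frame_filt w f s \<subseteq> frame_filt u e s"
      unfolding frame_filt_def[of w f] by (intro span_minimal subspace_ffs) auto
    have "u j \<in> frame_filt w f s" if "j \<in> Basis" "s \<le> e j" for j
      unfolding mem_ffs[OF w]
    proof (intro ballI impI)
      fix i :: 'a assume "i \<in> Basis" "f i < s"
      then show "u j \<bullet> w i = 0"
        using wu[of i j] that by (simp add: inner_commute)
    qed
    then show "frame_filt u e s \<subseteq> frame_filt w f s"
      unfolding frame_filt_def[of u e] by (intro span_minimal subspace_ffs) auto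
  qed
  then have frame_filt: "frame_filt w f s = frame_filt u e s" for s
    by blast
  have inj: "inj_on w Basis"
    by (rule oframe_inj[OF w])
  have "card {c \<in> w ` Basis. frame_weight w f c = s} = card {c \<in> u ` Basis. frame_weight u e c = s}" for s
    by (rule weight_multiplicity)
       (simp_all add: oframe_independent w frame fs_frame[OF inj] fs_frame[OF inj_u] frame_filt)
  moreover have "card {c \<in> v ` Basis. frame_weight v f' c = s} = card {i \<in> Basis. f' i = s}"
    if "inj_on v Basis" for v :: "'a \<Rightarrow> 'a" and f' s
  proof -
    have "{c \<in> v ` Basis. frame_weight v f' c = s} = v ` {i \<in> Basis. f' i = s}"
      using fw_apply[OF that] by auto
    moreover have "inj_on v {i \<in> Basis. f' i = s}"
      using that by (rule inj_on_subset) auto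
    ultimately show ?thesis
      by (simp add: card_image)
  qed
  ultimately have card: "card {i \<in> Basis. e i = s} = card {i \<in> Basis. f i = s}" for s
    using inj inj_u by metis
  have count: "count (image_mset f' (mset_set I)) s = card {i \<in> I. f' i = s}" if "finite I" for f' :: "'a \<Rightarrow> real" and I s
    using that
  proof (induction I)
    case (insert x I)
    have "{i \<in> insert x I. f' i = s} = (if f' x = s then insert x {i \<in> I. f' i = s} else {i \<in> I. f' i = s})"
      by auto
    then show ?case
      using insert by auto
  qed simp
  have "image_mset e (mset_set Basis) = image_mset f (mset_set Basis)"
    by (rule multiset_eqI) (simp add: count card)
  then obtain p where p: "p permutes Basis" "\<forall>i\<in>Basis. e i = f (p i)"
    using image_mset_eq_implies_permutes[OF finite_Basis] by metis
  have pB: "p i \<in> Basis" if "i \<in> Basis" for i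
    using p(1) that by (simp add: permutes_in_image)
  have pinj: "p i = p j \<longleftrightarrow> i = j" for i j
    using permutes_inj[OF p(1)] by (auto simp: inj_def)
  have "adapted (\<lambda>i. w (p i))"
    using p(2) by (auto simp: adapted_def oframe_def oframeD[OF w] pB pinj Dw)
  then show thesis
    using that[of "\<lambda>i. w (p i)" "\<lambda>i. y (p i)"] Tw pB by blast
qed

text \<open>Singular value decomposition inside the centralizer of \<open>D\<close>: as
  \<open>D\<close> is symmetric, it commutes with the adjoint of \<open>g\<close> composed with
  \<open>g\<close>, whose eigenframe can be chosen adapted.\<close>

lemma singular_frames:
  assumes G: "graded_iso g h"
  obtains v z a where "adapted v" "adapted z" "\<And>i. i \<in> Basis \<Longrightarrow> g (v i) = a i *\<^sub>R z i"
    "\<And>i. i \<in> Basis \<Longrightarrow> 0 < a i"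
proof -
  have g: "linear g" "\<And>x. g (D x) = D (g x)" "\<And>x. h (g x) = x" "linear h"
    using G by (auto simp: graded_iso_def)
  define T where "T x = adjoint g (g x)" for x
  have T: "linear T"
    unfolding T_def using linear_compose[OF g(1) adjoint_linear[OF g(1)]] by (simp add: o_def)
  have Tin: "T x \<bullet> y = g x \<bullet> g y" for x y
    by (simp add: T_def adjoint_inner_left[OF g(1)])
  have "D (T x) = T (D x)" for x
  proof (rule vector_eq_rdot[THEN iffD1], intro allI)
    fix y
    have "D (T x) \<bullet> y = g x \<bullet> g (D y)"
      by (simp add: diagop_symmetric Tin)
    also have "\<dots> = g (D x) \<bullet> g y"
      by (simp add: g(2) diagop_symmetric)
    finally show "D (T x) \<bullet> y = T (D x) \<bullet> y"
      by (simp add: Tin)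
  qed
  then obtain v y where v: "adapted v" and Tv: "\<And>i. i \<in> Basis \<Longrightarrow> T (v i) = y i *\<^sub>R v i"
    using adapted_eigenframe[OF T] Tin by (metis inner_commute)
  have fr: "oframe v"
    using v by (rule adapted_frame)
  define a where "a i = norm (g (v i))" for i
  have pos: "0 < a i" if "i \<in> Basis" for i
  proof -
    have "g (v i) \<noteq> 0"
      using g(3)[of "v i"] oframe_nonzero[OF fr that] by (metis g(4) linear_0)
    then show ?thesis by (simp add: a_def)
  qed
  define z where "z i = g (v i) /\<^sub>R a i" for i
  have gin: "g (v i) \<bullet> g (v j) = (if i = j then (a i)\<^sup>2 else 0)" if "i \<in> Basis" "j \<in> Basis" for i j
  proof (cases "i = j")
    case True
    then show ?thesis by (simp add: a_def power2_norm_eq_inner)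
  next
    case False
    then show ?thesis
      using Tin[of "v i" "v j"] Tv[OF that(1)] oframeD[OF fr that] by simp
  qed
  have "oframe z"
    unfolding oframe_def
  proof (intro ballI)
    fix i j :: 'a assume ij: "i \<in> Basis" "j \<in> Basis"
    show "z i \<bullet> z j = (if i = j then 1 else 0)"
      using gin[OF ij] pos[OF ij(1)] by (auto simp: z_def power2_eq_square field_simps)
  qed
  moreover have "D (z i) = e i *\<^sub>R z i" if "i \<in> Basis" for i
  proof -
    have "D (v i) = e i *\<^sub>R v i"
      using v that by (simp add: adapted_def)
    then have "D (g (v i)) = e i *\<^sub>R g (v i)"
      using g(2)[of "v i"] by (simp add: linear_cmul[OF g(1)])
    then show ?thesis
      by (simp add: z_def linear_cmul[OF linear_diagop])
  qed
  ultimately have "adapted z"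
    by (simp add: adapted_def)
  moreover have "g (v i) = a i *\<^sub>R z i" if "i \<in> Basis" for i
    using pos[OF that] by (simp add: z_def)
  ultimately show thesis
    using that[OF v] pos by blast
qed

lemma lchi_compose:
  assumes G: "graded_iso g h" and G': "graded_iso g' h'"
  shows "log_char (\<lambda>x. g' (g x)) = log_char g' + log_char g"
proof -
  have lin: "linear g" "linear g'" and comm: "\<And>x. g (D x) = D (g x)" "\<And>x. g' (D x) = D (g' x)"
    using G G' by (auto simp: graded_iso_def)
  have nz: "edet (block s g) \<noteq> 0" if "graded_iso g h" for g h s
  proof -
    obtain v z a where vz: "adapted v" "adapted z" "\<And>i. i \<in> Basis \<Longrightarrow> g (v i) = a i *\<^sub>R z i"
      and a: "\<And>i. i \<in> Basis \<Longrightarrow> 0 < a i"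
      using singular_frames[OF \<open>graded_iso g h\<close>] by metis
    have "0 < (\<Prod>i\<in>{i \<in> Basis. e i = s}. a i)"
      using a by (intro prod_pos) auto
    moreover have "\<bar>edet (block s g)\<bar> = (\<Prod>i\<in>{i \<in> Basis. e i = s}. a i)"
      by (rule blk_frames[OF vz(1,2) _ vz(3) a]) (use \<open>graded_iso g h\<close> in \<open>simp_all add: graded_iso_def\<close>)
    ultimately show ?thesis
      by linarith
  qed
  have pp: "proj s (proj s x) = proj s x" for s x
    unfolding proj_def diagop_comp[OF frame] by (rule diagop_cong) auto
  have block: "block s (\<lambda>x. g' (g x)) x = block s g' (block s g x)" for s x
    by (simp add: block_def linear_add[OF linear_proj] linear_diff[OF linear_proj] pp
        proj_comm[OF lin(1) comm(1)])
  then have "edet (block s (\<lambda>x. g' (g x))) = edet (block s g') * edet (block s g)" for s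
    using edet_comp[OF linear_blk[OF lin(2)], of s "block s g"] by (simp add: block[abs_def])
  then have "ln \<bar>edet (block s (\<lambda>x. g' (g x)))\<bar> = ln \<bar>edet (block s g')\<bar> + ln \<bar>edet (block s g)\<bar>" for s
    using nz[OF G] nz[OF G'] by (simp add: abs_mult ln_mult)
  then show ?thesis
    by (simp add: log_char_def sum.distrib distrib_left)
qed

end

section \<open>Semistability and minimal vectors for the centralizer of the grading\<close>

lemma binner_tendsto:
  assumes "\<And>x y. (\<lambda>n. B n x y) \<longlonglongrightarrow> L x y"
  shows "(\<lambda>n. binner (B n) (B n)) \<longlonglongrightarrow> binner L L"
  unfolding binner_def by (intro tendsto_sum tendsto_inner assms)

lemma oinner_tendsto:
  assumes "\<And>x. (\<lambda>n. T n x) \<longlonglongrightarrow> L x"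
  shows "(\<lambda>n. oinner (T n) (T n)) \<longlonglongrightarrow> oinner L L"
  unfolding oinner_def by (intro tendsto_sum tendsto_inner assms)

lemma tr_tendsto:
  assumes "\<And>x. (\<lambda>n. T n x) \<longlonglongrightarrow> L x"
  shows "(\<lambda>n. tr (T n)) \<longlonglongrightarrow> tr L"
  unfolding tr_def by (intro tendsto_sum tendsto_inner assms tendsto_const)

lemma norm_le_sqrt: "x \<bullet> x \<le> c \<Longrightarrow> norm x \<le> sqrt c"
  by (simp add: norm_eq_sqrt_inner)

lemma inverse_Suc_tendsto: "(\<lambda>n. 1 / real (Suc n)) \<longlonglongrightarrow> 0"
  using LIMSEQ_inverse_real_of_nat by (simp add: inverse_eq_divide)

context optimal_nilpotent
begin

lemma adapted_limit:
  assumes v: "\<And>n. adapted (v n)" and lim: "\<And>i. i \<in> Basis \<Longrightarrow> (\<lambda>n. v n i) \<longlonglongrightarrow> w i"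
  shows "adapted w"
  unfolding adapted_def oframe_def
proof (intro conjI ballI)
  fix i j :: 'a assume ij: "i \<in> Basis" "j \<in> Basis"
  have "(\<lambda>n. v n i \<bullet> v n j) \<longlonglongrightarrow> w i \<bullet> w j"
    by (intro tendsto_inner lim ij)
  then have "(\<lambda>n. if i = j then 1 else 0) \<longlonglongrightarrow> w i \<bullet> w j"
    by (simp add: oframeD[OF adapted_frame[OF v] ij])
  then show "w i \<bullet> w j = (if i = j then 1 else 0)"
    by (simp add: LIMSEQ_const_iff)
next
  fix i :: 'a assume i: "i \<in> Basis"
  have bl: "bounded_linear D"
    using linear_diagop linear_conv_bounded_linear by blast
  show "D (w i) = e i *\<^sub>R w i"
  proof (rule LIMSEQ_unique)
    show "(\<lambda>n. D (v n i)) \<longlonglongrightarrow> D (w i)"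
      by (rule bounded_linear.tendsto[OF bl lim[OF i]])
    show "(\<lambda>n. D (v n i)) \<longlonglongrightarrow> e i *\<^sub>R w i"
      using v i tendsto_scaleR[OF tendsto_const lim[OF i]] by (simp add: adapted_def)
  qed
qed

lemma conjb_singular_coeff:
  assumes G: "graded_iso g h" and v: "adapted v" and z: "adapted z"
    and gv: "\<And>i. i \<in> Basis \<Longrightarrow> g (v i) = a i *\<^sub>R z i" and a: "\<And>i. i \<in> Basis \<Longrightarrow> 0 < a i"
    and ijk: "i \<in> Basis" "j \<in> Basis" "k \<in> Basis"
  shows "conj_bracket g h \<nu> (z i) (z j) \<bullet> z k = (a k / (a i * a j)) * (\<nu> (v i) (v j) \<bullet> v k)"
proof -
  have g: "linear g" "linear h" "\<And>x. h (g x) = x"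
    using G by (auto simp: graded_iso_def)
  have hz: "h (z i) = (1 / a i) *\<^sub>R v i" if "i \<in> Basis" for i
  proof -
    have "v i = a i *\<^sub>R h (z i)"
      using g(3)[of "v i"] gv[OF that] by (simp add: linear_cmul[OF g(2)])
    then show ?thesis
      using a[OF that] by simp
  qed
  have gk: "g x \<bullet> z k = a k * (x \<bullet> v k)" for x
  proof -
    have "g x \<bullet> z k = (\<Sum>l\<in>Basis. (x \<bullet> v l) * (a l * (z l \<bullet> z k)))"
      by (subst oframe_linear_expand[OF adapted_frame[OF v] g(1)]) (simp add: inner_sum_left gv mult.assoc)
    also have "\<dots> = (\<Sum>l\<in>Basis. if l = k then a k * (x \<bullet> v k) else 0)"
      by (rule sum.cong) (auto simp: oframeD[OF adapted_frame[OF z] _ ijk(3)])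
    finally show ?thesis
      using ijk by simp
  qed
  show ?thesis
    by (simp add: conj_bracket_def hz ijk gk bilinear_lmul[OF bilinear_nu] bilinear_rmul[OF bilinear_nu])
qed

text \<open>If \<open>g\<^sub>n \<nu>\<close> tended to \<open>0\<close> with \<open>log_char g\<^sub>n = 0\<close>, then the logarithms of the singular values of
  \<open>g\<^sub>n\<close> would be a direction, in the limit of the singular frames, in which the cost decreases.\<close>

lemma semistable:
  assumes neg: "(\<Sum>i\<in>Basis. e i - 1) < 0"
  obtains \<epsilon> where "0 < \<epsilon>"
    "\<And>g h. graded_iso g h \<Longrightarrow> log_char g = 0 \<Longrightarrow> \<epsilon> \<le> binner (conj_bracket g h \<nu>) (conj_bracket g h \<nu>)"
proof (rule ccontr)
  assume no: "\<not> thesis"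
  have "\<exists>g h. graded_iso g h \<and> log_char g = 0 \<and> binner (conj_bracket g h \<nu>) (conj_bracket g h \<nu>) < 1 / real (Suc n)" for n
  proof (rule ccontr)
    assume "\<nexists>g h. graded_iso g h \<and> log_char g = 0 \<and> binner (conj_bracket g h \<nu>) (conj_bracket g h \<nu>) < 1 / real (Suc n)"
    then show False
      using no that[of "1 / real (Suc n)"] by (force simp: not_less)
  qed
  then obtain g h where G: "\<And>n. graded_iso (g n) (h n)" and chi: "\<And>n. log_char (g n) = 0"
    and small: "\<And>n. binner (conj_bracket (g n) (h n) \<nu>) (conj_bracket (g n) (h n) \<nu>) < 1 / real (Suc n)"
    by metis
  have "\<exists>v z a. adapted v \<and> adapted z \<and> (\<forall>i\<in>Basis. g n (v i) = a i *\<^sub>R z i \<and> 0 < a i)" for n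
    using singular_frames[OF G[of n]] by metis
  then obtain v z a where v: "\<And>n. adapted (v n)" and z: "\<And>n. adapted (z n)"
    and gv': "\<And>n. \<forall>i\<in>Basis. g n (v n i) = a n i *\<^sub>R z n i \<and> 0 < a n i"
    by metis
  then have gv: "\<And>n i. i \<in> Basis \<Longrightarrow> g n (v n i) = a n i *\<^sub>R z n i" and a: "\<And>n i. i \<in> Basis \<Longrightarrow> 0 < a n i"
    by blast+
  have "bounded (range (\<lambda>n. v n i))" if "i \<in> Basis" for i
    using oframe_norm[OF adapted_frame[OF v] that] by (intro boundedI[of _ 1]) auto
  then have "\<exists>l r. strict_mono (r :: nat \<Rightarrow> nat) \<and> (\<forall>i\<in>Basis. (\<lambda>n. v (r n) i) \<longlonglongrightarrow> l i)"
    using bounded_family_convergent_subsequence[OF finite_Basis] by blast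
  then obtain w and r :: "nat \<Rightarrow> nat" where r: "strict_mono r"
    and lim: "\<And>i. i \<in> Basis \<Longrightarrow> (\<lambda>n. v (r n) i) \<longlonglongrightarrow> w i"
    by blast
  have w: "adapted w"
    by (rule adapted_limit[OF v lim])
  let ?T = "{(i, j, k). i \<in> Basis \<and> j \<in> Basis \<and> k \<in> (Basis :: 'a set) \<and> \<nu> (w i) (w j) \<bullet> w k \<noteq> 0}"
  have finT: "finite ?T"
    by (rule finite_subset[of _ "Basis \<times> Basis \<times> Basis"]) auto
  \<comment> \<open>A coefficient that is nonzero in the limit frame stays away from 0, while the
    transformed bracket becomes arbitrarily small. So the factor \<open>a k / (a i * a j)\<close>
    between them eventually drops below \<open>exp (- 1)\<close>.\<close>
  have ev: "\<forall>\<^sub>F n in sequentially. ln (a (r n) k) - ln (a (r n) i) - ln (a (r n) j) \<le> - 1"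
    if ijk: "i \<in> Basis" "j \<in> Basis" "k \<in> Basis" and nz: "\<nu> (w i) (w j) \<bullet> w k \<noteq> 0" for i j k
  proof -
    define c where "c = (\<nu> (w i) (w j) \<bullet> w k)\<^sup>2"
    define cn where "cn n = (\<nu> (v (r n) i) (v (r n) j) \<bullet> v (r n) k)\<^sup>2" for n
    have c: "0 < c"
      using nz by (simp add: c_def)
    have "(\<lambda>n. \<nu> (v (r n) i) (v (r n) j)) \<longlonglongrightarrow> \<nu> (w i) (w j)"
      by (rule bilinear_tendsto[of "\<lambda>_. \<nu>", OF bilinear_nu tendsto_const lim[OF ijk(1)] lim[OF ijk(2)]])
    then have "cn \<longlonglongrightarrow> c"
      unfolding cn_def[abs_def] c_def
      by (intro tendsto_power tendsto_inner lim[OF ijk(3)])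
    then have 1: "\<forall>\<^sub>F n in sequentially. c / 2 < cn n"
      by (rule order_tendstoD) (use c in simp)
    have "(\<lambda>n. 1 / real (Suc (r n))) \<longlonglongrightarrow> 0"
      using LIMSEQ_subseq_LIMSEQ[OF inverse_Suc_tendsto r] by (simp add: o_def)
    then have 2: "\<forall>\<^sub>F n in sequentially. 1 / real (Suc (r n)) < (exp (- 1))\<^sup>2 * (c / 2)"
      by (rule order_tendstoD) (use c in simp)
    from 1 2 show ?thesis
    proof eventually_elim
      case (elim n)
      let ?a = "a (r n)"
      define q where "q = ?a k / (?a i * ?a j)"
      have q: "0 < q"
        using a ijk by (simp add: q_def)
      let ?X = "conj_bracket (g (r n)) (h (r n)) \<nu> (z (r n) i) (z (r n) j)"
      have zf: "oframe (z (r n))"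
        using z by (rule adapted_frame)
      have bil: "bilinear (conj_bracket (g (r n)) (h (r n)) \<nu>)"
        using G[of "r n"] by (intro bilinear_conjb bilinear_nu) (auto simp: graded_iso_def)
      have "?X \<bullet> z (r n) k = q * (\<nu> (v (r n) i) (v (r n) j) \<bullet> v (r n) k)"
        unfolding q_def by (rule conjb_singular_coeff[OF G v z gv a ijk])
      then have "q\<^sup>2 * cn n = (?X \<bullet> z (r n) k)\<^sup>2"
        by (simp add: cn_def power_mult_distrib)
      also have "\<dots> \<le> (?X \<bullet> ?X) * (z (r n) k \<bullet> z (r n) k)"
        by (rule Cauchy_Schwarz_ineq)
      also have "\<dots> \<le> binner (conj_bracket (g (r n)) (h (r n)) \<nu>) (conj_bracket (g (r n)) (h (r n)) \<nu>)"
        using binner_le[OF zf bil ijk(1,2)] oframe_self[OF zf ijk(3)] by simp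
      also have "\<dots> < (exp (- 1))\<^sup>2 * (c / 2)"
        using small[of "r n"] elim by linarith
      finally have "q\<^sup>2 * cn n < (exp (- 1))\<^sup>2 * (c / 2)" .
      moreover have "q\<^sup>2 * (c / 2) \<le> q\<^sup>2 * cn n"
        using elim by (intro mult_left_mono) auto
      ultimately have "q\<^sup>2 * (c / 2) < (exp (- 1))\<^sup>2 * (c / 2)"
        by linarith
      then have "q\<^sup>2 < (exp (- 1))\<^sup>2"
        using c by simp
      then have "q < exp (- 1)"
        by (rule power_less_imp_less_base) simp
      then have "ln q < - 1"
        using q by (metis exp_gt_zero ln_exp ln_less_cancel_iff)
      moreover have "ln q = ln (?a k) - ln (?a i) - ln (?a j)"
        using a[OF ijk(1), of "r n"] a[OF ijk(2), of "r n"] a[OF ijk(3), of "r n"]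
        by (simp add: q_def ln_div ln_mult)
      ultimately show ?case
        by linarith
    qed
  qed
  have "\<forall>\<^sub>F n in sequentially. \<forall>(i, j, k)\<in>?T. ln (a (r n) k) - ln (a (r n) i) - ln (a (r n) j) \<le> - 1"
    by (rule eventually_ball_finite[OF finT]) (use ev in auto)
  then obtain n where n: "\<forall>(i, j, k)\<in>?T. ln (a (r n) k) - ln (a (r n) i) - ln (a (r n) j) \<le> - 1"
    by (auto simp: eventually_sequentially)
  \<comment> \<open>The logarithms satisfy the first order condition with a margin of 1, which the
    constant 1 uses up. Its contribution to the derivative of the cost is the negative sum of
    \<open>e i - 1\<close>; the logarithms contribute minus \<open>log_char\<close>, which is
    0.\<close>
  let ?x = "\<lambda>i. 1 - ln (a (r n) i)"
  have "0 \<le> (\<Sum>i\<in>Basis. (e i - 1) * ?x i)"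
  proof (rule first_order[OF _ adapted_frame[OF w] adapted_mult[OF w]])
    fix i j k :: 'a
    assume ijk: "i \<in> Basis" "j \<in> Basis" "k \<in> Basis" and eq: "e k = e i + e j" and nz: "\<mu> (w i) (w j) \<bullet> w k \<noteq> 0"
    have "(i, j, k) \<in> ?T"
      using ijk nz nu_adapted[OF w ijk] eq by simp
    from bspec[OF n this] show "?x i + ?x j \<le> ?x k"
      by simp
  qed
  also have "\<dots> = (\<Sum>i\<in>Basis. e i - 1) - log_char (g (r n))"
  proof -
    have "linear (g (r n))"
      using G by (simp add: graded_iso_def)
    then show ?thesis
      by (simp add: lchi_frames[OF v z _ gv a] sum_subtractf[symmetric] right_diff_distrib)
  qed
  finally show False
    using neg chi by simp
qed

lemma adapted_D:
  assumes v: "adapted v"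
  shows "D x = diagop v e x"
  by (rule oframe_linear_eqI[OF adapted_frame[OF v] linear_diagop linear_diagop])
     (use v in \<open>simp add: adapted_def diagop_frame\<close>)

lemma inG_diag:
  assumes v: "adapted v"
  shows "graded_iso (diagop v (\<lambda>i. exp (c i))) (diagop v (\<lambda>i. exp (- c i)))"
    and "log_char (diagop v (\<lambda>i. exp (c i))) = (\<Sum>i\<in>Basis. (e i - 1) * c i)"
proof -
  have fr: "oframe v"
    using v by (rule adapted_frame)
  show "graded_iso (diagop v (\<lambda>i. exp (c i))) (diagop v (\<lambda>i. exp (- c i)))"
    by (simp add: graded_iso_def linear_diagop adapted_D[OF v] diagop_comp[OF fr] mult.commute exp_minus diagop_one[OF fr])
  show "log_char (diagop v (\<lambda>i. exp (c i))) = (\<Sum>i\<in>Basis. (e i - 1) * c i)"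
    by (subst lchi_frames[OF v v linear_diagop, where a = "\<lambda>i. exp (c i)"]) (simp_all add: diagop_frame[OF fr])
qed

text \<open>Along a diagonal one-parameter group both squared norms are finite sums of exponentials,
  which can be differentiated term by term.\<close>

lemma diag_energy:
  assumes v: "oframe v" and B: "bilinear B" and T: "linear T"
  shows "binner (conj_bracket (diagop v (\<lambda>i. exp (c i))) (diagop v (\<lambda>i. exp (- c i))) B)
      (conj_bracket (diagop v (\<lambda>i. exp (c i))) (diagop v (\<lambda>i. exp (- c i))) B)
    = (\<Sum>i\<in>Basis. \<Sum>j\<in>Basis. \<Sum>k\<in>Basis. exp (2 * (c k - c i - c j)) * (B (v i) (v j) \<bullet> v k)\<^sup>2)" (is ?th1)
    and "oinner (conj_op (diagop v (\<lambda>i. exp (c i))) (diagop v (\<lambda>i. exp (- c i))) T)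
      (conj_op (diagop v (\<lambda>i. exp (c i))) (diagop v (\<lambda>i. exp (- c i))) T)
    = (\<Sum>i\<in>Basis. \<Sum>k\<in>Basis. exp (2 * (c k - c i)) * (T (v i) \<bullet> v k)\<^sup>2)" (is ?th2)
proof -
  let ?g = "diagop v (\<lambda>i. exp (c i))" and ?h = "diagop v (\<lambda>i. exp (- c i))"
  have gg: "?g x \<bullet> ?g x = (\<Sum>k\<in>Basis. (exp (c k))\<^sup>2 * (x \<bullet> v k)\<^sup>2)" for x
    unfolding oframe_inner[OF v, of "?g x" "?g x"]
    by (rule sum.cong) (auto simp: diagop_inner[OF v] power2_eq_square)
  have bil: "bilinear (conj_bracket ?g ?h B)"
    by (intro bilinear_conjb linear_diagop B)
  have ex: "exp (2 * (x - y - z)) = (exp (- y))\<^sup>2 * ((exp (- z))\<^sup>2 * (exp x)\<^sup>2)"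
    "exp (2 * (x - y)) = (exp (- y))\<^sup>2 * (exp x)\<^sup>2" for x y z :: real
    by (simp_all add: power2_eq_square exp_add[symmetric])
  show ?th1
    unfolding binner_frame[OF v bil bil] ex(1)
    by (intro sum.cong refl)
       (simp add: conj_bracket_def diagop_frame[OF v] bilinear_lmul[OF B] bilinear_rmul[OF B] linear_cmul[OF linear_diagop]
         gg sum_distrib_left power2_eq_square mult_ac)
  show ?th2
    unfolding oinner_frame[OF v linear_conjo[OF linear_diagop linear_diagop T] linear_conjo[OF linear_diagop linear_diagop T]] ex(2)
    by (intro sum.cong refl)
       (simp add: conj_op_def diagop_frame[OF v] linear_cmul[OF T] linear_cmul[OF linear_diagop]
         gg sum_distrib_left power2_eq_square mult_ac)
qed

lemma conj_compose:
  "conj_bracket (\<lambda>x. g (g' x)) (\<lambda>x. h' (h x)) B x y = conj_bracket g h (conj_bracket g' h' B) x y"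
  "conj_op (\<lambda>x. g (g' x)) (\<lambda>x. h' (h x)) T x = conj_op g h (conj_op g' h' T) x"
  by (simp_all add: conj_bracket_def conj_op_def)

lemma conj_id: "conj_bracket (\<lambda>x. x) (\<lambda>x. x) B = B" "conj_op (\<lambda>x. x) (\<lambda>x. x) T = T"
  by (simp_all add: fun_eq_iff conj_bracket_def conj_op_def)

text \<open>The pair of \<open>\<nu>\<close> and \<open>A\<close> is moved by the centralizer of
  \<open>D\<close> under the constraint \<open>log_char g = 0\<close>, and \<open>\<omega>\<close>,
  \<open>T\<close> is a shortest pair in the closure of its orbit. The final equation is criticality
  in the symmetric directions, that is, the moment map equation with multiplier
  \<open>\<kappa>\<close>. Lie axioms, derivations and the trace of \<open>(D - 1) A\<close> pass to
  the limit. The derivation is carried along to control this trace; \<open>A = 0\<close> leaves the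
  bracket alone.\<close>

lemma minimal_vector:
  assumes neg: "(\<Sum>i\<in>Basis. e i - 1) < 0"
    and A: "derivation \<nu> A" "\<And>x. D (A x) = A (D x)"
  obtains \<omega> T \<kappa> where "nil_lie K \<omega>" "derivation \<omega> D" "derivation \<omega> T" "\<forall>x. D (T x) = T (D x)"
    "tr (\<lambda>x. D (T x) - T x) = tr (\<lambda>x. D (A x) - A x)" "(\<forall>x. A x = 0) \<longrightarrow> (\<forall>x. T x = 0)" "0 < \<kappa>"
    "\<forall>Y. linear Y \<longrightarrow> (\<forall>x y. Y x \<bullet> y = x \<bullet> Y y) \<longrightarrow> (\<forall>x. D (Y x) = Y (D x)) \<longrightarrow>
       binner (act Y \<omega>) \<omega> + oinner (\<lambda>x. Y (T x) - T (Y x)) T = \<kappa> * tr (\<lambda>x. D (Y x) - Y x)"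
proof -
  have linA: "linear A"
    using A by (simp add: derivation_def)
  define E where "E g h B T = binner (conj_bracket g h B) (conj_bracket g h B) + oinner (conj_op g h T) (conj_op g h T)"
    for g h and B :: "'a \<Rightarrow> 'a \<Rightarrow> 'a" and T :: "'a \<Rightarrow> 'a"
  have E0: "0 \<le> E g h B T" for g h B T
    by (simp add: E_def binner_nonneg oinner_nonneg)
  let ?S = "{E g h \<nu> A | g h. graded_iso g h \<and> log_char g = 0}"
  define m where "m = Inf ?S"
  have id: "graded_iso (\<lambda>x. x) (\<lambda>x. x)" "log_char (\<lambda>x. x) = 0"
    using lchi_frames[OF adapted_u adapted_u linear_ident, of "\<lambda>_. 1"] by (simp_all add: graded_iso_def linear_ident)
  have ne: "?S \<noteq> {}"
    using id by blast
  have bdd: "bdd_below ?S"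
    using E0 by (intro bdd_belowI[of _ 0]) auto
  have mle: "m \<le> E g h \<nu> A" if "graded_iso g h" "log_char g = 0" for g h
    unfolding m_def using that by (intro cInf_lower[OF _ bdd]) blast
  have "\<exists>g h. graded_iso g h \<and> log_char g = 0 \<and> E g h \<nu> A < m + 1 / real (Suc n)" for n
  proof -
    have "m < m + 1 / real (Suc n)" by simp
    then obtain c where "c \<in> ?S" "c < m + 1 / real (Suc n)"
      unfolding m_def using cInf_less_iff[OF ne bdd] by blast
    then show ?thesis by blast
  qed
  then obtain g h where G: "\<And>n. graded_iso (g n) (h n)" and chi: "\<And>n. log_char (g n) = 0"
    and cost: "\<And>n. E (g n) (h n) \<nu> A < m + 1 / real (Suc n)"
    by metis
  define Bn where "Bn n = conj_bracket (g n) (h n) \<nu>" for n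
  define Tn where "Tn n = conj_op (g n) (h n) A" for n
  have gh: "linear (g n)" "linear (h n)" "h n (g n x) = x" "g n (h n x) = x" "g n (D x) = D (g n x)" for n x
    using G[of n] by (auto simp: graded_iso_def)
  have bilB: "bilinear (Bn n)" and linT: "linear (Tn n)" for n
    unfolding Bn_def Tn_def by (intro bilinear_conjb linear_conjo gh bilinear_nu linA)+
  have bE: "binner (Bn n) (Bn n) \<le> m + 1" "oinner (Tn n) (Tn n) \<le> m + 1" for n
  proof -
    have "1 / real (Suc n) \<le> 1" by simp
    then have "binner (Bn n) (Bn n) + oinner (Tn n) (Tn n) \<le> m + 1"
      using cost[of n] unfolding E_def Bn_def Tn_def by linarith
    then show "binner (Bn n) (Bn n) \<le> m + 1" "oinner (Tn n) (Tn n) \<le> m + 1"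
      using binner_nonneg[of "Bn n"] oinner_nonneg[of "Tn n"] by linarith+
  qed
  have "bounded (range (\<lambda>n. (Bn n (fst p) (snd p), Tn n (fst p))))" if p: "p \<in> Basis \<times> Basis" for p
  proof (rule boundedI)
    fix x assume "x \<in> range (\<lambda>n. (Bn n (fst p) (snd p), Tn n (fst p)))"
    then obtain n where x: "x = (Bn n (fst p) (snd p), Tn n (fst p))"
      by blast
    have "Bn n (fst p) (snd p) \<bullet> Bn n (fst p) (snd p) \<le> m + 1"
      using binner_le[OF oframe_id bilB, of "fst p" "snd p" n] p bE(1)[of n] by auto
    moreover have "Tn n (fst p) \<bullet> Tn n (fst p) \<le> oinner (Tn n) (Tn n)"
      unfolding oinner_def using p by (intro member_le_sum) auto
    then have "Tn n (fst p) \<bullet> Tn n (fst p) \<le> m + 1"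
      using bE(2)[of n] by linarith
    ultimately show "norm x \<le> sqrt (m + 1) + sqrt (m + 1)"
      unfolding x using norm_Pair_le norm_le_sqrt by (meson add_mono order_trans)
  qed
  then have "\<exists>l r. strict_mono (r :: nat \<Rightarrow> nat) \<and>
      (\<forall>p\<in>Basis \<times> Basis. (\<lambda>n. (Bn (r n) (fst p) (snd p), Tn (r n) (fst p))) \<longlonglongrightarrow> l p)"
    using bounded_family_convergent_subsequence[of "Basis \<times> Basis" "\<lambda>n p. (Bn n (fst p) (snd p), Tn n (fst p))"] by simp
  then obtain l and r :: "nat \<Rightarrow> nat" where r: "strict_mono r"
    and lim: "\<And>p. p \<in> Basis \<times> Basis \<Longrightarrow> (\<lambda>n. (Bn (r n) (fst p) (snd p), Tn (r n) (fst p))) \<longlonglongrightarrow> l p"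
    by blast
  define \<omega> where "\<omega> x y = (\<Sum>i\<in>Basis. \<Sum>j\<in>Basis. ((x \<bullet> i) * (y \<bullet> j)) *\<^sub>R fst (l (i, j)))" for x y :: 'a
  define T where "T x = (\<Sum>i\<in>Basis. (x \<bullet> i) *\<^sub>R snd (l (i, i)))" for x :: 'a
  have limB: "(\<lambda>n. Bn (r n) x y) \<longlonglongrightarrow> \<omega> x y" for x y
  proof -
    have "(\<lambda>n. Bn (r n) i j) \<longlonglongrightarrow> fst (l (i, j))" if "i \<in> Basis" "j \<in> Basis" for i j
      using tendsto_fst[OF lim[of "(i, j)"]] that by simp
    then have "(\<lambda>n. \<Sum>i\<in>Basis. \<Sum>j\<in>Basis. ((x \<bullet> i) * (y \<bullet> j)) *\<^sub>R Bn (r n) i j) \<longlonglongrightarrow> \<omega> x y"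
      unfolding \<omega>_def by (intro tendsto_sum tendsto_scaleR tendsto_const)
    then show ?thesis
      by (simp add: bilinear_expand[OF bilB oframe_id oframe_id, symmetric])
  qed
  have limT: "(\<lambda>n. Tn (r n) x) \<longlonglongrightarrow> T x" for x
  proof -
    have "(\<lambda>n. Tn (r n) i) \<longlonglongrightarrow> snd (l (i, i))" if "i \<in> Basis" for i
      using tendsto_snd[OF lim[of "(i, i)"]] that by simp
    then have "(\<lambda>n. \<Sum>i\<in>Basis. (x \<bullet> i) *\<^sub>R Tn (r n) i) \<longlonglongrightarrow> T x"
      unfolding T_def by (intro tendsto_sum tendsto_scaleR tendsto_const)
    then show ?thesis
      by (simp add: oframe_linear_expand[OF oframe_id linT, symmetric])
  qed
  have nil\<omega>: "nil_lie K \<omega>"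
    by (rule nil_lie_limit[OF _ limB]) (unfold Bn_def, intro nil_lie_conjb gh nil_nu)
  have bil\<omega>: "bilinear \<omega>"
    using nil\<omega> by (simp add: nil_lie_def)
  have conjD: "conj_op (g n) (h n) D = D" for n
    by (rule ext) (simp add: conj_op_def gh)
  have derD: "derivation \<omega> D"
  proof (rule derivation_limit[OF bilB limB])
    show "derivation (Bn (r n)) D" for n
      using derivation_conj[OF gh(1-3) D_derivation, of "r n"] by (simp add: Bn_def conjD)
  qed simp
  have derT: "derivation \<omega> T"
    by (rule derivation_limit[OF bilB limB _ limT]) (unfold Bn_def Tn_def, intro derivation_conj gh A)
  have linTl: "linear T"
    using derT by (simp add: derivation_def)
  have DTn: "D (Tn n x) = Tn n (D x)" for n x
    by (simp add: Tn_def conj_op_def gh(5)[symmetric] A(2) inG_D[OF G])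
  have bl: "bounded_linear D"
    using linear_diagop linear_conv_bounded_linear by blast
  have DT: "D (T x) = T (D x)" for x
  proof (rule LIMSEQ_unique)
    show "(\<lambda>n. D (Tn (r n) x)) \<longlonglongrightarrow> D (T x)"
      by (rule bounded_linear.tendsto[OF bl limT])
    show "(\<lambda>n. D (Tn (r n) x)) \<longlonglongrightarrow> T (D x)"
      unfolding DTn by (rule limT)
  qed
  have "tr (\<lambda>x. D (Tn n x) - Tn n x) = tr (\<lambda>x. D (A x) - A x)" for n
  proof -
    have "linear (\<lambda>x. D (A (h n x)) - A (h n x))"
      using linear_compose[OF linear_compose[OF gh(2) linA] linear_diagop] linear_compose[OF gh(2) linA]
      by (intro linear_compose_sub) (simp_all add: o_def)
    from tr_comm[OF gh(1) this]
    have "tr (\<lambda>x. g n (D (A (h n x)) - A (h n x))) = tr (\<lambda>x. D (A x) - A x)"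
      by (simp add: gh)
    then show ?thesis
      by (simp add: Tn_def conj_op_def gh(5)[symmetric] linear_diff[OF gh(1)])
  qed
  moreover have "(\<lambda>n. tr (\<lambda>x. D (Tn (r n) x) - Tn (r n) x)) \<longlonglongrightarrow> tr (\<lambda>x. D (T x) - T x)"
    by (intro tr_tendsto tendsto_diff bounded_linear.tendsto[OF bl] limT)
  ultimately have trT: "tr (\<lambda>x. D (T x) - T x) = tr (\<lambda>x. D (A x) - A x)"
    by (simp add: LIMSEQ_const_iff)
  have T0: "T x = 0" if "\<And>x. A x = 0" for x
    using limT[of x] that by (simp add: Tn_def conj_op_def linear_0[OF gh(1)] LIMSEQ_const_iff)
  \<comment> \<open>The limit pair is minimal on its own constrained orbit: composing
    \<open>g'\<close> with \<open>g n\<close> keeps the constraint, so \<open>m\<close> bounds the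
    energy before the limit.\<close>
  have Emin: "m \<le> E g' h' \<omega> T" if G': "graded_iso g' h'" "log_char g' = 0" for g' h'
  proof -
    have lin': "bounded_linear g'"
      using G' linear_conv_bounded_linear by (auto simp: graded_iso_def)
    have lim: "(\<lambda>n. E g' h' (Bn (r n)) (Tn (r n))) \<longlonglongrightarrow> E g' h' \<omega> T"
      unfolding E_def conj_bracket_def conj_op_def
      by (intro tendsto_add binner_tendsto oinner_tendsto bounded_linear.tendsto[OF lin'] limB limT)
    have bound: "m \<le> E g' h' (Bn n) (Tn n)" for n
    proof -
      have "m \<le> E (\<lambda>x. g' (g n x)) (\<lambda>x. h n (h' x)) \<nu> A"
        by (rule mle) (use inG_compose[OF G G'(1)] lchi_compose[OF G G'(1)] chi G'(2) in auto)
      also have "\<dots> = E g' h' (Bn n) (Tn n)"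
        by (simp add: E_def Bn_def Tn_def conj_compose[abs_def])
      finally show ?thesis .
    qed
    show ?thesis
      by (rule LIMSEQ_le_const[OF lim]) (use bound in blast)
  qed
  have Em: "E (\<lambda>x. x) (\<lambda>x. x) \<omega> T \<le> m"
  proof -
    have 1: "(\<lambda>n. binner (Bn (r n)) (Bn (r n)) + oinner (Tn (r n)) (Tn (r n))) \<longlonglongrightarrow> binner \<omega> \<omega> + oinner T T"
      by (intro tendsto_add binner_tendsto oinner_tendsto limB limT)
    have "(\<lambda>n. m + 1 / real (Suc (r n))) \<longlonglongrightarrow> m + 0"
      using LIMSEQ_subseq_LIMSEQ[OF inverse_Suc_tendsto r] by (intro tendsto_intros) (simp add: o_def)
    from LIMSEQ_le[OF 1 this] have "binner \<omega> \<omega> + oinner T T \<le> m + 0"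
      using cost unfolding E_def Bn_def Tn_def by (meson less_imp_le)
    then show ?thesis
      by (simp add: E_def conj_id)
  qed
  \<comment> \<open>Semistability keeps the limit bracket away from 0; this is what makes the
    multiplier positive.\<close>
  obtain \<epsilon> where \<epsilon>: "0 < \<epsilon>" "\<And>g h. graded_iso g h \<Longrightarrow> log_char g = 0 \<Longrightarrow> \<epsilon> \<le> binner (conj_bracket g h \<nu>) (conj_bracket g h \<nu>)"
    using semistable[OF neg] by blast
  have "\<epsilon> \<le> binner \<omega> \<omega>"
    by (rule LIMSEQ_le_const[OF binner_tendsto[OF limB]]) (use \<epsilon>(2)[OF G chi] in \<open>auto simp: Bn_def\<close>)
  then have pos: "0 < binner \<omega> \<omega>"
    using \<epsilon> by linarith
  define \<Sigma> where "\<Sigma> = (\<Sum>i\<in>Basis. e i - 1)"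
  \<comment> \<open>The value forced by the direction \<open>Y = id\<close>: there the bracket
    contributes \<open>- binner \<omega> \<omega>\<close>, the operator part vanishes, and the trace
    is \<open>\<Sigma>\<close>.\<close>
  define \<kappa> where "\<kappa> = binner \<omega> \<omega> / (- \<Sigma>)"
  have \<kappa>: "0 < \<kappa>"
    using pos neg by (simp add: \<kappa>_def \<Sigma>_def divide_pos_neg)
  have main: "binner (act Y \<omega>) \<omega> + oinner (\<lambda>x. Y (T x) - T (Y x)) T = \<kappa> * tr (\<lambda>x. D (Y x) - Y x)"
    if Y: "linear Y" "\<And>x y. Y x \<bullet> y = x \<bullet> Y y" "\<And>x. D (Y x) = Y (D x)" for Y
  proof -
    obtain v y where v: "adapted v" and Yv: "\<And>i. i \<in> Basis \<Longrightarrow> Y (v i) = y i *\<^sub>R v i"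
      using adapted_eigenframe[OF Y] by metis
    have fr: "oframe v"
      using v by (rule adapted_frame)
    \<comment> \<open>Subtracting this multiple of the identity makes the direction tangent to the
      constraint; it is possible since \<open>\<Sigma>\<close> is nonzero.\<close>
    define c0 where "c0 = (\<Sum>i\<in>Basis. (e i - 1) * y i) / \<Sigma>"
    have c0: "(\<Sum>i\<in>Basis. (e i - 1) * y i) = c0 * \<Sigma>"
      using neg by (simp add: c0_def \<Sigma>_def)
    define y' where "y' i = y i - c0" for i
    have y'0: "(\<Sum>i\<in>Basis. (e i - 1) * y' i) = 0"
    proof -
      have "(\<Sum>i\<in>Basis. (e i - 1) * y' i) = (\<Sum>i\<in>Basis. (e i - 1) * y i) - \<Sigma> * c0"
        unfolding \<Sigma>_def sum_distrib_right sum_subtractf[symmetric]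
        by (rule sum.cong) (auto simp: y'_def algebra_simps)
      then show ?thesis
        by (simp add: c0)
    qed
    define \<phi> where "\<phi> t = (\<Sum>i\<in>Basis. \<Sum>j\<in>Basis. \<Sum>k\<in>Basis. exp (2 * (t * y' k - t * y' i - t * y' j)) * (\<omega> (v i) (v j) \<bullet> v k)\<^sup>2)
      + (\<Sum>i\<in>Basis. \<Sum>k\<in>Basis. exp (2 * (t * y' k - t * y' i)) * (T (v i) \<bullet> v k)\<^sup>2)" for t
    have \<phi>E: "\<phi> t = E (diagop v (\<lambda>i. exp (t * y' i))) (diagop v (\<lambda>i. exp (- (t * y' i)))) \<omega> T" for t
      unfolding E_def \<phi>_def diag_energy[OF fr bil\<omega> linTl] ..
    have "\<phi> 0 \<le> \<phi> t" for t
    proof -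
      have "diagop v (\<lambda>_. 1) = (\<lambda>x. x)"
        by (rule ext) (rule diagop_one[OF fr])
      then have "\<phi> 0 = E (\<lambda>x. x) (\<lambda>x. x) \<omega> T"
        by (simp add: \<phi>E)
      also have "\<dots> \<le> m"
        by (rule Em)
      also have "m \<le> \<phi> t"
        unfolding \<phi>E
      proof (rule Emin[OF inG_diag(1)[OF v]])
        have "(\<Sum>i\<in>Basis. (e i - 1) * (t * y' i)) = t * (\<Sum>i\<in>Basis. (e i - 1) * y' i)"
          by (simp add: sum_distrib_left mult_ac)
        then show "log_char (diagop v (\<lambda>i. exp (t * y' i))) = 0"
          using y'0 by (simp add: inG_diag(2)[OF v])
      qed
      finally show ?thesis .
    qed
    moreover have "(\<phi> has_field_derivative
        ((\<Sum>i\<in>Basis. \<Sum>j\<in>Basis. \<Sum>k\<in>Basis. 2 * (y' k - y' i - y' j) * (\<omega> (v i) (v j) \<bullet> v k)\<^sup>2)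
        + (\<Sum>i\<in>Basis. \<Sum>k\<in>Basis. 2 * (y' k - y' i) * (T (v i) \<bullet> v k)\<^sup>2))) (at 0)"
      unfolding \<phi>_def
      by (intro DERIV_add DERIV_sum) (auto intro!: derivative_eq_intros simp: algebra_simps)
    ultimately have crit: "(\<Sum>i\<in>Basis. \<Sum>j\<in>Basis. \<Sum>k\<in>Basis. 2 * (y' k - y' i - y' j) * (\<omega> (v i) (v j) \<bullet> v k)\<^sup>2)
        + (\<Sum>i\<in>Basis. \<Sum>k\<in>Basis. 2 * (y' k - y' i) * (T (v i) \<bullet> v k)\<^sup>2) = 0"
      by (intro DERIV_local_min[where d=1]) auto
    have bw: "binner (act Y \<omega>) \<omega> = (\<Sum>i\<in>Basis. \<Sum>j\<in>Basis. \<Sum>k\<in>Basis. (y k - y i - y j) * (\<omega> (v i) (v j) \<bullet> v k)\<^sup>2)"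
      unfolding binner_frame[OF fr bilinear_act[OF Y(1) bil\<omega>] bil\<omega>]
    proof (intro sum.cong refl)
      fix i j :: 'a assume ij: "i \<in> Basis" "j \<in> Basis"
      have "act Y \<omega> (v i) (v j) \<bullet> v k = (y k - y i - y j) * (\<omega> (v i) (v j) \<bullet> v k)" if "k \<in> Basis" for k
        using that ij
        by (simp add: act_def inner_diff_left Y(2) Yv bilinear_lmul[OF bil\<omega>] bilinear_rmul[OF bil\<omega>] algebra_simps)
      then show "act Y \<omega> (v i) (v j) \<bullet> \<omega> (v i) (v j) = (\<Sum>k\<in>Basis. (y k - y i - y j) * (\<omega> (v i) (v j) \<bullet> v k)\<^sup>2)"
        unfolding oframe_inner[OF fr, of "act Y \<omega> (v i) (v j)" "\<omega> (v i) (v j)"]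
        by (simp add: power2_eq_square mult_ac)
    qed
    have linYT: "linear (\<lambda>x. Y (T x) - T (Y x))"
      using linear_compose[OF linTl Y(1)] linear_compose[OF Y(1) linTl] by (intro linear_compose_sub) (simp_all add: o_def)
    have oT: "oinner (\<lambda>x. Y (T x) - T (Y x)) T = (\<Sum>i\<in>Basis. \<Sum>k\<in>Basis. (y k - y i) * (T (v i) \<bullet> v k)\<^sup>2)"
      unfolding oinner_frame[OF fr linYT linTl]
    proof (intro sum.cong refl)
      fix i :: 'a assume i: "i \<in> Basis"
      have "(Y (T (v i)) - T (Y (v i))) \<bullet> v k = (y k - y i) * (T (v i) \<bullet> v k)" if "k \<in> Basis" for k
        using that i by (simp add: inner_diff_left Y(2) Yv linear_cmul[OF linTl] algebra_simps)
      then show "(Y (T (v i)) - T (Y (v i))) \<bullet> T (v i) = (\<Sum>k\<in>Basis. (y k - y i) * (T (v i) \<bullet> v k)\<^sup>2)"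
        unfolding oframe_inner[OF fr, of "Y (T (v i)) - T (Y (v i))" "T (v i)"]
        by (simp add: power2_eq_square mult_ac)
    qed
    have ww: "binner \<omega> \<omega> = (\<Sum>i\<in>Basis. \<Sum>j\<in>Basis. \<Sum>k\<in>Basis. (\<omega> (v i) (v j) \<bullet> v k)\<^sup>2)"
      unfolding binner_frame[OF fr bil\<omega> bil\<omega>]
      by (intro sum.cong refl) (subst oframe_inner[OF fr], simp add: power2_eq_square)
    have "(\<Sum>i\<in>Basis. \<Sum>j\<in>Basis. \<Sum>k\<in>Basis. 2 * (y' k - y' i - y' j) * (\<omega> (v i) (v j) \<bullet> v k)\<^sup>2)
        = 2 * binner (act Y \<omega>) \<omega> + 2 * c0 * binner \<omega> \<omega>"
      unfolding bw ww sum_distrib_left sum.distrib[symmetric]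
      by (intro sum.cong refl) (simp add: y'_def algebra_simps)
    moreover have "(\<Sum>i\<in>Basis. \<Sum>k\<in>Basis. 2 * (y' k - y' i) * (T (v i) \<bullet> v k)\<^sup>2)
        = 2 * oinner (\<lambda>x. Y (T x) - T (Y x)) T"
      unfolding oT sum_distrib_left by (intro sum.cong refl) (simp add: y'_def algebra_simps)
    ultimately have L: "binner (act Y \<omega>) \<omega> + oinner (\<lambda>x. Y (T x) - T (Y x)) T = - c0 * binner \<omega> \<omega>"
      using crit by linarith
    have linDY: "linear (\<lambda>x. D (Y x) - Y x)"
      using linear_compose[OF Y(1) linear_diagop] by (intro linear_compose_sub Y(1)) (simp add: o_def)
    have "tr (\<lambda>x. D (Y x) - Y x) = (\<Sum>i\<in>Basis. (e i - 1) * y i)"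
      unfolding tr_frame[OF fr linDY]
      using v by (intro sum.cong refl)
        (simp add: Yv adapted_def linear_cmul[OF linear_diagop] inner_diff_left oframe_self[OF fr] algebra_simps)
    then show ?thesis
      using neg by (simp add: L c0 \<kappa>_def \<Sigma>_def)
  qed
  show thesis
  proof (rule that[OF nil\<omega> derD derT _ trT _ \<kappa>])
    show "\<forall>x. D (T x) = T (D x)"
      using DT by blast
    show "(\<forall>x. A x = 0) \<longrightarrow> (\<forall>x. T x = 0)"
      using T0 by blast
    show "\<forall>Y. linear Y \<longrightarrow> (\<forall>x y. Y x \<bullet> y = x \<bullet> Y y) \<longrightarrow> (\<forall>x. D (Y x) = Y (D x)) \<longrightarrow>
       binner (act Y \<omega>) \<omega> + oinner (\<lambda>x. Y (T x) - T (Y x)) T = \<kappa> * tr (\<lambda>x. D (Y x) - Y x)"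
      using main by blast
  qed
qed

lemma sum_weights: "(\<Sum>i\<in>Basis. e i - 1) = - frame_cost e"
proof -
  have "frame_cost e = (\<Sum>i\<in>Basis. (e i)\<^sup>2) - 2 * (\<Sum>i\<in>Basis. e i) + (\<Sum>i\<in>(Basis::'a set). 1)"
    unfolding frame_cost_def sum_distrib_left sum.distrib[symmetric] sum_subtractf[symmetric]
    by (rule sum.cong) (auto simp: power2_eq_square algebra_simps)
  then show ?thesis
    by (simp add: sum_sq sum_subtractf)
qed

text \<open>Since \<open>tr (D - 1)\<close> is minus the cost, either it is negative and
  semistability is available, or \<open>D\<close> is the identity and the claims about
  \<open>D\<close> are immediate.\<close>

lemma weights_cases:
  obtains "(\<Sum>i\<in>Basis. e i - 1) < 0" | "\<And>i. i \<in> Basis \<Longrightarrow> e i = 1"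
proof (cases "frame_cost e = 0")
  case True
  then have "\<forall>i\<in>Basis. (e i - 1)\<^sup>2 = 0"
    unfolding frame_cost_def by (subst sum_nonneg_eq_0_iff[symmetric]) auto
  then show thesis
    using that(2) by simp
next
  case False
  moreover have "0 \<le> frame_cost e"
    by (simp add: frame_cost_def sum_nonneg)
  ultimately show thesis
    using that(1) by (simp add: sum_weights)
qed

lemma adjoint_commute_D:
  assumes T: "linear T" and comm: "\<And>x. D (T x) = T (D x)"
  shows "D (adjoint T x) = adjoint T (D x)"
proof (rule vector_eq_rdot[THEN iffD1], intro allI)
  fix y
  have "D (adjoint T x) \<bullet> y = x \<bullet> T (D y)"
    by (simp add: diagop_symmetric adjoint_inner_left[OF T])
  also have "\<dots> = adjoint T (D x) \<bullet> y"
    by (simp add: comm[symmetric] diagop_symmetric[symmetric] adjoint_inner_left[OF T])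
  finally show "D (adjoint T x) \<bullet> y = adjoint T (D x) \<bullet> y" .
qed

text \<open>The moment equation is tested with \<open>Y\<close>, the sum of \<open>T\<close> and its
  adjoint. The bracket term vanishes because \<open>T\<close> is a derivation and the action is
  compatible with adjoints; the operator term is the trace of a commutator. As
  \<open>\<kappa>\<close> is positive, the trace of \<open>(D - 1) Y\<close>, twice that of
  \<open>(D - 1) T\<close>, is 0.\<close>

lemma derivation_trace:
  assumes A: "derivation \<mu> A"
  shows "(\<Sum>i\<in>Basis. (e i - 1) * (A (u i) \<bullet> u i)) = 0"
proof (cases rule: weights_cases)
  case 1
  obtain A0 where A0: "derivation \<nu> A0" "\<forall>x. D (A0 x) = A0 (D x)"
    and sum: "(\<Sum>i\<in>Basis. (e i - 1) * (A0 (u i) \<bullet> u i)) = (\<Sum>i\<in>Basis. (e i - 1) * (A (u i) \<bullet> u i))"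
    by (rule graded_derivation[OF A]) (rule that)
  obtain \<omega> T \<kappa> where \<omega>: "nil_lie K \<omega>" and derD: "derivation \<omega> D"
    and T: "derivation \<omega> T" and DT: "\<forall>x. D (T x) = T (D x)"
    and tr: "tr (\<lambda>x. D (T x) - T x) = tr (\<lambda>x. D (A0 x) - A0 x)"
    and T0: "(\<forall>x. A0 x = 0) \<longrightarrow> (\<forall>x. T x = 0)" and \<kappa>: "0 < \<kappa>"
    and main: "\<forall>Y. linear Y \<longrightarrow> (\<forall>x y. Y x \<bullet> y = x \<bullet> Y y) \<longrightarrow> (\<forall>x. D (Y x) = Y (D x)) \<longrightarrow>
       binner (act Y \<omega>) \<omega> + oinner (\<lambda>x. Y (T x) - T (Y x)) T = \<kappa> * tr (\<lambda>x. D (Y x) - Y x)"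
    by (rule minimal_vector[OF 1 A0(1) spec[OF A0(2)]]) (rule that)
  have bil: "bilinear \<omega>" and lin: "linear T" and actT: "act T \<omega> x y = 0" for x y
    using \<omega> T by (auto simp: nil_lie_def derivation_act)
  let ?S = "adjoint T"
  have linS: "linear ?S"
    by (rule adjoint_linear[OF lin])
  define Y where "Y x = 1 *\<^sub>R T x + 1 *\<^sub>R ?S x" for x
  have Y: "linear Y" "\<And>x y. Y x \<bullet> y = x \<bullet> Y y" "\<And>x. D (Y x) = Y (D x)"
    unfolding Y_def using lin linS
    by (auto simp: linear_compose_add inner_add_left inner_add_right adjoint_works[OF lin] adjoint_inner_left[OF lin]
        linear_add[OF linear_diagop] spec[OF DT] adjoint_commute_D[OF lin spec[OF DT]])
  have "binner (act T \<omega>) \<omega> = 0"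
    by (simp add: binner_def actT)
  moreover have "binner (act ?S \<omega>) \<omega> = 0"
    using binner_act_adjoint[OF lin bil bil] \<open>binner (act T \<omega>) \<omega> = 0\<close> by (simp add: binner_commute)
  ultimately have b0: "binner (act Y \<omega>) \<omega> = 0"
    unfolding Y_def act_linear_comb[OF bil, abs_def] by (simp add: binner_def inner_add_left sum.distrib)
  have linTT: "linear (\<lambda>x. ?S (T x))"
    using linear_compose[OF lin linS] by (simp add: o_def)
  have linC: "linear (\<lambda>x. Y (T x) - T (Y x))"
    using linear_compose[OF lin Y(1)] linear_compose[OF Y(1) lin] by (intro linear_compose_sub) (simp_all add: o_def)
  have "oinner (\<lambda>x. Y (T x) - T (Y x)) T = tr (\<lambda>x. ?S (Y (T x) - T (Y x)))"
    by (rule oinner_tr[OF linC lin])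
  also have "\<dots> = tr (\<lambda>x. ?S (?S (T x)) - ?S (T (?S x)))"
    by (rule arg_cong[where f = tr]) (auto simp: Y_def linear_add[OF lin] linear_add[OF linS] linear_diff[OF linS])
  also have "\<dots> = 0"
    unfolding tr_diff using tr_comm[OF linS linTT] by simp
  finally have o0: "oinner (\<lambda>x. Y (T x) - T (Y x)) T = 0" .
  have linDT: "linear (\<lambda>x. D (T x))"
    using linear_compose[OF lin linear_diagop] by (simp add: o_def)
  have "tr (\<lambda>x. D (?S x)) = tr (\<lambda>x. D (T x))"
  proof -
    have "adjoint (\<lambda>x. D (T x)) = (\<lambda>x. ?S (adjoint D x))"
      by (rule adjoint_comp_eq[OF linear_diagop lin])
    also have "adjoint D = D"
      by (rule adjoint_unique) (simp add: diagop_symmetric)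
    finally have "tr (\<lambda>x. ?S (D x)) = tr (\<lambda>x. D (T x))"
      using tr_adjoint[OF linDT] by simp
    then show ?thesis
      by (simp add: adjoint_commute_D[OF lin spec[OF DT]])
  qed
  then have "tr (\<lambda>x. D (Y x) - Y x) = 2 * tr (\<lambda>x. D (T x) - T x)"
    by (simp add: Y_def tr_diff tr_add linear_add[OF linear_diagop] tr_adjoint[OF lin])
  moreover have "binner (act Y \<omega>) \<omega> + oinner (\<lambda>x. Y (T x) - T (Y x)) T = \<kappa> * tr (\<lambda>x. D (Y x) - Y x)"
    using main Y by blast
  ultimately have "tr (\<lambda>x. D (T x) - T x) = 0"
    using b0 o0 \<kappa> by simp
  then have "tr (\<lambda>x. D (A0 x) - A0 x) = 0"
    using tr by simp
  moreover have "linear (\<lambda>x. D (A0 x) - A0 x)"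
  proof -
    have "linear A0"
      using A0(1) by (simp add: derivation_def)
    then show ?thesis
      using linear_compose[OF _ linear_diagop] by (intro linear_compose_sub) (simp_all add: o_def)
  qed
  then have "tr (\<lambda>x. D (A0 x) - A0 x) = (\<Sum>i\<in>Basis. (e i - 1) * (A0 (u i) \<bullet> u i))"
    by (simp add: tr_frame[OF frame] inner_diff_left diagop_inner[OF frame] left_diff_distrib)
  ultimately show ?thesis
    using sum by simp
qed simp

text \<open>Heber's argument: at the minimal vector, a central element \<open>X\<close> of \<open>ker D\<close> acts by a normal and
  nilpotent operator, hence trivially; testing with the projection onto \<open>X\<close> gives a contradiction.\<close>

lemma weights_pos:
  assumes nonneg: "\<And>i. i \<in> Basis \<Longrightarrow> 0 \<le> e i" and i: "i \<in> Basis"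
  shows "0 < e i"
proof (cases rule: weights_cases)
  case 1
  show ?thesis
  proof (rule ccontr)
    assume "\<not> 0 < e i"
    then have e0: "e i = 0"
      using nonneg[OF i] by simp
    have der0: "derivation \<nu> (\<lambda>x. 0)"
      by (simp add: derivation_def linear_zero bilinear_lzero[OF bilinear_nu] bilinear_rzero[OF bilinear_nu])
  obtain \<omega> T \<kappa> where \<omega>: "nil_lie K \<omega>" and derD: "derivation \<omega> D"
    and T: "derivation \<omega> T" and DT: "\<forall>x. D (T x) = T (D x)"
    and tr: "tr (\<lambda>x. D (T x) - T x) = tr (\<lambda>x. D ((0::'a)) - (0::'a))"
    and T0': "(\<forall>x::'a. (0::'a) = 0) \<longrightarrow> (\<forall>x. T x = 0)" and \<kappa>: "0 < \<kappa>"
    and main': "\<forall>Y. linear Y \<longrightarrow> (\<forall>x y. Y x \<bullet> y = x \<bullet> Y y) \<longrightarrow> (\<forall>x. D (Y x) = Y (D x)) \<longrightarrow>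
       binner (act Y \<omega>) \<omega> + oinner (\<lambda>x. Y (T x) - T (Y x)) T = \<kappa> * tr (\<lambda>x. D (Y x) - Y x)"
    proof (rule minimal_vector[OF 1 der0])
      show "D 0 = 0"
        by (rule linear_0[OF linear_diagop])
    qed (rule that)
    then have T0: "T x = 0" for x
      by simp
    have main: "binner (act Y \<omega>) \<omega> = \<kappa> * tr (\<lambda>x. D (Y x) - Y x)"
      if "linear Y" "\<And>x y. Y x \<bullet> y = x \<bullet> Y y" "\<And>x. D (Y x) = Y (D x)" for Y
      using main' that by (simp add: oinner_def T0)
    have bil: "bilinear \<omega>" and anti: "\<And>x y. \<omega> x y = - \<omega> y x"
      and jac: "\<And>x y z. \<omega> x (\<omega> y z) = \<omega> (\<omega> x y) z + \<omega> y (\<omega> x z)"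
      and nilp: "\<And>xs y. length xs = K \<Longrightarrow> foldr \<omega> xs y = 0"
      using \<omega> unfolding nil_lie_def by blast+
    have D\<omega>: "D (\<omega> x y) = \<omega> (D x) y + \<omega> x (D y)" for x y
      using derD by (simp add: derivation_def)
    \<comment> \<open>Lengths of nonzero iterated brackets inside the kernel of \<open>D\<close>.
      Nilpotency bounds them, and a longest such product is a central element \<open>X\<close> of
      the kernel.\<close>
    define P where "P n \<longleftrightarrow> (\<exists>xs y. length xs = n \<and> (\<forall>x\<in>set xs. D x = 0) \<and> D y = 0 \<and> foldr \<omega> xs y \<noteq> 0)" for n
    have "P 0"
      unfolding P_def
      by (intro exI[of _ "[]"] exI[of _ "u i"])
         (use i e0 in \<open>simp add: diagop_frame[OF frame] oframe_nonzero[OF frame]\<close>)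
    moreover have bound: "n < Suc K" if "P n" for n
    proof (rule ccontr)
      assume "\<not> n < Suc K"
      obtain xs y where xs: "length xs = n" "foldr \<omega> xs y \<noteq> 0"
        using \<open>P n\<close> by (auto simp: P_def)
      have "foldr \<omega> xs y = foldr \<omega> (take K xs) (foldr \<omega> (drop K xs) y)"
        by (metis append_take_drop_id comp_apply foldr_append)
      also have "\<dots> = 0"
        using xs \<open>\<not> n < Suc K\<close> by (intro nilp) simp
      finally show False
        using xs by simp
    qed
    ultimately obtain n where n: "P n" and max: "\<And>m. P m \<Longrightarrow> m \<le> n"
      using ex_has_greatest_nat[of P 0 "\<lambda>n. n" "Suc K"] by auto
    obtain xs y where xs: "length xs = n" "\<And>x. x \<in> set xs \<Longrightarrow> D x = 0" "D y = 0" "foldr \<omega> xs y \<noteq> 0"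
      using n by (auto simp: P_def)
    define X where "X = foldr \<omega> xs y"
    have X0: "X \<noteq> 0"
      using xs by (simp add: X_def)
    have DX: "D X = 0"
      unfolding X_def using xs(2)
      by (induction xs) (auto simp: xs(3) D\<omega> bilinear_lzero[OF bil] bilinear_rzero[OF bil])
    have center: "\<omega> X z = 0" if "D z = 0" for z
    proof (rule ccontr)
      assume "\<omega> X z \<noteq> 0"
      then have "foldr \<omega> (z # xs) y \<noteq> 0"
        using anti[of X z] by (simp add: X_def)
      then have "P (Suc n)"
        unfolding P_def by (intro exI[of _ "z # xs"] exI[of _ y]) (use xs that in auto)
      then show False
        using max[of "Suc n"] by simp
    qed
    define N where "N = \<omega> X"
    have linN: "linear N"
      unfolding N_def using bil by (simp add: bilinear_def)
    define M where "M = adjoint N"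
    have linM: "linear M"
      unfolding M_def by (rule adjoint_linear[OF linN])
    have MN: "M x \<bullet> y = x \<bullet> N y" "N x \<bullet> y = x \<bullet> M y" for x y
      by (simp_all add: M_def adjoint_inner_left[OF linN] adjoint_works[OF linN])
    have DN: "D (N x) = N (D x)" for x
      by (simp add: N_def D\<omega> DX bilinear_lzero[OF bil])
    have DM: "D (M x) = M (D x)" for x
      unfolding M_def by (rule adjoint_commute_D[OF linN DN])
    have actN: "act N \<omega> = (\<lambda>x y. 0)"
      by (intro ext) (simp add: act_def N_def jac[of X])
    \<comment> \<open>The commutator of \<open>N\<close> with its adjoint \<open>M\<close>, both
      commuting with \<open>D\<close>. Hence the trace of \<open>(D - 1) Y\<close> is 0, and the
      moment equation gives \<open>binner (act Y \<omega>) \<omega> = 0\<close>.\<close>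
    define Y where "Y x = N (M x) - M (N x)" for x
    have linNM: "linear (\<lambda>x. N (M x))" "linear (\<lambda>x. M (N x))"
      using linear_compose[OF linM linN] linear_compose[OF linN linM] by (simp_all add: o_def)
    have Y: "linear Y" "\<And>x y. Y x \<bullet> y = x \<bullet> Y y" "\<And>x. D (Y x) = Y (D x)"
      unfolding Y_def
      by (auto simp: linear_compose_sub[OF linNM] inner_diff_left inner_diff_right MN linear_diff[OF linear_diagop] DN DM)
    have "tr (\<lambda>x. D (Y x) - Y x) = tr (\<lambda>x. N (M (D x) - M x)) - tr (\<lambda>x. M (D (N x)) - M (N x))"
      unfolding tr_diff[symmetric]
      by (rule arg_cong[where f = tr]) (auto simp: Y_def linear_diff[OF linear_diagop] linear_diff[OF linN] DN DM)
    also have "\<dots> = 0"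
    proof -
      have "linear (\<lambda>x. M (D x) - M x)"
        using linear_compose[OF linear_diagop linM] by (intro linear_compose_sub linM) (simp add: o_def)
      from tr_comm[OF linN this] show ?thesis
        by simp
    qed
    finally have "binner (act Y \<omega>) \<omega> = 0"
      using main[OF Y] by simp
    \<comment> \<open>\<open>N\<close> is a derivation, so the other half of the commutator drops
      out. Moving \<open>N\<close> across the inner product turns the pairing into the squared norm
      of \<open>act M \<omega>\<close>, and \<open>M\<close> is a derivation too.\<close>
    moreover have "act Y \<omega> = act N (act M \<omega>)"
    proof (intro ext)
      fix x y
      show "act Y \<omega> x y = act N (act M \<omega>) x y"
        unfolding Y_def[abs_def] act_commutator[OF linN linM bil] actN
        by (simp add: act_def[of M "\<lambda>x y. 0"] linear_0[OF linM])
    qed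
    ultimately have "binner (act M \<omega>) (act M \<omega>) = 0"
      using binner_act_adjoint[OF linN bilinear_act[OF linM bil] bil] by (simp add: M_def)
    then have "act M \<omega> x y = 0" for x y
      by (rule binner_eq_0[OF bilinear_act[OF linM bil]])
    then have derM: "M (\<omega> x y) = \<omega> (M x) y + \<omega> x (M y)" for x y
      unfolding act_def by (metis (no_types, lifting) add.commute diff_diff_eq eq_iff_diff_eq_0)
    \<comment> \<open>\<open>M X\<close> lies in the kernel of \<open>D\<close>, where
      \<open>X\<close> is central, so \<open>N\<close> kills it.\<close>
    have "M X \<bullet> M X = 0"
    proof -
      have "D (M X) = 0"
        by (simp add: DM DX linear_0[OF linM])
      then have "N (M X) = 0"
        by (simp add: N_def center)
      then show ?thesis
        by (simp add: MN(1))
    qed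
    then have MX: "M X = 0"
      by simp
    have normal: "M (N x) = N (M x)" for x
      using derM[of X x] by (simp add: N_def MX bilinear_lzero[OF bil])
    \<comment> \<open>A normal operator has the same kernel as its square, so the nilpotent
      \<open>N\<close> vanishes.\<close>
    have NN: "N x = 0" if "N (N x) = 0" for x
    proof -
      have "M (N x) \<bullet> M (N x) = 0"
        using that normal[of "N x"] by (simp add: MN(1) linear_0[OF linM])
      then have "M (N x) = 0" by simp
      then have "N x \<bullet> N x = 0"
        by (simp add: MN(2))
      then show ?thesis by simp
    qed
    have "foldr \<omega> (replicate n X) x = (N ^^ n) x" for n x
      by (induction n) (auto simp: N_def)
    then have NK: "(N ^^ K) x = 0" for x
      using nilp[of "replicate K X" x] by simp
    have "N x = 0" if "\<And>x. (N ^^ m) x = 0" for m x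
      using that
    proof (induction m)
      case 0
      then show ?case by (metis funpow_0)
    next
      case (Suc m)
      show ?case
      proof (cases m)
        case 0
        then show ?thesis
          using Suc.prems[of x] by simp
      next
        case (Suc l)
        then show ?thesis
          using NN Suc.IH Suc.prems by simp
      qed
    qed
    then have "N x = 0" for x
      using NK by blast
    then have z: "\<omega> X x = 0" "\<omega> x X = 0" for x
      using anti[of x X] by (simp_all add: N_def)
    \<comment> \<open>A multiple of the projection onto \<open>X\<close>. As \<open>X\<close> is now
      central in the whole algebra, the bracket term is a sum of squares, whereas
      \<open>D X = 0\<close> makes the trace negative.\<close>
    define Z where "Z x = (x \<bullet> X) *\<^sub>R X" for x
    have XD: "X \<bullet> D x = 0" for x
      using diagop_symmetric[of u e X x] by (simp add: DX)
    have Z: "linear Z" "\<And>x y. Z x \<bullet> y = x \<bullet> Z y" "\<And>x. D (Z x) = Z (D x)"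
      unfolding Z_def
      by (auto intro!: linearI simp: inner_add_left algebra_simps inner_commute linear_cmul[OF linear_diagop] DX XD)
    have "act Z \<omega> x y = (\<omega> x y \<bullet> X) *\<^sub>R X" for x y
      by (simp add: act_def Z_def bilinear_lmul[OF bil] bilinear_rmul[OF bil] z)
    then have "0 \<le> binner (act Z \<omega>) \<omega>"
      unfolding binner_def by (intro sum_nonneg) (simp add: inner_commute)
    moreover have "tr (\<lambda>x. D (Z x) - Z x) = - (X \<bullet> X)"
    proof -
      have "tr (\<lambda>x. D (Z x) - Z x) = (\<Sum>b\<in>Basis. - ((X \<bullet> b) * (X \<bullet> b)))"
        by (simp add: tr_def Z_def linear_cmul[OF linear_diagop] DX inner_commute)
      also have "\<dots> = - (X \<bullet> X)"
        by (simp add: sum_negf euclidean_inner[of X X])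
      finally show ?thesis .
    qed
    moreover have "0 < \<kappa> * (X \<bullet> X)"
      using \<kappa> X0 by simp
    ultimately show False
      using main[OF Z] by simp
  qed
qed (use i in simp)

end

text \<open>Stated for arbitrary eigenvectors instead of one frame, because the eigenframe used
  later must also respect the splitting into \<open>nn br\<close> and \<open>aa br\<close>.\<close>

theorem optimal_grading:
  fixes \<mu> :: "'a::euclidean_space \<Rightarrow> 'a \<Rightarrow> 'a"
  assumes nil: "nil_lie K \<mu>"
  obtains D where "linear D" "\<And>x y. D x \<bullet> y = x \<bullet> D y"
    "\<And>x y z r s t. D x = r *\<^sub>R x \<Longrightarrow> D y = s *\<^sub>R y \<Longrightarrow> D z = t *\<^sub>R z \<Longrightarrow> \<mu> x y \<bullet> z \<noteq> 0 \<Longrightarrow> r + s \<le> t"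
    "\<And>A x z r t. derivation \<mu> A \<Longrightarrow> D x = r *\<^sub>R x \<Longrightarrow> D z = t *\<^sub>R z \<Longrightarrow> A x \<bullet> z \<noteq> 0 \<Longrightarrow> r \<le> t"
    "\<And>A. derivation \<mu> A \<Longrightarrow> tr (\<lambda>x. D (A x) - A x) = 0"
    "tr (\<lambda>x. D (D x)) = tr D"
    "\<And>x r. D x = r *\<^sub>R x \<Longrightarrow> x \<noteq> 0 \<Longrightarrow> 0 < r"
proof -
  have bil: "bilinear \<mu>" and anti: "\<And>x y. \<mu> x y = - \<mu> y x"
    and jac: "\<And>x y z. \<mu> x (\<mu> y z) = \<mu> (\<mu> x y) z + \<mu> y (\<mu> x z)"
    using nil unfolding nil_lie_def by blast+
  obtain u e where ue: "oframe u" "frame_multiplicative \<mu> u e"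
    "\<And>u' e'. oframe u' \<Longrightarrow> frame_multiplicative \<mu> u' e' \<Longrightarrow> frame_cost e \<le> frame_cost e'"
    using exists_optimal_frame[OF bil] by metis
  interpret optimal_nilpotent \<mu> u e K
  proof unfold_locales
    show "frame_cost e \<le> frame_cost e'" if "oframe u'" "frame_multiplicative \<mu> u' e'" for u' e'
      using that by (rule ue(3))
  qed (rule bil ue(1,2) nil)+
  have derx: "derivation \<mu> (\<mu> x)" for x
    unfolding derivation_def using bilinear_linear(1)[OF bil] jac by blast
  have nonneg: "0 \<le> e i" if "i \<in> Basis" for i
  proof (rule weights_nonneg[OF anti _ that])
    show "\<mu> x y \<in> frame_filt u e s" if "y \<in> frame_filt u e s" for x y s
      using derivation_invariant[OF _ _ that, of "\<mu> x"] derx[of x] by (simp add: derivation_def)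
  qed
  have inF: "x \<in> frame_filt u e r" if "D x = r *\<^sub>R x" for x r
    using eigenvector_inner[OF frame that] by (auto simp: mem_ffs[OF frame])
  have low: "x \<bullet> z = 0" if "x \<in> frame_filt u e s" "D z = t *\<^sub>R z" "t < s" for x z s t
    unfolding oframe_inner[OF frame, of x z]
  proof (rule sum.neutral, intro ballI)
    fix i :: 'a assume i: "i \<in> Basis"
    show "(x \<bullet> u i) * (z \<bullet> u i) = 0"
    proof (cases "e i = t")
      case True
      then show ?thesis
        using that i by (simp add: mem_ffs[OF frame])
    next
      case False
      then show ?thesis
        using eigenvector_inner[OF frame that(2) i] by simp
    qed
  qed
  have mult': "multiplicative \<mu> (u ` Basis) (frame_weight u e)"
    using mult multiplicative_frame[OF frame] by blast
  show thesis
  proof (rule that[OF linear_diagop diagop_symmetric])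
    show "r + s \<le> t" if "D x = r *\<^sub>R x" "D y = s *\<^sub>R y" "D z = t *\<^sub>R z" "\<mu> x y \<bullet> z \<noteq> 0" for x y z r s t
    proof (rule ccontr)
      assume "\<not> r + s \<le> t"
      have "\<mu> x y \<in> frame_filt u e (r + s)"
        using multiplicative_fs[OF bil mult', of x r y s] inF[OF that(1)] inF[OF that(2)]
        by (simp add: fs_frame[OF inj_u])
      then show False
        using low[of "\<mu> x y" "r + s" z t] that \<open>\<not> r + s \<le> t\<close> by simp
    qed
    show "r \<le> t" if "derivation \<mu> A" "D x = r *\<^sub>R x" "D z = t *\<^sub>R z" "A x \<bullet> z \<noteq> 0" for A x z r t
    proof (rule ccontr)
      assume "\<not> r \<le> t"
      have "A x \<in> frame_filt u e r"
        using derivation_invariant[OF _ _ inF[OF that(2)], of A] that(1) by (simp add: derivation_def)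
      then show False
        using low[of "A x" r z t] that \<open>\<not> r \<le> t\<close> by simp
    qed
    show "tr (\<lambda>x. D (A x) - A x) = 0" if "derivation \<mu> A" for A
    proof -
      have "linear (\<lambda>x. D (A x) - A x)"
      proof -
        have "linear A"
          using that by (simp add: derivation_def)
        then show ?thesis
          using linear_compose[OF _ linear_diagop] by (intro linear_compose_sub) (simp_all add: o_def)
      qed
      then show ?thesis
        using derivation_trace[OF that]
        by (simp add: tr_frame[OF frame] inner_diff_left diagop_inner[OF frame] left_diff_distrib)
    qed
    have lin2: "linear (\<lambda>x. D (D x))"
      using linear_compose[OF linear_diagop linear_diagop] by (simp add: o_def)
    show "tr (\<lambda>x. D (D x)) = tr D"
      using sum_sq
      by (simp add: tr_frame[OF frame lin2] tr_frame[OF frame linear_diagop] diagop_inner[OF frame] oframe_self[OF frame] power2_eq_square)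
    show "0 < r" if Dx: "D x = r *\<^sub>R x" and x0: "x \<noteq> 0" for x r
    proof -
      obtain i where i: "i \<in> Basis" "x \<bullet> u i \<noteq> 0"
        using oframe_eqI[OF frame, of x 0] x0 by auto
      then have "e i = r"
        using eigenvector_inner[OF frame Dx] by blast
      then show ?thesis
        using weights_pos[OF nonneg i(1)] by simp
    qed
  qed
qed

subsection \<open>The Lie algebra of a Lie group\<close>

lemma C_k_on_cong:
  assumes "open W" "\<And>x. x \<in> W \<Longrightarrow> f x = g x"
  shows "C_k_on k f W \<longleftrightarrow> C_k_on k g W"
  using assms(2)
proof (induction k arbitrary: f g)
  case 0
  then show ?case
    by (simp cong: continuous_on_cong)
next
  case (Suc k)
  have der: "(f has_derivative f') (at x) \<longleftrightarrow> (g has_derivative f') (at x)" if "x \<in> W" for x f'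
    using has_derivative_transform_within_open[OF _ assms(1) that, of f f' UNIV g]
      has_derivative_transform_within_open[OF _ assms(1) that, of g f' UNIV f] Suc.prems by auto
  then have "frechet_derivative f (at x) = frechet_derivative g (at x)" if "x \<in> W" for x
    using that by (simp add: frechet_derivative_def)
  then have "C_k_on k (\<lambda>x. frechet_derivative f (at x) v) W \<longleftrightarrow> C_k_on k (\<lambda>x. frechet_derivative g (at x) v) W" for v
    by (intro Suc.IH) simp
  moreover have "f differentiable_on W \<longleftrightarrow> g differentiable_on W"
    using der by (simp add: differentiable_on_eq_differentiable_at[OF assms(1)] differentiable_def)
  ultimately show ?case
    by simp
qed

lemma C_k_on_Suc: "C_k_on (Suc k) f W \<Longrightarrow> C_k_on k f W"
proof (induction k arbitrary: f)
  case 0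
  then show ?case
    by (simp add: differentiable_imp_continuous_on)
next
  case (Suc k)
  then show ?case
    by simp
qed

lemma C_k_on_differentiable:
  assumes "C_k_on (Suc k) f W" "open W" "x \<in> W"
  shows "f differentiable (at x)"
  using assms by (simp add: differentiable_on_eq_differentiable_at)

lemma C_k_on_const: "C_k_on k (\<lambda>x. c) W"
proof (induction k arbitrary: c)
  case (Suc k)
  have "frechet_derivative (\<lambda>x. c) (at x) = (\<lambda>v. 0)" for x
    by (metis frechet_derivative_at has_derivative_const)
  then show ?case
    using Suc[of 0] by simp
qed simp

lemma C_k_on_add:
  assumes "open W" "C_k_on k f W" "C_k_on k g W"
  shows "C_k_on k (\<lambda>x. f x + g x) W"
  using assms(2,3)
proof (induction k arbitrary: f g)
  case 0
  then show ?case
    by (simp add: continuous_on_add)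
next
  case (Suc k)
  have fd: "frechet_derivative (\<lambda>x. f x + g x) (at x) v = frechet_derivative f (at x) v + frechet_derivative g (at x) v"
    if "x \<in> W" for x v
    using frechet_derivative_at[OF has_derivative_add[OF
        frechet_derivative_works[THEN iffD1, OF C_k_on_differentiable[OF Suc.prems(1) assms(1) that]]
        frechet_derivative_works[THEN iffD1, OF C_k_on_differentiable[OF Suc.prems(2) assms(1) that]]]]
    by (rule fun_cong[OF sym])
  have "C_k_on k (\<lambda>x. frechet_derivative (\<lambda>x. f x + g x) (at x) v) W" for v
    using Suc.IH[of "\<lambda>x. frechet_derivative f (at x) v" "\<lambda>x. frechet_derivative g (at x) v"] Suc.prems
    by (subst C_k_on_cong[OF assms(1) fd]) simp_all
  then show ?case
    using Suc.prems by (simp add: differentiable_on_add)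
qed

lemma C_k_on_mult:
  fixes f g :: "'a::euclidean_space \<Rightarrow> real"
  assumes "open W" "C_k_on k f W" "C_k_on k g W"
  shows "C_k_on k (\<lambda>x. f x * g x) W"
  using assms(2,3)
proof (induction k arbitrary: f g)
  case 0
  then show ?case
    by (simp add: continuous_on_mult)
next
  case (Suc k)
  have fd: "frechet_derivative (\<lambda>x. f x * g x) (at x) v = f x * frechet_derivative g (at x) v + frechet_derivative f (at x) v * g x"
    if "x \<in> W" for x v
    using frechet_derivative_at[OF has_derivative_mult[OF
        frechet_derivative_works[THEN iffD1, OF C_k_on_differentiable[OF Suc.prems(1) assms(1) that]]
        frechet_derivative_works[THEN iffD1, OF C_k_on_differentiable[OF Suc.prems(2) assms(1) that]]]]
    by (rule fun_cong[OF sym])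
  have "C_k_on k (\<lambda>x. f x * frechet_derivative g (at x) v + frechet_derivative f (at x) v * g x) W" for v
    using Suc.prems C_k_on_Suc[OF Suc.prems(1)] C_k_on_Suc[OF Suc.prems(2)]
    by (intro C_k_on_add[OF assms(1)] Suc.IH) simp_all
  then have "C_k_on k (\<lambda>x. frechet_derivative (\<lambda>x. f x * g x) (at x) v) W" for v
    by (subst C_k_on_cong[OF assms(1) fd])
  then show ?case
    using Suc.prems by (simp add: differentiable_on_mult)
qed

text \<open>The only chart of the target is the identity of the reals, so the preimage in
  \<open>smooth_map\<close> is the whole domain of the chart.\<close>

lemma smooth_functions_iff:
  assumes "smooth_manifold A"
  shows "f \<in> smooth_functions A \<longleftrightarrow> continuous_on UNIV f \<and>
    (\<forall>(U, \<xi>)\<in>A. \<forall>k. open (\<xi> ` U) \<and> C_k_on k (\<lambda>x. f (inv_into U \<xi> x)) (\<xi> ` U))"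
  using assms by (auto simp: smooth_functions_def smooth_map_def smooth_on_def smooth_manifold_def chart_on_def o_def)

lemma smooth_functions_const: "smooth_manifold A \<Longrightarrow> (\<lambda>q. c) \<in> smooth_functions A"
  by (auto simp: smooth_functions_iff C_k_on_const smooth_manifold_def chart_on_def)

lemma smooth_functions_add:
  assumes "smooth_manifold A" "f \<in> smooth_functions A" "g \<in> smooth_functions A"
  shows "(\<lambda>q. f q + g q) \<in> smooth_functions A"
  using assms(2,3) unfolding smooth_functions_iff[OF assms(1)]
  by (fastforce intro: continuous_on_add C_k_on_add)

lemma smooth_functions_mult:
  assumes "smooth_manifold A" "f \<in> smooth_functions A" "g \<in> smooth_functions A"
  shows "(\<lambda>q. f q * g q) \<in> smooth_functions A"
  using assms(2,3) unfolding smooth_functions_iff[OF assms(1)]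
  by (fastforce intro: continuous_on_mult C_k_on_mult)

lemma smooth_functions_cmult:
  "smooth_manifold A \<Longrightarrow> f \<in> smooth_functions A \<Longrightarrow> (\<lambda>q. c * f q) \<in> smooth_functions A"
  using smooth_functions_mult smooth_functions_const by blast

lemma smooth_functions_diff:
  assumes "smooth_manifold A" "f \<in> smooth_functions A" "g \<in> smooth_functions A"
  shows "(\<lambda>q. f q - g q) \<in> smooth_functions A"
  using smooth_functions_add[OF assms(1,2) smooth_functions_cmult[OF assms(1,3), of "-1"]] by simp

lemma tangent_spaceD:
  assumes "v \<in> tangent_space A p"
  shows "f \<in> smooth_functions A \<Longrightarrow> h \<in> smooth_functions A \<Longrightarrow> v (\<lambda>q. f q + h q) = v f + v h"
    and "f \<in> smooth_functions A \<Longrightarrow> v (\<lambda>q. c * f q) = c * v f"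
    and "f \<in> smooth_functions A \<Longrightarrow> h \<in> smooth_functions A \<Longrightarrow> v (\<lambda>q. f q * h q) = f p * v h + h p * v f"
    and "f \<notin> smooth_functions A \<Longrightarrow> v f = 0"
  using CollectD[OF assms[unfolded tangent_space_def]] by blast+

lemma vector_field:
  assumes A: "smooth_manifold A" and X: "X \<in> vector_fields A"
  shows vf_smooth: "f \<in> smooth_functions A \<Longrightarrow> X f \<in> smooth_functions A"
    and vf_add: "f \<in> smooth_functions A \<Longrightarrow> h \<in> smooth_functions A \<Longrightarrow> X (\<lambda>q. f q + h q) = (\<lambda>q. X f q + X h q)"
    and vf_cmult: "f \<in> smooth_functions A \<Longrightarrow> X (\<lambda>q. c * f q) = (\<lambda>q. c * X f q)"
    and vf_diff: "f \<in> smooth_functions A \<Longrightarrow> h \<in> smooth_functions A \<Longrightarrow> X (\<lambda>q. f q - h q) = (\<lambda>q. X f q - X h q)"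
    and vf_leibniz: "f \<in> smooth_functions A \<Longrightarrow> h \<in> smooth_functions A \<Longrightarrow>
      X (\<lambda>q. f q * h q) = (\<lambda>q. f q * X h q + h q * X f q)"
    and vf_junk: "f \<notin> smooth_functions A \<Longrightarrow> X f = (\<lambda>q. 0)"
    and vf_zero: "X (\<lambda>q. 0) = (\<lambda>q. 0)"
proof -
  have X': "at_point X p \<in> tangent_space A p" "f \<in> smooth_functions A \<Longrightarrow> X f \<in> smooth_functions A" for p f
    using CollectD[OF X[unfolded vector_fields_def]] by blast+
  note t = tangent_spaceD[OF X'(1), unfolded at_point_def]
  show "X f \<in> smooth_functions A" if "f \<in> smooth_functions A"
    by (rule X'(2)[OF that])
  show add: "X (\<lambda>q. f q + h q) = (\<lambda>q. X f q + X h q)" if "f \<in> smooth_functions A" "h \<in> smooth_functions A" for f h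
    by (rule ext) (rule t(1)[OF that])
  show cm: "X (\<lambda>q. c * f q) = (\<lambda>q. c * X f q)" if "f \<in> smooth_functions A" for f c
    by (rule ext) (rule t(2)[OF that])
  show "X (\<lambda>q. f q - h q) = (\<lambda>q. X f q - X h q)" if "f \<in> smooth_functions A" "h \<in> smooth_functions A"
    using add[OF that(1) smooth_functions_cmult[OF A that(2), of "-1"]] cm[OF that(2), of "-1"] by simp
  show "X (\<lambda>q. f q * h q) = (\<lambda>q. f q * X h q + h q * X f q)" if "f \<in> smooth_functions A" "h \<in> smooth_functions A"
    by (rule ext) (rule t(3)[OF that])
  show "X f = (\<lambda>q. 0)" if "f \<notin> smooth_functions A"
    by (rule ext) (rule t(4)[OF that])
  show "X (\<lambda>q. 0) = (\<lambda>q. 0)"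
    using cm[OF smooth_functions_const[OF A, of 0], of 0] by simp
qed

lemma commutator_vector_field:
  assumes A: "smooth_manifold A" and X: "X \<in> vector_fields A" and Y: "Y \<in> vector_fields A"
  shows "commutator X Y \<in> vector_fields A"
  unfolding vector_fields_def
proof (intro CollectI conjI allI ballI)
  note x = vector_field[OF A X] and y = vector_field[OF A Y]
  show "commutator X Y f \<in> smooth_functions A" if "f \<in> smooth_functions A" for f
    unfolding commutator_def using that by (intro smooth_functions_diff A x(1) y(1))
  fix p
  show "at_point (commutator X Y) p \<in> tangent_space A p"
    unfolding tangent_space_def
  proof (intro CollectI conjI ballI allI impI)
    fix f h and c :: real
    assume f: "f \<in> smooth_functions A"
    show "at_point (commutator X Y) p (\<lambda>q. c * f q) = c * at_point (commutator X Y) p f"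
      by (simp add: at_point_def commutator_def x y f algebra_simps)
    assume h: "h \<in> smooth_functions A"
    show "at_point (commutator X Y) p (\<lambda>q. f q + h q) = at_point (commutator X Y) p f + at_point (commutator X Y) p h"
      by (simp add: at_point_def commutator_def x y f h)
    show "at_point (commutator X Y) p (\<lambda>q. f q * h q) = f p * at_point (commutator X Y) p h + h p * at_point (commutator X Y) p f"
      by (simp add: at_point_def commutator_def x y f h smooth_functions_mult[OF A] algebra_simps)
  next
    \<comment> \<open>The value 0 on functions that are not smooth is inherited: each inner field
      gives the zero function, which the outer one sends to 0.\<close>
    fix f assume "f \<notin> smooth_functions A"
    then show "at_point (commutator X Y) p f = 0"
      by (simp add: at_point_def commutator_def x(6,7) y(6,7))
  qed
qed

lemma commutator_left_invariant:
  assumes A: "smooth_manifold A"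
    and X: "X \<in> left_invariant_fields mul A" and Y: "Y \<in> left_invariant_fields mul A"
  shows "commutator X Y \<in> left_invariant_fields mul A"
proof -
  have XY: "X \<in> vector_fields A" "Y \<in> vector_fields A"
    using X Y by (auto simp: left_invariant_fields_def)
  have inv: "X (f \<circ> mul a) = X f \<circ> mul a" "Y (f \<circ> mul a) = Y f \<circ> mul a" if "f \<in> smooth_functions A" for f a
    using X Y that by (auto simp: left_invariant_fields_def)
  have "commutator X Y (f \<circ> mul a) = commutator X Y f \<circ> mul a" if f: "f \<in> smooth_functions A" for f a
    using inv(1)[OF vf_smooth[OF A XY(2) f], of a] inv(2)[OF vf_smooth[OF A XY(1) f], of a]
    by (simp add: commutator_def inv[OF f] fun_eq_iff)
  then show ?thesis
    using commutator_vector_field[OF A XY] by (simp add: left_invariant_fields_def)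
qed

text \<open>The axioms are pulled back from the commutator along the bijection
  \<open>\<phi>\<close>. Two fields need to be compared on smooth functions only, as both vanish on
  all others.\<close>

lemma transported_bracket_lie_alg:
  fixes \<phi> :: "'a::euclidean_space \<Rightarrow> ('g::{t2_space, second_countable_topology}) vector_field"
  assumes G: "lie_group mul e iv A" and \<phi>: "lie_algebra_isometry mul e A g \<phi>"
  shows "lie_alg (transported_bracket \<phi>)"
proof -
  have A: "smooth_manifold A"
    using G by (simp add: lie_group_def lie_group_axioms_def)
  have bij: "bij_betw \<phi> UNIV (left_invariant_fields mul A)"
    and add: "\<And>x y. \<phi> (x + y) = (\<lambda>f p. \<phi> x f p + \<phi> y f p)"
    and scale: "\<And>c x. \<phi> (c *\<^sub>R x) = (\<lambda>f p. c * \<phi> x f p)"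
    using \<phi> by (simp_all add: lie_algebra_isometry_def)
  have inj: "inj \<phi>" and L: "\<phi> x \<in> left_invariant_fields mul A" for x
    using bij by (auto simp: bij_betw_def)
  have V: "\<phi> x \<in> vector_fields A" for x
    using L by (simp add: left_invariant_fields_def)
  have bracket: "\<phi> (transported_bracket \<phi> x y) = commutator (\<phi> x) (\<phi> y)" for x y
  proof -
    have "commutator (\<phi> x) (\<phi> y) \<in> range \<phi>"
      using commutator_left_invariant[OF A L L] bij by (simp add: bij_betw_def)
    then show ?thesis
      by (simp add: transported_bracket_def f_inv_into_f)
  qed
  note v = vector_field[OF A V]
  have eqI: "x = y" if "\<And>f p. f \<in> smooth_functions A \<Longrightarrow> \<phi> x f p = \<phi> y f p" for x y
  proof -
    have "\<phi> x f = \<phi> y f" for f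
      using that by (cases "f \<in> smooth_functions A") (auto simp: v(6))
    then show ?thesis
      using inj by (meson ext injD)
  qed
  have neg: "\<phi> (- x) = (\<lambda>f p. - \<phi> x f p)" for x
    using scale[of "-1" x] by simp
  let ?br = "transported_bracket \<phi>"
  have anti: "?br x y = - ?br y x" for x y
    by (rule eqI) (simp add: neg bracket commutator_def)
  have addr: "?br x (y + z) = ?br x y + ?br x z" for x y z
    by (rule eqI) (simp add: bracket add commutator_def v)
  have scaler: "?br x (c *\<^sub>R y) = c *\<^sub>R ?br x y" for x y c
    by (rule eqI) (simp add: bracket scale commutator_def v algebra_simps)
  show ?thesis
  proof
    show "bilinear ?br"
      unfolding bilinear_def
    proof (intro conjI allI linearI)
      show "?br (y + z) x = ?br y x + ?br z x" for x y z
        using anti[of "y + z" x] anti[of y x] anti[of z x] addr[of x y z] by simp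
      show "?br (c *\<^sub>R y) x = c *\<^sub>R ?br y x" for x y c
        using anti[of "c *\<^sub>R y" x] anti[of y x] scaler[of x c y] by simp
    qed (rule addr scaler)+
    show "?br x y = - ?br y x" for x y
      by (rule anti)
    show "?br x (?br y z) = ?br (?br x y) z + ?br y (?br x z)" for x y z
    proof (rule eqI)
      fix f p assume f: "f \<in> smooth_functions A"
      show "\<phi> (?br x (?br y z)) f p = \<phi> (?br (?br x y) z + ?br y (?br x z)) f p"
        by (simp add: bracket add commutator_def v f)
    qed
  qed
qed

subsection \<open>The Ricci operator\<close>

lemma operator_of_form_inner:
  assumes "linear (\<beta> x)"
  shows "operator_of_form \<beta> x \<bullet> y = \<beta> x y"
proof -
  have "\<beta> x y = \<beta> x (\<Sum>b\<in>Basis. (y \<bullet> b) *\<^sub>R b)"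
    by (simp add: euclidean_representation)
  also have "\<dots> = (\<Sum>b\<in>Basis. (y \<bullet> b) * \<beta> x b)"
    by (simp add: linear_sum[OF assms] linear_cmul[OF assms])
  finally show ?thesis
    by (simp add: operator_of_form_def inner_sum_left inner_commute[of y] mult.commute)
qed

context lie_alg
begin

lemma linear_tr_br: "linear (\<lambda>x. tr (br x))"
  by (rule linearI) (simp_all add: tr_def bilinear_ladd[OF bilin] bilinear_lmul[OF bilin] inner_add_left sum.distrib sum_distrib_left)

lemma linear_R_form: "linear (R_form br x)"
  by (rule linearI)
     (simp_all add: R_form_def bilinear_ladd[OF bilin] bilinear_lmul[OF bilin] inner_add_left inner_add_right
       sum.distrib sum_distrib_left algebra_simps)

lemma linear_killing_form: "linear (killing_form br x)"
  by (rule linearI)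
     (simp_all add: killing_form_def tr_def bilinear_ladd[OF bilin] bilinear_lmul[OF bilin] linear_add[OF lin_right]
       linear_cmul[OF lin_right] inner_add_left sum.distrib sum_distrib_left)

text \<open>The Riesz vector \<open>H0\<close> of the functional \<open>tr (br x)\<close>, projected
  to \<open>aa br\<close>, is the unique solution that the description operator asks for.\<close>

lemma mean_curvature:
  shows mean_curvature_aa: "mean_curvature_vector br \<in> aa br"
    and mean_curvature_inner: "x \<in> aa br \<Longrightarrow> mean_curvature_vector br \<bullet> x = tr (br x)"
proof -
  have aa: "x \<in> aa br \<longleftrightarrow> (\<forall>w\<in>nn br. x \<bullet> w = 0)" for x
    by (auto simp: aa_def orthogonal_comp_def orthogonal_def inner_commute)
  have sub: "subspace (aa br)"
    unfolding aa_def by (rule subspace_orthogonal_comp)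
  define H0 where "H0 = (\<Sum>b\<in>Basis. tr (br b) *\<^sub>R b)"
  have H0: "H0 \<bullet> x = tr (br x)" for x
  proof -
    have "tr (br x) = tr (br (\<Sum>b\<in>Basis. (x \<bullet> b) *\<^sub>R b))"
      by (simp add: euclidean_representation)
    also have "\<dots> = (\<Sum>b\<in>Basis. (x \<bullet> b) * tr (br b))"
      by (subst linear_sum[OF linear_tr_br]) (simp add: linear_cmul[OF linear_tr_br])
    finally show ?thesis
      by (simp add: H0_def inner_sum_left inner_commute[of x] mult.commute)
  qed
  let ?H = "oproj (aa br) H0"
  have ex: "?H \<in> aa br \<and> (\<forall>x\<in>aa br. ?H \<bullet> x = tr (br x))"
    using oproj_in[OF sub] oproj_inner[OF sub] H0 by simp
  have uniq: "G = ?H" if G: "G \<in> aa br \<and> (\<forall>x\<in>aa br. G \<bullet> x = tr (br x))" for G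
  proof -
    have "G - ?H \<in> aa br"
      using G ex sub by (simp add: subspace_diff)
    then have "(G - ?H) \<bullet> (G - ?H) = 0"
      using G ex by (subst inner_diff_left) simp
    then show ?thesis by simp
  qed
  have "mean_curvature_vector br = ?H"
    unfolding mean_curvature_vector_def using ex uniq by (rule the_equality)
  then show "mean_curvature_vector br \<in> aa br" "x \<in> aa br \<Longrightarrow> mean_curvature_vector br \<bullet> x = tr (br x)"
    using ex by simp_all
qed

text \<open>The definition fixes the standard basis, whereas the Ricci form is evaluated in the
  eigenframe of the weights. Both double sums are squared norms and so do not depend on the
  frame.\<close>

lemma R_form_frame:
  assumes v: "oframe v"
  shows "R_form br x x = - (1/2) * (\<Sum>i\<in>Basis. \<Sum>j\<in>Basis. (br x (v i) \<bullet> v j)\<^sup>2)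
     + (1/4) * (\<Sum>i\<in>Basis. \<Sum>j\<in>Basis. (br (v i) (v j) \<bullet> x)\<^sup>2)"
proof -
  have "(\<Sum>i\<in>Basis. \<Sum>j\<in>Basis. (br x i \<bullet> j) * (br x i \<bullet> j)) = oinner (br x) (br x)"
    unfolding oinner_def by (rule sum.cong) (simp_all add: oframe_inner[OF oframe_id, symmetric])
  also have "\<dots> = (\<Sum>i\<in>Basis. \<Sum>j\<in>Basis. (br x (v i) \<bullet> v j)\<^sup>2)"
    unfolding oinner_frame[OF v lin_right lin_right]
    by (rule sum.cong[OF refl], subst oframe_inner[OF v]) (simp add: power2_eq_square)
  finally have 1: "(\<Sum>i\<in>Basis. \<Sum>j\<in>Basis. (br x i \<bullet> j) * (br x i \<bullet> j))
      = (\<Sum>i\<in>Basis. \<Sum>j\<in>Basis. (br x (v i) \<bullet> v j)\<^sup>2)" .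
  obtain b where b: "b \<in> (Basis :: 'a set)"
    using nonempty_Basis by blast
  \<comment> \<open>The scalar form \<open>br y z \<bullet> x\<close>, made vector valued by a fixed
    unit vector so that \<open>binner_frame\<close> applies.\<close>
  define B where "B y z = (br y z \<bullet> x) *\<^sub>R b" for y z
  have bilB: "bilinear B"
    unfolding bilinear_def B_def
    by (intro conjI allI linearI)
       (simp_all add: bilinear_ladd[OF bilin] bilinear_radd[OF bilin] bilinear_lmul[OF bilin] bilinear_rmul[OF bilin]
         inner_add_left scaleR_add_left)
  have "(\<Sum>i\<in>Basis. \<Sum>j\<in>Basis. (br i j \<bullet> x) * (br i j \<bullet> x)) = binner B B"
    using b by (simp add: binner_def B_def)
  also have "\<dots> = (\<Sum>i\<in>Basis. \<Sum>j\<in>Basis. (br (v i) (v j) \<bullet> x)\<^sup>2)"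
    unfolding binner_frame[OF v bilB bilB] using b by (simp add: B_def power2_eq_square)
  finally show ?thesis
    by (simp add: R_form_def 1)
qed

lemma killing_form_frame:
  assumes v: "oframe v"
  shows "killing_form br x x = (\<Sum>i\<in>Basis. \<Sum>j\<in>Basis. (br x (v i) \<bullet> v j) * (br x (v j) \<bullet> v i))"
proof -
  have "linear (br x \<circ> br x)"
    by (rule linear_compose[OF lin_right lin_right])
  then have "killing_form br x x = (\<Sum>i\<in>Basis. br x (br x (v i)) \<bullet> v i)"
    by (simp add: killing_form_def tr_frame[OF v])
  also have "\<dots> = (\<Sum>i\<in>Basis. \<Sum>j\<in>Basis. (br x (v i) \<bullet> v j) * (br x (v j) \<bullet> v i))"
    by (rule sum.cong[OF refl], subst oframe_linear_expand[OF v lin_right]) (simp add: inner_sum_left)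
  finally show ?thesis .
qed

lemma einstein_diagonal:
  assumes "einstein br"
  obtains c where "\<And>x. R_form br x x - (1/2) * killing_form br x x - br (mean_curvature_vector br) x \<bullet> x = c * (x \<bullet> x)"
proof -
  obtain c where c: "\<And>x. ricci_operator br x = c *\<^sub>R x"
    using assms by (auto simp: einstein_def)
  have "R_form br x x - (1/2) * killing_form br x x - br (mean_curvature_vector br) x \<bullet> x = c * (x \<bullet> x)" for x
  proof -
    have "symmetric_part (br (mean_curvature_vector br)) x \<bullet> x = br (mean_curvature_vector br) x \<bullet> x"
      using adjoint_inner_left[OF lin_right[of "mean_curvature_vector br"], of x x]
        inner_commute[of x "br (mean_curvature_vector br) x"]
      by (simp add: symmetric_part_def inner_add_left)
    then have "ricci_operator br x \<bullet> x
        = R_form br x x - (1/2) * killing_form br x x - br (mean_curvature_vector br) x \<bullet> x"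
      by (simp add: ricci_operator_def inner_diff_left operator_of_form_inner linear_R_form linear_killing_form)
    then show ?thesis
      using c[of x] by simp
  qed
  then show thesis
    by (rule that)
qed

section \<open>The bracket of the derived algebra and its weights in an adapted frame\<close>

text \<open>The bracket of \<open>nn br\<close>, extended by 0 to \<open>aa br\<close> so that
  everything stays on the type \<open>'a\<close>. The price is that the optimal \<open>D\<close>
  also has weights on \<open>aa br\<close>, to be discarded later.\<close>

definition nbracket :: "'a \<Rightarrow> 'a \<Rightarrow> 'a" where
  "nbracket x y = br (oproj (nn br) x) (oproj (nn br) y)"

lemma nil_lie_nbracket:
  assumes solvable: "solvable_algebra br"
  obtains K where "nil_lie K nbracket"
proof -
  let ?P = "oproj (nn br)"
  note P = oproj_in[OF subspace_nn] oproj_fix[OF subspace_nn]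
  have linP: "linear ?P"
    by (rule linear_oproj[OF subspace_nn])
  have Pbr: "?P (br x y) = br x y" for x y
    by (rule P(2)[OF nn_bracket])
  obtain K where K: "\<And>xs y. set xs \<subseteq> nn br \<Longrightarrow> length xs = K \<Longrightarrow> foldr br xs y = 0"
    using nn_nilpotent_action[OF solvable] by blast
  have fold: "foldr nbracket xs z = foldr br (map ?P xs) z \<and> ?P (foldr nbracket xs z) = foldr nbracket xs z"
    if "?P z = z" for xs z
    using that by (induction xs) (auto simp: nbracket_def Pbr)
  \<comment> \<open>The innermost factor serves to bring an arbitrary \<open>y\<close> into
    \<open>nn br\<close>; the other \<open>K\<close> factors then give 0.\<close>
  have "nil_lie (Suc K) nbracket"
    unfolding nil_lie_def
  proof (intro conjI allI impI)
    show "bilinear nbracket"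
      unfolding bilinear_def nbracket_def
      by (intro conjI allI linearI)
         (simp_all add: linear_add[OF linP] linear_cmul[OF linP] bilinear_ladd[OF bilin] bilinear_radd[OF bilin]
           bilinear_lmul[OF bilin] bilinear_rmul[OF bilin])
    show "nbracket x y = - nbracket y x" for x y
      unfolding nbracket_def by (rule anti)
    show "nbracket x (nbracket y z) = nbracket (nbracket x y) z + nbracket y (nbracket x z)" for x y z
      unfolding nbracket_def Pbr by (rule jacobi)
    fix xs :: "'a list" and y :: 'a assume "length xs = Suc K"
    then obtain zs x where xs: "xs = zs @ [x]" "length zs = K"
      by (metis length_Suc_conv_rev)
    have "foldr nbracket zs (nbracket x y) = foldr br (map ?P zs) (nbracket x y)"
      using fold[of "nbracket x y" zs] by (simp add: nbracket_def Pbr)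
    also have "\<dots> = 0"
      using P(1) xs by (intro K) auto
    finally show "foldr nbracket xs y = 0"
      by (simp add: xs)
  qed
  then show thesis
    by (rule that)
qed

text \<open>This includes \<open>y\<close> in \<open>aa br\<close>: its action on the ideal,
  extended by 0, is a derivation, so it preserves the optimal filtration.\<close>

lemma derivation_nbr_ad:
  "derivation nbracket (\<lambda>x. br y (oproj (nn br) x))"
  unfolding derivation_def
proof (intro conjI allI)
  let ?P = "oproj (nn br)"
  have Pbr: "?P (br x y) = br x y" for x y
    by (rule oproj_fix[OF subspace_nn nn_bracket])
  show "linear (\<lambda>x. br y (?P x))"
    using linear_compose[OF linear_oproj[OF subspace_nn] lin_right] by (simp add: o_def)
  show "br y (?P (nbracket x z)) = nbracket (br y (?P x)) z + nbracket x (br y (?P z))" for x z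
    unfolding nbracket_def Pbr by (rule jacobi)
qed

text \<open>The projection \<open>Q\<close> onto \<open>aa br\<close> kills brackets and has central
  image, so it is a derivation of \<open>nbracket\<close>. Invariance of the filtration under it
  makes \<open>D\<close> commute with \<open>Q\<close>, and an eigenframe of both splits along
  \<open>nn br\<close> and \<open>aa br\<close>.\<close>

lemma adapted_frame_exists:
  assumes solvable: "solvable_algebra br"
  obtains v e where "oframe v" "\<And>i. i \<in> Basis \<Longrightarrow> v i \<in> nn br \<or> v i \<in> aa br"
    "\<And>i. i \<in> Basis \<Longrightarrow> 0 < e i"
    "\<And>i j k. i \<in> Basis \<Longrightarrow> j \<in> Basis \<Longrightarrow> k \<in> Basis \<Longrightarrow> v i \<in> nn br \<Longrightarrow> v j \<in> nn br \<Longrightarrow>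
       br (v i) (v j) \<bullet> v k \<noteq> 0 \<Longrightarrow> e i + e j \<le> e k"
    "\<And>x j k. j \<in> Basis \<Longrightarrow> k \<in> Basis \<Longrightarrow> v j \<in> nn br \<Longrightarrow> br x (v j) \<bullet> v k \<noteq> 0 \<Longrightarrow> e j \<le> e k"
    "\<And>x. (\<Sum>i\<in>{i\<in>Basis. v i \<in> nn br}. (e i - 1) * (br x (v i) \<bullet> v i)) = 0"
    "(\<Sum>i\<in>{i\<in>Basis. v i \<in> nn br}. (e i)\<^sup>2) = (\<Sum>i\<in>{i\<in>Basis. v i \<in> nn br}. e i)"
proof -
  let ?P = "oproj (nn br)"
  note P = oproj_in[OF subspace_nn] oproj_fix[OF subspace_nn]
  have linP: "linear ?P"
    by (rule linear_oproj[OF subspace_nn])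
  have symP: "?P x \<bullet> y = x \<bullet> ?P y" for x y
    by (rule oproj_symmetric[OF subspace_nn])
  have Pbr: "?P (br x y) = br x y" for x y
    by (rule P(2)[OF nn_bracket])
  obtain K where nil: "nil_lie K nbracket"
    using nil_lie_nbracket[OF solvable] by blast
  obtain D where D: "linear D" and symD: "\<And>x y. D x \<bullet> y = x \<bullet> D y"
    and mul: "\<And>x y z r s t. D x = r *\<^sub>R x \<Longrightarrow> D y = s *\<^sub>R y \<Longrightarrow> D z = t *\<^sub>R z \<Longrightarrow> nbracket x y \<bullet> z \<noteq> 0 \<Longrightarrow> r + s \<le> t"
    and der: "\<And>A x z r t. derivation nbracket A \<Longrightarrow> D x = r *\<^sub>R x \<Longrightarrow> D z = t *\<^sub>R z \<Longrightarrow> A x \<bullet> z \<noteq> 0 \<Longrightarrow> r \<le> t"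
    and tr0: "\<And>A. derivation nbracket A \<Longrightarrow> tr (\<lambda>x. D (A x) - A x) = 0"
    and trD: "tr (\<lambda>x. D (D x)) = tr D"
    and pos: "\<And>x r. D x = r *\<^sub>R x \<Longrightarrow> x \<noteq> 0 \<Longrightarrow> 0 < r"
    by (rule optimal_grading[OF nil]) blast
  define Q where "Q x = x - ?P x" for x
  have linQ: "linear Q"
    unfolding Q_def using linP by (intro linear_compose_sub linear_ident)
  have symQ: "Q x \<bullet> y = x \<bullet> Q y" for x y
    by (simp add: Q_def inner_diff_left inner_diff_right symP)
  have PQ: "?P (Q x) = 0" for x
    by (simp add: Q_def linear_diff[OF linP] P)
  have Qbr: "Q (br x y) = 0" for x y
    by (simp add: Q_def Pbr)
  have derQ: "derivation nbracket Q"
    unfolding derivation_def using linQ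
    by (auto simp: Qbr nbracket_def PQ bilinear_lzero[OF bilin] bilinear_rzero[OF bilin])
  obtain w f where w: "oframe w" and Dw: "\<And>i. i \<in> Basis \<Longrightarrow> D (w i) = f i *\<^sub>R w i"
    using common_eigenframe[OF D D symD symD] by metis
  \<comment> \<open>A derivation never lowers weights; since \<open>Q\<close> is symmetric, it does
    not raise them either.\<close>
  have Qw: "f i = f k" if "i \<in> Basis" "k \<in> Basis" "Q (w i) \<bullet> w k \<noteq> 0" for i k
    using der[OF derQ Dw[OF that(1)] Dw[OF that(2)]] der[OF derQ Dw[OF that(2)] Dw[OF that(1)]] that(3)
      symQ[of "w i" "w k"] by (simp add: inner_commute)
  have DQ: "D (Q x) = Q (D x)" for x
  proof (rule oframe_linear_eqI[OF w, of "\<lambda>x. D (Q x)" "\<lambda>x. Q (D x)"])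
    show "linear (\<lambda>x. D (Q x))" "linear (\<lambda>x. Q (D x))"
      using linear_compose[OF linQ D] linear_compose[OF D linQ] by (simp_all add: o_def)
    fix i :: 'a assume i: "i \<in> Basis"
    show "D (Q (w i)) = Q (D (w i))"
    proof (rule oframe_eqI[OF w])
      fix k :: 'a assume k: "k \<in> Basis"
      have "D (Q (w i)) \<bullet> w k = f k * (Q (w i) \<bullet> w k)"
        by (simp add: symD Dw[OF k])
      also have "\<dots> = f i * (Q (w i) \<bullet> w k)"
        using Qw[OF i k] by (cases "Q (w i) \<bullet> w k = 0") simp_all
      finally show "D (Q (w i)) \<bullet> w k = Q (D (w i)) \<bullet> w k"
        by (simp add: Dw[OF i] linear_cmul[OF linQ])
    qed
  qed
  obtain v e q where v: "oframe v" and Dv: "\<And>i. i \<in> Basis \<Longrightarrow> D (v i) = e i *\<^sub>R v i"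
    and Qv: "\<And>i. i \<in> Basis \<Longrightarrow> Q (v i) = q i *\<^sub>R v i"
    using common_eigenframe[OF D linQ symD symQ DQ] by metis
  have split: "v i \<in> nn br \<or> v i \<in> aa br" if i: "i \<in> Basis" for i
  proof (cases "q i = 0")
    case True
    then have "?P (v i) = v i"
      using Qv[OF i] by (simp add: Q_def)
    then show ?thesis
      using P(1)[of "v i"] by simp
  next
    case False
    have "?P (v i) = (1 / q i) *\<^sub>R ?P (Q (v i))"
      using False by (simp add: Qv[OF i] linear_cmul[OF linP])
    then have "?P (v i) = 0"
      by (simp add: PQ)
    then have "v i \<bullet> y = 0" if "y \<in> nn br" for y
      using symP[of "v i" y] P(2)[OF that] by simp
    then show ?thesis
      by (auto simp: aa_def orthogonal_comp_def orthogonal_def inner_commute)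
  qed
  have Pa: "?P (v i) = 0" if "v i \<in> aa br" for i
    using that by (intro oproj_orthogonal[OF subspace_nn]) (auto simp: aa_def orthogonal_comp_def orthogonal_def inner_commute)
  have notboth: "v i \<notin> nn br" if "i \<in> Basis" "v i \<in> aa br" for i
    using Pa[OF that(2)] P(2)[of "v i"] oframe_nonzero[OF v that(1)] by auto
  let ?N = "{i \<in> Basis. v i \<in> nn br}"
  have e0: "0 < e i" if "i \<in> Basis" for i
    using pos[OF Dv[OF that] oframe_nonzero[OF v that]] .
  have c1: "e i + e j \<le> e k"
    if "i \<in> Basis" "j \<in> Basis" "k \<in> Basis" "v i \<in> nn br" "v j \<in> nn br" "br (v i) (v j) \<bullet> v k \<noteq> 0" for i j k
    by (rule mul[OF Dv Dv Dv]) (use that in \<open>auto simp: nbracket_def P\<close>)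
  have c2: "e j \<le> e k" if "j \<in> Basis" "k \<in> Basis" "v j \<in> nn br" "br x (v j) \<bullet> v k \<noteq> 0" for x j k
    by (rule der[OF derivation_nbr_ad[of x] Dv Dv]) (use that in \<open>auto simp: P\<close>)
  have c3: "(\<Sum>i\<in>?N. (e i - 1) * (br x (v i) \<bullet> v i)) = 0" for x
  proof -
    let ?A = "\<lambda>y. br x (?P y)"
    have linA: "linear ?A"
      using linear_compose[OF linP lin_right] by (simp add: o_def)
    then have "linear (\<lambda>y. D (?A y) - ?A y)"
      using linear_compose[OF linA D] by (intro linear_compose_sub) (simp_all add: o_def)
    then have "(\<Sum>i\<in>Basis. (D (?A (v i)) - ?A (v i)) \<bullet> v i) = 0"
      using tr0[OF derivation_nbr_ad[of x]] by (simp add: tr_frame[OF v])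
    moreover have "(\<Sum>i\<in>Basis. (D (?A (v i)) - ?A (v i)) \<bullet> v i) = (\<Sum>i\<in>?N. (e i - 1) * (br x (v i) \<bullet> v i))"
    proof (rule sum.mono_neutral_cong_right)
      show "\<forall>i\<in>Basis - ?N. (D (?A (v i)) - ?A (v i)) \<bullet> v i = 0"
      proof
        fix i assume "i \<in> Basis - ?N"
        then have "?P (v i) = 0"
          using split Pa by blast
        then show "(D (?A (v i)) - ?A (v i)) \<bullet> v i = 0"
          by (simp add: bilinear_rzero[OF bilin] linear_0[OF D])
      qed
      show "(D (?A (v i)) - ?A (v i)) \<bullet> v i = (e i - 1) * (br x (v i) \<bullet> v i)" if "i \<in> ?N" for i
        using that by (simp add: P inner_diff_left symD Dv algebra_simps)
    qed auto
    ultimately show ?thesis by simp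
  qed
  \<comment> \<open>\<open>D Q\<close> is again a derivation of \<open>nbracket\<close>, so
    \<open>tr (D D Q) = tr (D Q)\<close>. Subtracting this from \<open>tr (D D) = tr D\<close>
    removes the weights on \<open>aa br\<close>.\<close>
  have c4: "(\<Sum>i\<in>?N. (e i)\<^sup>2) = (\<Sum>i\<in>?N. e i)"
  proof -
    have linDQ: "linear (\<lambda>x. D (Q x))"
      using linear_compose[OF linQ D] by (simp add: o_def)
    have PD: "?P (D (Q x)) = 0" for x
      unfolding DQ by (rule PQ)
    have "derivation nbracket (\<lambda>x. D (Q x))"
      unfolding derivation_def using linDQ
      by (auto simp: Qbr linear_0[OF D] nbracket_def PD bilinear_lzero[OF bilin] bilinear_rzero[OF bilin])
    then have "tr (\<lambda>x. D (D (Q x)) - D (Q x)) = 0"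
      by (rule tr0)
    moreover have "linear (\<lambda>x. D (D (Q x)) - D (Q x))"
      using linear_compose[OF linDQ D] by (intro linear_compose_sub linDQ) (simp add: o_def)
    ultimately have 1: "(\<Sum>i\<in>Basis. (D (D (Q (v i))) - D (Q (v i))) \<bullet> v i) = 0"
      by (simp add: tr_frame[OF v])
    have linDD: "linear (\<lambda>x. D (D x))"
      using linear_compose[OF D D] by (simp add: o_def)
    have 2: "(\<Sum>i\<in>Basis. (e i)\<^sup>2 - e i) = 0"
      using trD by (simp add: tr_frame[OF v D] tr_frame[OF v linDD] Dv linear_cmul[OF D] oframe_self[OF v] power2_eq_square
          sum_subtractf)
    have "(\<Sum>i\<in>Basis. (e i)\<^sup>2 - e i) = (\<Sum>i\<in>Basis. (D (D (Q (v i))) - D (Q (v i))) \<bullet> v i) + (\<Sum>i\<in>?N. (e i)\<^sup>2 - e i)"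
    proof -
      have "(\<Sum>i\<in>?N. (e i)\<^sup>2 - e i) = (\<Sum>i\<in>Basis. if v i \<in> nn br then (e i)\<^sup>2 - e i else 0)"
        by (rule sum.inter_filter) simp
      moreover have "(e i)\<^sup>2 - e i = (D (D (Q (v i))) - D (Q (v i))) \<bullet> v i + (if v i \<in> nn br then (e i)\<^sup>2 - e i else 0)"
        if i: "i \<in> Basis" for i
      proof (cases "v i \<in> nn br")
        case True
        then show ?thesis
          by (simp add: Q_def P linear_0[OF D])
      next
        case False
        then have "Q (v i) = v i"
          using split[OF i] Pa by (auto simp: Q_def)
        then show ?thesis
          using False by (simp add: Dv[OF i] linear_cmul[OF D] oframe_self[OF v i] inner_diff_left power2_eq_square)
      qed
      ultimately show ?thesis
        by (simp only: sum.distrib[symmetric] cong: sum.cong)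
    qed
    then have "(\<Sum>i\<in>?N. (e i)\<^sup>2 - e i) = 0"
      using 1 2 by simp
    then show ?thesis
      by (simp add: sum_subtractf)
  qed
  show thesis
    by (rule that[of v e]) (fact v split e0 c1 c2 c3 c4)+
qed

section \<open>The Einstein equation paired with the weights\<close>

theorem einstein_standard:
  assumes solvable: "solvable_algebra br" and einstein: "einstein br"
  shows "standard br"
proof -
  obtain v e where v: "oframe v" and split: "\<And>i. i \<in> Basis \<Longrightarrow> v i \<in> nn br \<or> v i \<in> aa br"
    and e0: "\<And>i. i \<in> Basis \<Longrightarrow> 0 < e i"
    and c1: "\<And>i j k. i \<in> Basis \<Longrightarrow> j \<in> Basis \<Longrightarrow> k \<in> Basis \<Longrightarrow> v i \<in> nn br \<Longrightarrow> v j \<in> nn br \<Longrightarrow>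
       br (v i) (v j) \<bullet> v k \<noteq> 0 \<Longrightarrow> e i + e j \<le> e k"
    and c2: "\<And>x j k. j \<in> Basis \<Longrightarrow> k \<in> Basis \<Longrightarrow> v j \<in> nn br \<Longrightarrow> br x (v j) \<bullet> v k \<noteq> 0 \<Longrightarrow> e j \<le> e k"
    and c3: "\<And>x. (\<Sum>i\<in>{i\<in>Basis. v i \<in> nn br}. (e i - 1) * (br x (v i) \<bullet> v i)) = 0"
    and c4: "(\<Sum>i\<in>{i\<in>Basis. v i \<in> nn br}. (e i)\<^sup>2) = (\<Sum>i\<in>{i\<in>Basis. v i \<in> nn br}. e i)"
    by (rule adapted_frame_exists[OF solvable]) blast
  obtain c where ric: "\<And>x. R_form br x x - (1/2) * killing_form br x x - br (mean_curvature_vector br) x \<bullet> x = c * (x \<bullet> x)"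
    using einstein_diagonal[OF einstein] by blast
  define H where "H = mean_curvature_vector br"
  \<comment> \<open>On \<open>aa br\<close> the weights from the grading are replaced by 0.\<close>
  define E where "E i = (if v i \<in> nn br then e i else 0)" for i
  define C where "C i j k = br (v i) (v j) \<bullet> v k" for i j k
  let ?N = "{i \<in> Basis. v i \<in> nn br}"
  have aa_orth: "x \<bullet> y = 0" if "x \<in> aa br" "y \<in> nn br" for x y
    using that by (auto simp: aa_def orthogonal_comp_def orthogonal_def inner_commute)
  have Ca: "C i j k = 0" if "v k \<in> aa br" for i j k
    unfolding C_def using aa_orth[OF that nn_bracket] by (simp add: inner_commute)
  have anti_C: "C i j k = - C j i k" for i j k
    unfolding C_def using anti[of "v i" "v j"] by simp
  have E0: "0 \<le> E i" if "i \<in> Basis" for i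
    using e0[OF that] by (simp add: E_def)
  \<comment> \<open>Multiplicativity if \<open>i\<close> and \<open>j\<close> both lie in
    \<open>nn br\<close>, invariance under derivations if one does, and positivity of
    \<open>e k\<close> if none does.\<close>
  have mono: "E i + E j \<le> E k" if ijk: "i \<in> Basis" "j \<in> Basis" "k \<in> Basis" and nz: "C i j k \<noteq> 0" for i j k
  proof -
    have k: "v k \<in> nn br"
      using Ca nz split[OF ijk(3)] by blast
    have nz': "C j i k \<noteq> 0"
      using nz anti_C[of i j k] by simp
    show ?thesis
      using c1[OF ijk] c2[OF ijk(2,3), of "v i"] c2[OF ijk(1,3), of "v j"] nz nz' k e0[OF ijk(3)]
      unfolding E_def C_def by auto
  qed
  define q where "q = (\<Sum>k\<in>?N. e k * (br H (v k) \<bullet> v k))"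
  have sumN: "(\<Sum>k\<in>?N. f k) = (\<Sum>k\<in>Basis. if v k \<in> nn br then f k else 0)" for f :: "'a \<Rightarrow> real"
    by (rule sum.inter_filter) simp
  \<comment> \<open>Two entries in opposite positions cannot both be nonzero: bracketing with
    \<open>v k\<close> raises weights by \<open>e k > 0\<close>.\<close>
  have killing0: "killing_form br (v k) (v k) = 0" if k: "k \<in> ?N" for k
    unfolding killing_form_frame[OF v]
  proof (intro sum.neutral ballI)
    fix i j :: 'a assume ij: "i \<in> Basis" "j \<in> Basis"
    have "C k i j = 0 \<or> C k j i = 0"
    proof (rule ccontr)
      assume nz: "\<not> (C k i j = 0 \<or> C k j i = 0)"
      then have "v i \<in> nn br" "v j \<in> nn br"
        using Ca split ij by blast+
      then show False
        using mono[of k i j] mono[of k j i] k ij nz e0[of k] by (auto simp: E_def)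
    qed
    then show "br (v k) (v i) \<bullet> v j * (br (v k) (v j) \<bullet> v i) = 0"
      by (auto simp: C_def)
  qed
  let ?S = "\<lambda>f. \<Sum>i\<in>Basis. \<Sum>j\<in>Basis. \<Sum>k\<in>(Basis :: 'a set). f i j k"
  have key: "(1/4) * ?S (\<lambda>i j k. (C i j k)\<^sup>2 * (E k - E i - E j)) = c * (\<Sum>k\<in>?N. e k) + q"
  proof -
    have ric_k: "c = (\<Sum>i\<in>Basis. \<Sum>j\<in>Basis. - (1/2) * (C k i j)\<^sup>2 + (1/4) * (C i j k)\<^sup>2) - br H (v k) \<bullet> v k"
      if k: "k \<in> ?N" for k
    proof -
      have "c = R_form br (v k) (v k) - br H (v k) \<bullet> v k"
        using ric[of "v k"] killing0[OF k] k oframe_self[OF v, of k] by (simp add: H_def)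
      then show ?thesis
        by (simp add: R_form_frame[OF v] C_def sum.distrib sum_subtractf sum_distrib_left sum_negf)
    qed
    have "c * (\<Sum>k\<in>?N. e k) + q = (\<Sum>k\<in>?N. e k * (c + br H (v k) \<bullet> v k))"
      by (simp add: q_def sum_distrib_left sum.distrib algebra_simps)
    also have "\<dots> = (\<Sum>k\<in>?N. E k * (\<Sum>i\<in>Basis. \<Sum>j\<in>Basis. - (1/2) * (C k i j)\<^sup>2 + (1/4) * (C i j k)\<^sup>2))"
    proof (rule sum.cong[OF refl])
      fix k assume k: "k \<in> ?N"
      have "c + br H (v k) \<bullet> v k = (\<Sum>i\<in>Basis. \<Sum>j\<in>Basis. - (1/2) * (C k i j)\<^sup>2 + (1/4) * (C i j k)\<^sup>2)"
        using ric_k[OF k] by linarith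
      then show "e k * (c + br H (v k) \<bullet> v k)
          = E k * (\<Sum>i\<in>Basis. \<Sum>j\<in>Basis. - (1/2) * (C k i j)\<^sup>2 + (1/4) * (C i j k)\<^sup>2)"
        using k by (simp add: E_def)
    qed
    also have "\<dots> = (\<Sum>k\<in>Basis. E k * (\<Sum>i\<in>Basis. \<Sum>j\<in>Basis. - (1/2) * (C k i j)\<^sup>2 + (1/4) * (C i j k)\<^sup>2))"
      unfolding sumN by (rule sum.cong) (auto simp: E_def)
    also have "\<dots> = ?S (\<lambda>k i j. E k * (- (1/2) * (C k i j)\<^sup>2)) + ?S (\<lambda>k i j. E k * ((1/4) * (C i j k)\<^sup>2))"
      by (simp only: sum_distrib_left sum.distrib distrib_left)
    also have "?S (\<lambda>k i j. E k * ((1/4) * (C i j k)\<^sup>2)) = ?S (\<lambda>i j k. E k * ((1/4) * (C i j k)\<^sup>2))"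
      by (subst sum.swap, rule sum.cong[OF refl], rule sum.swap)
    \<comment> \<open>By antisymmetry the squares do not change when the first two indices are
      exchanged, so the term splits evenly between \<open>E i\<close> and
      \<open>E j\<close>.\<close>
    also have "?S (\<lambda>k i j. E k * (- (1/2) * (C k i j)\<^sup>2))
        = ?S (\<lambda>i j k. E i * (- (1/4) * (C i j k)\<^sup>2)) + ?S (\<lambda>i j k. E j * (- (1/4) * (C i j k)\<^sup>2))"
    proof -
      have "?S (\<lambda>i j k. E j * (- (1/4) * (C i j k)\<^sup>2)) = ?S (\<lambda>j i k. E j * (- (1/4) * (C i j k)\<^sup>2))"
        by (rule sum.swap)
      also have "\<dots> = ?S (\<lambda>j i k. E j * (- (1/4) * (C j i k)\<^sup>2))"
      proof -
        have sq: "(C i j k)\<^sup>2 = (C j i k)\<^sup>2" for i j k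
          using anti_C[of i j k] by simp
        show ?thesis
          by (intro sum.cong refl) (subst sq, rule refl)
      qed
      finally show ?thesis
        by (simp add: sum.distrib[symmetric])
    qed
    also have "?S (\<lambda>i j k. E i * (- (1/4) * (C i j k)\<^sup>2)) + ?S (\<lambda>i j k. E j * (- (1/4) * (C i j k)\<^sup>2))
        + ?S (\<lambda>i j k. E k * ((1/4) * (C i j k)\<^sup>2)) = (1/4) * ?S (\<lambda>i j k. (C i j k)\<^sup>2 * (E k - E i - E j))"
      unfolding sum_distrib_left sum.distrib[symmetric]
      by (intro sum.cong refl) (simp add: algebra_simps)
    finally show ?thesis by simp
  qed
  \<comment> \<open>Brackets are orthogonal to \<open>x\<close>, so the second sum of
    \<open>R_form\<close> and the term with \<open>H\<close> vanish. What remains is minus the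
    squared norm of the symmetric part of \<open>br x\<close>.\<close>
  have ric_a: "c * (x \<bullet> x) = - (1/4) * (\<Sum>i\<in>Basis. \<Sum>j\<in>Basis. (br x (v i) \<bullet> v j + br x (v j) \<bullet> v i)\<^sup>2)"
    if x: "x \<in> aa br" for x
  proof -
    let ?X = "\<lambda>i j. br x (v i) \<bullet> v j"
    have n0: "br y z \<bullet> x = 0" for y z
      using aa_orth[OF x nn_bracket] by (simp add: inner_commute)
    have "(\<Sum>i\<in>Basis. \<Sum>j\<in>Basis. (?X i j + ?X j i)\<^sup>2)
        = (\<Sum>i\<in>Basis. \<Sum>j\<in>Basis. (?X i j)\<^sup>2) + (\<Sum>i\<in>Basis. \<Sum>j\<in>Basis. (?X j i)\<^sup>2)
          + 2 * (\<Sum>i\<in>Basis. \<Sum>j\<in>Basis. ?X i j * ?X j i)"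
      unfolding sum_distrib_left sum.distrib[symmetric]
      by (intro sum.cong refl) (simp add: power2_sum)
    also have "(\<Sum>i\<in>Basis. \<Sum>j\<in>Basis. (?X j i)\<^sup>2) = (\<Sum>i\<in>Basis. \<Sum>j\<in>Basis. (?X i j)\<^sup>2)"
      by (rule sum.swap)
    finally have sum: "(\<Sum>i\<in>Basis. \<Sum>j\<in>Basis. (?X i j + ?X j i)\<^sup>2)
        = 2 * (\<Sum>i\<in>Basis. \<Sum>j\<in>Basis. (?X i j)\<^sup>2) + 2 * killing_form br x x"
      by (simp add: killing_form_frame[OF v])
    have "- (1/2) * (\<Sum>i\<in>Basis. \<Sum>j\<in>Basis. (?X i j)\<^sup>2) - (1/2) * killing_form br x x = c * (x \<bullet> x)"
      using ric[of x] by (simp add: R_form_frame[OF v] n0)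
    moreover have "r = - (1/4) * (2 * S + 2 * k)" if "- (1/2) * S - (1/2) * k = r" for r S k :: real
      using that by (simp add: field_simps)
    ultimately show ?thesis
      unfolding sum by blast
  qed
  have HH: "H \<in> aa br" "H \<bullet> H = tr (br H)"
    using mean_curvature_aa mean_curvature_inner[OF mean_curvature_aa] by (simp_all add: H_def)
  have trN: "(\<Sum>k\<in>?N. br H (v k) \<bullet> v k) = tr (br H)"
    unfolding tr_frame[OF v lin_right] sumN
    by (rule sum.cong) (use split aa_orth[OF _ nn_bracket] in \<open>auto simp: inner_commute\<close>)
  \<comment> \<open>The trace identity \<open>c3\<close> removes the weights from \<open>q\<close>,
    leaving the trace of \<open>br H\<close>.\<close>
  have qH: "q = H \<bullet> H"
  proof -
    have "q - (\<Sum>k\<in>?N. br H (v k) \<bullet> v k) = (\<Sum>k\<in>?N. (e k - 1) * (br H (v k) \<bullet> v k))"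
      by (simp add: q_def sum_subtractf[symmetric] left_diff_distrib)
    then show ?thesis
      using c3[of H] trN HH by simp
  qed
  have trE: "0 \<le> (\<Sum>k\<in>?N. e k)"
    by (intro sum_nonneg) (use e0 less_imp_le in auto)
  \<comment> \<open>If \<open>H = 0\<close>, the sign of \<open>c\<close> is enough. Otherwise
    Cauchy-Schwarz gives \<open>q^2 \<le> - c q\<close> times the sum of the weights, and
    \<open>q = H \<bullet> H\<close> is cancelled.\<close>
  have final_le: "c * (\<Sum>k\<in>?N. e k) + q \<le> 0" if c: "c \<le> 0"
  proof (cases "H = 0")
    case True
    then show ?thesis
      using c trE qH by (simp add: mult_nonpos_nonneg)
  next
    case False
    then have q0: "0 < q"
      by (simp add: qH)
    let ?h = "\<lambda>k. br H (v k) \<bullet> v k"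
    have "(\<Sum>k\<in>?N. (?h k)\<^sup>2) \<le> - c * q"
    proof -
      have "(\<Sum>k\<in>?N. (?h k)\<^sup>2) \<le> (\<Sum>k\<in>Basis. (?h k)\<^sup>2)"
        by (rule sum_mono2) auto
      \<comment> \<open>The diagonal entries are among the entries of the symmetric part: the
        summand \<open>j = k\<close> alone gives the bound.\<close>
      also have "\<dots> \<le> (\<Sum>k\<in>Basis. (1/4) * (\<Sum>j\<in>Basis. (br H (v k) \<bullet> v j + br H (v j) \<bullet> v k)\<^sup>2))"
      proof (rule sum_mono)
        fix k :: 'a assume k: "k \<in> Basis"
        have "(?h k + ?h k)\<^sup>2 \<le> (\<Sum>j\<in>Basis. (br H (v k) \<bullet> v j + br H (v j) \<bullet> v k)\<^sup>2)"
          using k by (intro member_le_sum[of k Basis "\<lambda>j. (br H (v k) \<bullet> v j + br H (v j) \<bullet> v k)\<^sup>2"]) auto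
        then show "(?h k)\<^sup>2 \<le> (1/4) * (\<Sum>j\<in>Basis. (br H (v k) \<bullet> v j + br H (v j) \<bullet> v k)\<^sup>2)"
          by (simp add: power2_eq_square algebra_simps)
      qed
      also have "\<dots> = - (c * (H \<bullet> H))"
        unfolding ric_a[OF HH(1)] by (simp add: sum_distrib_left sum_negf)
      finally show ?thesis
        by (simp add: qH)
    qed
    then have "(\<Sum>k\<in>?N. (e k)\<^sup>2) * (\<Sum>k\<in>?N. (?h k)\<^sup>2) \<le> (\<Sum>k\<in>?N. e k) * (- c * q)"
      unfolding c4 using trE by (intro mult_left_mono)
    moreover have "q\<^sup>2 \<le> (\<Sum>k\<in>?N. (e k)\<^sup>2) * (\<Sum>k\<in>?N. (?h k)\<^sup>2)"
      unfolding q_def by (rule Cauchy_Schwarz_ineq_sum)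
    ultimately have "q * q \<le> (- c * (\<Sum>k\<in>?N. e k)) * q"
      by (simp add: power2_eq_square mult_ac)
    then have "q \<le> - c * (\<Sum>k\<in>?N. e k)"
      using q0 by (rule mult_right_le_imp_le)
    then show ?thesis by simp
  qed
  have zero: "br (v i) (v j) = 0"
    if ij: "i \<in> Basis" "j \<in> Basis" and a: "v i \<in> aa br" "v j \<in> aa br" for i j
  proof -
    \<comment> \<open>The sign of \<open>c\<close> comes from a unit vector of \<open>aa br\<close>,
      and here \<open>v i\<close> is one.\<close>
    have c: "c \<le> 0"
    proof -
      have "c * (v i \<bullet> v i) \<le> 0"
        unfolding ric_a[OF a(1)] by (simp add: sum_nonneg)
      then show ?thesis
        using oframe_self[OF v ij(1)] by simp
    qed
    have terms: "0 \<le> (C i j k)\<^sup>2 * (E k - E i - E j)" if "i \<in> Basis" "j \<in> Basis" "k \<in> Basis" for i j k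
      using mono[OF that] by (cases "C i j k = 0") auto
    have "?S (\<lambda>i j k. (C i j k)\<^sup>2 * (E k - E i - E j)) = 0"
    proof (rule antisym)
      show "?S (\<lambda>i j k. (C i j k)\<^sup>2 * (E k - E i - E j)) \<le> 0"
        using key final_le[OF c] by simp
    qed (intro sum_nonneg terms)
    then have "(C i j k)\<^sup>2 * (E k - E i - E j) = 0" if k: "k \<in> Basis" for k
      using terms ij k by (simp add: sum_nonneg_eq_0_iff sum_nonneg)
    moreover have notN: "v l \<notin> nn br" if "l \<in> Basis" "v l \<in> aa br" for l
      using aa_orth[OF that(2), of "v l"] oframe_self[OF v that(1)] by auto
    \<comment> \<open>With \<open>i\<close> and \<open>j\<close> in \<open>aa br\<close> the factor
      \<open>E k - E i - E j\<close> is \<open>e k > 0\<close> for \<open>v k\<close> in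
      \<open>nn br\<close>; for \<open>v k\<close> in \<open>aa br\<close> the coefficient is 0
      anyway.\<close>
    ultimately have "C i j k = 0" if k: "k \<in> Basis" for k
      using k e0[OF k] split[OF k] Ca[of k i j] notN[OF ij(1) a(1)] notN[OF ij(2) a(2)] by (fastforce simp: E_def)
    then show ?thesis
      by (intro oframe_eqI[OF v]) (simp add: C_def)
  qed
  have "br x y = 0" if x: "x \<in> aa br" and y: "y \<in> aa br" for x y
  proof -
    have "((x \<bullet> v i) * (y \<bullet> v j)) *\<^sub>R br (v i) (v j) = 0" if ij: "i \<in> Basis" "j \<in> Basis" for i j
      using split[OF ij(1)] split[OF ij(2)] zero[OF ij] aa_orth[OF x, of "v i"] aa_orth[OF y, of "v j"] by auto
    then show ?thesis
      by (subst bilinear_expand[OF bilin v v]) (simp add: sum.neutral)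
  qed
  then have "{br x y |x y. x \<in> aa br \<and> y \<in> aa br} \<subseteq> {0}"
    by blast
  then have "bracket_space br (aa br) (aa br) \<subseteq> {0}"
    unfolding bracket_space_def by (intro span_minimal) auto
  then show ?thesis
    using span_zero by (auto simp: standard_def bracket_space_def)
qed

end

theorem theorem3p1:
  fixes mul :: "'g::{t2_space, second_countable_topology} \<Rightarrow> 'g \<Rightarrow> 'g"
    and e :: 'g
    and iv :: "'g \<Rightarrow> 'g"
    and A :: "('g, 'a::euclidean_space) atlas"
    and g :: "'g \<Rightarrow> (('g \<Rightarrow> real) \<Rightarrow> real) \<Rightarrow> (('g \<Rightarrow> real) \<Rightarrow> real) \<Rightarrow> real"
    and \<phi> :: "'a \<Rightarrow> 'g vector_field"
  assumes "lie_group mul e iv A"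
    and "simply_connected (UNIV :: 'g set)"
    and "left_invariant_metric mul A g"
    and "lie_algebra_isometry mul e A g \<phi>"
    and "solvable_algebra (transported_bracket \<phi>)"
    and "einstein (transported_bracket \<phi>)"
  shows "standard (transported_bracket \<phi>)"
  by (rule lie_alg.einstein_standard[OF transported_bracket_lie_alg[OF assms(1,4)] assms(5,6)])

end
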